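(* Let $H$ be a finite index normal subgroup of $G=\mathrm{Aut}(F_2)$ such that $\mathrm{Inn}(F_2)\le H\le \mathrm{Aut}'(F_2)=\mathrm{Inn}(F_2)\rtimes\langle\alpha,\beta\rangle$, and let $n=[\mathrm{Aut}'(F_2):H]$. Then for every prime $p\nmid 6n$ there exists an explicitly constructed normal subgroup $M\le F_2$ of index dividing $144\cdot n^4\cdot p^{36\cdot n^4+1}$ such that $G(M)\le H$.
   Context: $F_2=\langle x,y\rangle$ is the free group on $x$ and $y$. $\alpha,\beta\in\mathrm{Aut}(F_2)$ are the automorphisms $\alpha: x\mapsto x,\ y\mapsto yx^2$ and $\beta: x\mapsto xy^2,\ y\mapsto y$. $\mathrm{Inn}(F_2)$ is the group of inner automorphisms. $\mathrm{Aut}'(F_2)$ is the preimage, under the natural surjection $\mathrm{Aut}(F_2)\to\mathrm{Aut}(F_2/F_2')=\mathrm{Aut}(\mathbb{Z}^2)=GL_2(\mathbb{Z})$ (whose kernel is $\mathrm{Inn}(F_2)$), of the finite index subgroup $\left\langle \begin{pmatrix}1&2\\0&1\end{pmatrix},\begin{pmatrix}1&0\\2&1\end{pmatrix}\right\rangle$, which is free of rank $2$; one has $\mathrm{Aut}'(F_2)=\mathrm{Inn}(F_2)\rtimes\langle\alpha,\beta\rangle$, with $\langle\alpha,\beta\rangle$ free on $\alpha,\beta$. For a normal subgroup $M\vartriangleleft F_2$ define $$G(M)=\{\sigma\in G \mid \sigma(M)=M \text{ and } \sigma \text{ acts trivially on } F_2/M\}.$$ The explicit construction of $M$ is as follows.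 Let $\Delta=\ker(F_2\to(\mathbb{Z}/2\mathbb{Z})^2)$, a subgroup of index $4$ which is freely generated by $e_1=x^2$, $e_2=yxy^{-1}x^{-1}$, $e_3=y^2$, $e_4=xyxy^{-1}$, $e_5=xy^2x^{-1}$. Let $\pi:\Delta\to\langle\alpha,\beta\rangle$ be the homomorphism with $e_1\mapsto\alpha$, $e_2\mapsto 1$, $e_3\mapsto\beta$, $e_4\mapsto\alpha^{-1}$, $e_5\mapsto\beta^{-1}$. Put $K=H\cap\langle\alpha,\beta\rangle$ and let $t_1=1$, $t_2=x$, $t_3=y$, $t_4=xy$ (representatives of the right cosets of $\Delta$ in $F_2$). Set $$N=F_2'F_2^6\cap\bigcap_{i=1}^4 t_i^{-1}\pi^{-1}(K)t_i,\qquad M=F_2'F_2^4\cap N'N^p,$$ where for a group $X$, $X'$ is its commutator subgroup and $X^k$ is the subgroup generated by $k$-th powers. *)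

theory Defs
  imports "HOL-Analysis.Determinants" "HOL-Computational_Algebra.Primes"
    "HOL-Algebra.Generated_Groups" "HOL-Algebra.Bij"
begin

section \<open>The free group on two generators\<close>

text \<open>Elements are reduced words; the letter \<open>(g, False)\<close> is the generator \<open>g\<close> and
  \<open>(g, True)\<close> its inverse.\<close>

datatype gen = GX | GY

type_synonym letter = "gen \<times> bool"
type_synonym word = "letter list"

definition inv_letter :: "letter \<Rightarrow> letter" where
  "inv_letter l = (fst l, \<not> snd l)"

definition reduced_word :: "word \<Rightarrow> bool" where
  "reduced_word w \<longleftrightarrow> successively (\<lambda>a b. b \<noteq> inv_letter a) w"

fun lcons :: "letter \<Rightarrow> word \<Rightarrow> word" where
  "lcons a [] = [a]"
| "lcons a (b # w) = (if b = inv_letter a then w else a # b # w)"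

definition F2 :: "word monoid" where
  "F2 = \<lparr>carrier = {w. reduced_word w}, mult = (\<lambda>u v. foldr lcons u v), one = []\<rparr>"

definition gx :: word where "gx = [(GX, False)]"
definition gy :: word where "gy = [(GY, False)]"

lemma inv_letter_inv [simp]: "inv_letter (inv_letter a) = a"
  by (simp add: inv_letter_def)

lemma inv_letter_neq [simp]: "inv_letter a \<noteq> a" "a \<noteq> inv_letter a"
  by (auto simp: inv_letter_def prod_eq_iff)

lemma reduced_Nil [simp]: "reduced_word []"
  by (simp add: reduced_word_def)

lemma reduced_single [simp]: "reduced_word [a]"
  by (simp add: reduced_word_def)

lemma reduced_Cons2 [simp]:
  "reduced_word (a # b # w) \<longleftrightarrow> b \<noteq> inv_letter a \<and> reduced_word (b # w)"
  by (simp add: reduced_word_def)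

lemma reduced_ConsD: "reduced_word (a # w) \<Longrightarrow> reduced_word w"
  by (cases w) auto

lemma reduced_lcons: "reduced_word w \<Longrightarrow> reduced_word (lcons a w)"
  by (cases w) (auto dest: reduced_ConsD)

lemma lcons_eq_Cons: "reduced_word (a # w) \<Longrightarrow> lcons a w = a # w"
  by (cases w) auto

lemma lcons_cancel: "reduced_word w \<Longrightarrow> lcons a (lcons (inv_letter a) w) = w"
  by (cases w) (auto simp: lcons_eq_Cons)

lemma reduced_foldr: "reduced_word v \<Longrightarrow> reduced_word (foldr lcons u v)"
  by (induction u) (auto intro: reduced_lcons)

lemma foldr_lcons_Nil: "reduced_word u \<Longrightarrow> foldr lcons u [] = u"
  by (induction u) (use reduced_ConsD lcons_eq_Cons in \<open>fastforce+\<close>)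

lemma foldr_lcons_lcons:
  assumes "reduced_word v" "reduced_word w"
  shows "foldr lcons (lcons a v) w = lcons a (foldr lcons v w)"
proof (cases v)
  case (Cons b v')
  then show ?thesis
    using assms lcons_cancel[OF reduced_foldr[OF assms(2)], of a v'] by auto
qed auto

lemma foldr_lcons_assoc:
  assumes "reduced_word v" "reduced_word w"
  shows "foldr lcons (foldr lcons u v) w = foldr lcons u (foldr lcons v w)"
  by (induction u) (auto simp: foldr_lcons_lcons reduced_foldr assms)

lemma foldr_lcons_inverse:
  "reduced_word w \<Longrightarrow> reduced_word v \<Longrightarrow> foldr lcons (map inv_letter (rev w)) (foldr lcons w v) = v"
proof (induction w arbitrary: v)
  case (Cons a w)
  have "lcons (inv_letter a) (lcons a (foldr lcons w v)) = foldr lcons w v"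
    using lcons_cancel[OF reduced_foldr[OF Cons.prems(2)], of "inv_letter a" w] by simp
  then show ?case
    using Cons reduced_ConsD by auto
qed auto

lemma group_F2: "group F2"
proof (rule groupI)
  fix w assume "w \<in> carrier F2"
  then have w: "reduced_word w" by (simp add: F2_def)
  have "foldr lcons (foldr lcons (map inv_letter (rev w)) []) w = []"
    using foldr_lcons_inverse[OF w, of "[]"] w
    by (simp add: foldr_lcons_assoc foldr_lcons_Nil)
  then show "\<exists>u\<in>carrier F2. u \<otimes>\<^bsub>F2\<^esub> w = \<one>\<^bsub>F2\<^esub>"
    by (intro bexI[of _ "foldr lcons (map inv_letter (rev w)) []"])
      (auto simp: F2_def intro: reduced_foldr)
qed (auto simp: F2_def reduced_foldr foldr_lcons_assoc)

interpretation F2: group F2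
  by (rule group_F2)

lemma gx_carrier [simp]: "gx \<in> carrier F2" and gy_carrier [simp]: "gy \<in> carrier F2"
  by (simp_all add: F2_def gx_def gy_def)


section \<open>Homomorphisms out of the free group\<close>

definition letter_val :: "('a, 'b) monoid_scheme \<Rightarrow> (gen \<Rightarrow> 'a) \<Rightarrow> letter \<Rightarrow> 'a" where
  "letter_val G f l = (if snd l then inv\<^bsub>G\<^esub> (f (fst l)) else f (fst l))"

definition free_lift :: "('a, 'b) monoid_scheme \<Rightarrow> (gen \<Rightarrow> 'a) \<Rightarrow> word \<Rightarrow> 'a" where
  "free_lift G f w = foldr (\<lambda>l r. letter_val G f l \<otimes>\<^bsub>G\<^esub> r) w \<one>\<^bsub>G\<^esub>"

context group
begin

lemma letter_val_closed: "range f \<subseteq> carrier G \<Longrightarrow> letter_val G f l \<in> carrier G"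
  by (auto simp: letter_val_def)

lemma free_lift_closed: "range f \<subseteq> carrier G \<Longrightarrow> free_lift G f w \<in> carrier G"
  by (induction w) (auto simp: free_lift_def letter_val_closed)

lemma letter_val_inv:
  "range f \<subseteq> carrier G \<Longrightarrow> letter_val G f (inv_letter l) = inv (letter_val G f l)"
  by (auto simp: letter_val_def inv_letter_def image_subset_iff)

lemma free_lift_Cons: "free_lift G f (a # w) = letter_val G f a \<otimes> free_lift G f w"
  by (simp add: free_lift_def)

lemma free_lift_lcons:
  assumes f: "range f \<subseteq> carrier G"
  shows "free_lift G f (lcons a w) = letter_val G f a \<otimes> free_lift G f w"
proof (cases w)
  case (Cons b w')
  have "letter_val G f a \<otimes> (inv (letter_val G f a) \<otimes> free_lift G f w') = free_lift G f w'"
    using letter_val_closed[OF f] free_lift_closed[OF f]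
    by (metis inv_closed m_assoc r_inv l_one)
  then show ?thesis
    by (auto simp: Cons free_lift_Cons letter_val_inv[OF f])
qed (auto simp: free_lift_def)

lemma free_lift_hom:
  assumes f: "range f \<subseteq> carrier G"
  shows "free_lift G f \<in> hom F2 G"
proof (rule homI)
  fix u v
  show "free_lift G f (u \<otimes>\<^bsub>F2\<^esub> v) = free_lift G f u \<otimes> free_lift G f v"
  proof (induction u)
    case Nil
    then show ?case
      using free_lift_closed[OF f] by (simp add: F2_def free_lift_def[of _ _ "[]"])
  next
    case (Cons a u)
    then show ?case
      using letter_val_closed[OF f] free_lift_closed[OF f]
      by (simp add: F2_def free_lift_lcons[OF f] free_lift_Cons m_assoc)
  qed
qed (rule free_lift_closed[OF f])

lemma free_lift_gen:
  assumes "range f \<subseteq> carrier G"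
  shows "free_lift G f gx = f GX" "free_lift G f gy = f GY"
  using assms by (auto simp: free_lift_def letter_val_def gx_def gy_def image_subset_iff)

end

lemma lcons_mult: "reduced_word (a # w) \<Longrightarrow> a # w = [a] \<otimes>\<^bsub>F2\<^esub> w"
  by (simp add: F2_def lcons_eq_Cons)

lemma F2_mult: "u \<otimes>\<^bsub>F2\<^esub> v = foldr lcons u v"
  by (simp add: F2_def)

lemma F2_one: "\<one>\<^bsub>F2\<^esub> = []"
  by (simp add: F2_def)

lemma inv_single: "inv\<^bsub>F2\<^esub> [a] = [inv_letter a]"
  by (rule F2.inv_equality) (simp_all add: F2_def)

lemma F2_hom_eqI:
  assumes "group G" and f: "f \<in> hom F2 G" and g: "g \<in> hom F2 G"
    and eq: "f gx = g gx" "f gy = g gy" and w: "w \<in> carrier F2"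
  shows "f w = g w"
proof -
  interpret f: group_hom F2 G f
    using f assms(1) by (simp add: group_hom_def group_hom_axioms_def group_F2)
  interpret g: group_hom F2 G g
    using g assms(1) by (simp add: group_hom_def group_hom_axioms_def group_F2)
  have letter: "f [a] = g [a]" for a
  proof -
    obtain c i where a: "a = (c, i)" by fastforce
    have pos: "f [(c, False)] = g [(c, False)]"
      using eq by (cases c) (auto simp: gx_def gy_def)
    have "[(c, True)] = inv\<^bsub>F2\<^esub> [(c, False)]"
      by (simp add: inv_single inv_letter_def)
    moreover have "[(c, False)] \<in> carrier F2" by (simp add: F2_def)
    ultimately show ?thesis
      using pos a by (cases i) (simp_all)
  qed
  have "reduced_word w" using w by (simp add: F2_def)
  then show ?thesis
  proof (induction w)
    case Nil
    then show ?case using f.hom_one g.hom_one by (simp add: F2_def)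
  next
    case (Cons a w)
    have "[a] \<in> carrier F2" "w \<in> carrier F2"
      using Cons.prems by (auto simp: F2_def dest: reduced_ConsD)
    then show ?case
      using Cons letter lcons_mult[OF Cons.prems] reduced_ConsD by (metis f.hom_mult g.hom_mult)
  qed
qed


section \<open>Automorphisms of the free group\<close>

abbreviation AutF2 :: "(word \<Rightarrow> word) monoid" where
  "AutF2 \<equiv> AutoGroup F2"

definition endo :: "word \<Rightarrow> word \<Rightarrow> word \<Rightarrow> word" where
  "endo a b = restrict (free_lift F2 (case_gen a b)) (carrier F2)"

definition aut_alpha :: "word \<Rightarrow> word" where
  "aut_alpha = endo gx (gy \<otimes>\<^bsub>F2\<^esub> gx [^]\<^bsub>F2\<^esub> (2::nat))"

definition aut_beta :: "word \<Rightarrow> word" where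
  "aut_beta = endo (gx \<otimes>\<^bsub>F2\<^esub> gy [^]\<^bsub>F2\<^esub> (2::nat)) gy"

definition AB :: "(word \<Rightarrow> word) set" where
  "AB = generate AutF2 {aut_alpha, aut_beta}"

lemma endo_hom: "a \<in> carrier F2 \<Longrightarrow> b \<in> carrier F2 \<Longrightarrow> endo a b \<in> hom F2 F2"
  using F2.free_lift_hom[of "case_gen a b"]
  by (auto simp: endo_def hom_def image_subset_iff Pi_iff split: gen.split)

lemma endo_gen [simp]:
  assumes "a \<in> carrier F2" "b \<in> carrier F2"
  shows "endo a b gx = a" "endo a b gy = b"
  using F2.free_lift_gen[of "case_gen a b"] assms
  by (auto simp: endo_def image_subset_iff split: gen.split)

lemma endo_auto:
  assumes "a \<in> carrier F2" "b \<in> carrier F2" "c \<in> carrier F2" "d \<in> carrier F2"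
    and "endo a b c = gx" "endo a b d = gy" "endo c d a = gx" "endo c d b = gy"
  shows "endo a b \<in> carrier AutF2"
proof -
  have id: "(\<lambda>w. w) \<in> hom F2 F2" by (simp add: hom_def)
  have h: "endo a b \<in> hom F2 F2" "endo c d \<in> hom F2 F2"
    using assms endo_hom by auto
  have "endo a b \<circ> endo c d \<in> hom F2 F2" "endo c d \<circ> endo a b \<in> hom F2 F2"
    using h by (auto intro: hom_compose)
  then have "endo a b (endo c d w) = w" "endo c d (endo a b w) = w" if "w \<in> carrier F2" for w
    using F2_hom_eqI[OF group_F2 _ id _ _ that] assms by fastforce+
  then have "bij_betw (endo a b) (carrier F2) (carrier F2)"
    using h by (intro bij_betw_byWitness[where f' = "endo c d"]) (auto simp: hom_def)
  then show ?thesis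
    using h by (simp add: AutoGroup_def auto_def Bij_def endo_def)
qed

lemma aut_alpha_closed: "aut_alpha \<in> carrier AutF2"
  unfolding aut_alpha_def
proof (rule endo_auto[where c = gx and d = "gy \<otimes>\<^bsub>F2\<^esub> inv\<^bsub>F2\<^esub> (gx [^]\<^bsub>F2\<^esub> (2::nat))"])
  interpret a: group_hom F2 F2 "endo gx (gy \<otimes>\<^bsub>F2\<^esub> gx [^]\<^bsub>F2\<^esub> (2::nat))"
    by (simp add: group_hom_def group_hom_axioms_def group_F2 endo_hom)
  interpret b: group_hom F2 F2 "endo gx (gy \<otimes>\<^bsub>F2\<^esub> inv\<^bsub>F2\<^esub> (gx [^]\<^bsub>F2\<^esub> (2::nat)))"
    by (simp add: group_hom_def group_hom_axioms_def group_F2 endo_hom)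
  show "endo gx (gy \<otimes>\<^bsub>F2\<^esub> gx [^]\<^bsub>F2\<^esub> (2::nat)) (gy \<otimes>\<^bsub>F2\<^esub> inv\<^bsub>F2\<^esub> (gx [^]\<^bsub>F2\<^esub> (2::nat))) = gy"
    by (simp add: a.hom_nat_pow F2.m_assoc)
  show "endo gx (gy \<otimes>\<^bsub>F2\<^esub> inv\<^bsub>F2\<^esub> (gx [^]\<^bsub>F2\<^esub> (2::nat))) (gy \<otimes>\<^bsub>F2\<^esub> gx [^]\<^bsub>F2\<^esub> (2::nat)) = gy"
    by (simp add: b.hom_nat_pow F2.m_assoc)
qed simp_all

lemma aut_beta_closed: "aut_beta \<in> carrier AutF2"
  unfolding aut_beta_def
proof (rule endo_auto[where c = "gx \<otimes>\<^bsub>F2\<^esub> inv\<^bsub>F2\<^esub> (gy [^]\<^bsub>F2\<^esub> (2::nat))" and d = gy])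
  interpret a: group_hom F2 F2 "endo (gx \<otimes>\<^bsub>F2\<^esub> gy [^]\<^bsub>F2\<^esub> (2::nat)) gy"
    by (simp add: group_hom_def group_hom_axioms_def group_F2 endo_hom)
  interpret b: group_hom F2 F2 "endo (gx \<otimes>\<^bsub>F2\<^esub> inv\<^bsub>F2\<^esub> (gy [^]\<^bsub>F2\<^esub> (2::nat))) gy"
    by (simp add: group_hom_def group_hom_axioms_def group_F2 endo_hom)
  show "endo (gx \<otimes>\<^bsub>F2\<^esub> gy [^]\<^bsub>F2\<^esub> (2::nat)) gy (gx \<otimes>\<^bsub>F2\<^esub> inv\<^bsub>F2\<^esub> (gy [^]\<^bsub>F2\<^esub> (2::nat))) = gx"
    by (simp add: a.hom_nat_pow F2.m_assoc)
  show "endo (gx \<otimes>\<^bsub>F2\<^esub> inv\<^bsub>F2\<^esub> (gy [^]\<^bsub>F2\<^esub> (2::nat))) gy (gx \<otimes>\<^bsub>F2\<^esub> gy [^]\<^bsub>F2\<^esub> (2::nat)) = gx"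
    by (simp add: b.hom_nat_pow F2.m_assoc)
qed simp_all

interpretation AutF2: group AutF2
  by (rule F2.AutoGroup)

lemma subgroup_AB: "subgroup AB AutF2"
  unfolding AB_def by (rule AutF2.generate_is_subgroup) (simp add: aut_alpha_closed aut_beta_closed)

lemma aut_in_AB: "aut_alpha \<in> AB" "aut_beta \<in> AB"
  by (auto simp: AB_def intro: generate.incl)

definition InnF2 :: "(word \<Rightarrow> word) set" where
  "InnF2 = (\<lambda>g. \<lambda>w\<in>carrier F2. g \<otimes>\<^bsub>F2\<^esub> w \<otimes>\<^bsub>F2\<^esub> inv\<^bsub>F2\<^esub> g) ` carrier F2"

text \<open>The exponent sums of \<open>x\<close> and \<open>y\<close> identify \<open>F\<^sub>2/F\<^sub>2'\<close> with \<open>\<int>\<^sup>2\<close>; columns of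
  \<open>abel_matrix \<sigma>\<close> are the classes of \<open>\<sigma>(x)\<close> and \<open>\<sigma>(y)\<close>.\<close>

definition expsum :: "gen \<Rightarrow> word \<Rightarrow> int" where
  "expsum g w = (\<Sum>l\<leftarrow>w. if fst l = g then (if snd l then - 1 else 1) else 0)"

definition abel :: "word \<Rightarrow> int ^ 2" where
  "abel w = vector [expsum GX w, expsum GY w]"

definition abel_matrix :: "(word \<Rightarrow> word) \<Rightarrow> int ^ 2 ^ 2" where
  "abel_matrix \<sigma> = transpose (vector [abel (\<sigma> gx), abel (\<sigma> gy)])"

definition GL2Z :: "(int ^ 2 ^ 2) monoid" where
  "GL2Z = \<lparr>carrier = {A. invertible A}, mult = (**), one = mat 1\<rparr>"

definition Aut'F2 :: "(word \<Rightarrow> word) set" where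
  "Aut'F2 = {\<sigma> \<in> carrier AutF2. abel_matrix \<sigma> \<in> generate GL2Z
     {vector [vector [1, 2], vector [0, 1]], vector [vector [1, 0], vector [2, 1]]}}"

text \<open>\<open>G(M)\<close> for \<open>G = Aut(F\<^sub>2)\<close>; \<open>M\<close> is meant to be normal in \<open>F\<^sub>2\<close>.\<close>

definition trivial_mod :: "word set \<Rightarrow> (word \<Rightarrow> word) set" where
  "trivial_mod M = {\<sigma> \<in> carrier AutF2. \<sigma> ` M = M \<and>
     (\<forall>w\<in>carrier F2. M #>\<^bsub>F2\<^esub> \<sigma> w = M #>\<^bsub>F2\<^esub> w)}"


section \<open>The construction of \<open>M\<close>\<close>

definition power_subgroup :: "('a, 'b) monoid_scheme \<Rightarrow> 'a set \<Rightarrow> nat \<Rightarrow> 'a set" where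
  "power_subgroup G S k = generate G ((\<lambda>g. g [^]\<^bsub>G\<^esub> k) ` S)"

text \<open>The product \<open>S' S\<^sup>k\<close>, for a subgroup \<open>S\<close> of \<open>F\<^sub>2\<close>.\<close>

definition derived_power :: "word set \<Rightarrow> nat \<Rightarrow> word set" where
  "derived_power S k = derived F2 S <#>\<^bsub>F2\<^esub> power_subgroup F2 S k"

definition Delta :: "word set" where
  "Delta = {w \<in> carrier F2. even (expsum GX w) \<and> even (expsum GY w)}"

definition e1 :: word where "e1 = gx [^]\<^bsub>F2\<^esub> (2::nat)"
definition e2 :: word where "e2 = gy \<otimes>\<^bsub>F2\<^esub> gx \<otimes>\<^bsub>F2\<^esub> inv\<^bsub>F2\<^esub> gy \<otimes>\<^bsub>F2\<^esub> inv\<^bsub>F2\<^esub> gx"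
definition e3 :: word where "e3 = gy [^]\<^bsub>F2\<^esub> (2::nat)"
definition e4 :: word where "e4 = gx \<otimes>\<^bsub>F2\<^esub> gy \<otimes>\<^bsub>F2\<^esub> gx \<otimes>\<^bsub>F2\<^esub> inv\<^bsub>F2\<^esub> gy"
definition e5 :: word where "e5 = gx \<otimes>\<^bsub>F2\<^esub> gy [^]\<^bsub>F2\<^esub> (2::nat) \<otimes>\<^bsub>F2\<^esub> inv\<^bsub>F2\<^esub> gx"

text \<open>Extensionality on \<open>Delta\<close> only serves to make \<open>\<pi>\<close> unique as a HOL function.\<close>

definition is_pi :: "(word \<Rightarrow> word \<Rightarrow> word) \<Rightarrow> bool" where
  "is_pi f \<longleftrightarrow> f \<in> extensional Delta \<and>
     f \<in> hom (F2\<lparr>carrier := Delta\<rparr>) (AutF2\<lparr>carrier := AB\<rparr>) \<and>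
     f e1 = aut_alpha \<and> f e2 = \<one>\<^bsub>AutF2\<^esub> \<and> f e3 = aut_beta \<and>
     f e4 = inv\<^bsub>AutF2\<^esub> aut_alpha \<and> f e5 = inv\<^bsub>AutF2\<^esub> aut_beta"

text \<open>The homomorphism \<open>\<pi>\<close> exists and is unique, so \<open>pi_hom\<close> below is well defined.
  Existence: read a word along the Schreier graph of \<open>Delta\<close>, whose vertices are the cosets of
  \<open>1, x, y, xy\<close>, given as pairs of parities.\<close>

lemma inv_gen: "inv\<^bsub>F2\<^esub> gx = [(GX, True)]" "inv\<^bsub>F2\<^esub> gy = [(GY, True)]"
  by (simp_all add: gx_def gy_def inv_single inv_letter_def)

lemma e_words:
  "e1 = [(GX, False), (GX, False)]"
  "e2 = [(GY, False), (GX, False), (GY, True), (GX, True)]"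
  "e3 = [(GY, False), (GY, False)]"
  "e4 = [(GX, False), (GY, False), (GX, False), (GY, True)]"
  "e5 = [(GX, False), (GY, False), (GY, False), (GX, True)]"
  unfolding e1_def e2_def e3_def e4_def e5_def inv_gen
  by (simp_all add: gx_def gy_def F2_def nat_pow_def inv_letter_def numeral_2_eq_2)

lemma expsum_Cons:
  "expsum g (a # w) = (if fst a = g then (if snd a then - 1 else 1) else 0) + expsum g w"
  by (simp add: expsum_def)

lemma expsum_Nil [simp]: "expsum g [] = 0"
  by (simp add: expsum_def)

lemma expsum_lcons: "expsum g (lcons a w) = expsum g (a # w)"
  by (cases w) (auto simp: expsum_Cons inv_letter_def)

lemma expsum_mult: "expsum g (u \<otimes>\<^bsub>F2\<^esub> v) = expsum g u + expsum g v"
  by (induction u) (auto simp: F2_def expsum_lcons expsum_Cons)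

lemma expsum_inv: "w \<in> carrier F2 \<Longrightarrow> expsum g (inv\<^bsub>F2\<^esub> w) = - expsum g w"
  using expsum_mult[of g "inv\<^bsub>F2\<^esub> w" w] by (simp add: F2_one)

lemma subgroup_Delta: "subgroup Delta F2"
proof
  show "\<one>\<^bsub>F2\<^esub> \<in> Delta" using F2.one_closed by (simp add: Delta_def) (simp add: F2_def)
qed (auto simp: Delta_def expsum_mult expsum_inv)

fun coset_step :: "bool \<times> bool \<Rightarrow> letter \<Rightarrow> bool \<times> bool" where
  "coset_step (r, s) (GX, i) = (\<not> r, s)"
| "coset_step (r, s) (GY, i) = (r, \<not> s)"

fun coset_label :: "bool \<times> bool \<Rightarrow> letter \<Rightarrow> word \<Rightarrow> word" where
  "coset_label (r, s) (GX, False) =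
     (if r then if s then inv\<^bsub>AutF2\<^esub> aut_alpha else aut_alpha else \<one>\<^bsub>AutF2\<^esub>)"
| "coset_label (r, s) (GX, True) =
     (if r then \<one>\<^bsub>AutF2\<^esub> else if s then aut_alpha else inv\<^bsub>AutF2\<^esub> aut_alpha)"
| "coset_label (r, s) (GY, False) =
     (if s then if r then inv\<^bsub>AutF2\<^esub> aut_beta else aut_beta else \<one>\<^bsub>AutF2\<^esub>)"
| "coset_label (r, s) (GY, True) =
     (if s then \<one>\<^bsub>AutF2\<^esub> else if r then aut_beta else inv\<^bsub>AutF2\<^esub> aut_beta)"

fun coset_walk :: "bool \<times> bool \<Rightarrow> word \<Rightarrow> word \<Rightarrow> word" where
  "coset_walk c [] = \<one>\<^bsub>AutF2\<^esub>"
| "coset_walk c (a # w) = coset_label c a \<otimes>\<^bsub>AutF2\<^esub> coset_walk (coset_step c a) w"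

lemma coset_label_AB: "coset_label c a \<in> AB"
  using aut_in_AB subgroup.one_closed[OF subgroup_AB] subgroup.m_inv_closed[OF subgroup_AB]
  by (cases "(c, a)" rule: coset_label.cases) auto

lemma coset_walk_AB: "coset_walk c w \<in> AB"
proof (induction w arbitrary: c)
  case (Cons a w)
  show ?case
    unfolding coset_walk.simps using subgroup.m_closed[OF subgroup_AB coset_label_AB Cons.IH] .
qed (simp add: subgroup.one_closed[OF subgroup_AB])

lemma coset_label_closed [simp]: "coset_label c a \<in> carrier AutF2"
  and coset_walk_closed [simp]: "coset_walk c w \<in> carrier AutF2"
  using coset_label_AB coset_walk_AB subgroup.subset[OF subgroup_AB] by blast+

lemma coset_step_inv [simp]: "coset_step (coset_step c a) (inv_letter a) = c"
  by (cases "(c, a)" rule: coset_step.cases) (auto simp: inv_letter_def)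

lemma coset_label_inv:
  "coset_label c a \<otimes>\<^bsub>AutF2\<^esub> coset_label (coset_step c a) (inv_letter a) = \<one>\<^bsub>AutF2\<^esub>"
  by (cases "(c, a)" rule: coset_label.cases)
    (auto simp: inv_letter_def aut_alpha_closed aut_beta_closed)

lemma coset_walk_lcons: "coset_walk c (lcons a w) = coset_walk c (a # w)"
proof (cases w)
  case (Cons b v)
  show ?thesis
  proof (cases "b = inv_letter a")
    case True
    then show ?thesis
      using Cons coset_label_inv[of c a]
      by (simp flip: AutF2.m_assoc)
  qed (simp add: Cons)
qed simp

lemma coset_step_lcons: "foldl coset_step c (lcons a w) = foldl coset_step c (a # w)"
  by (cases w) auto

lemma coset_walk_mult:
  "coset_walk c (u \<otimes>\<^bsub>F2\<^esub> v) = coset_walk c u \<otimes>\<^bsub>AutF2\<^esub> coset_walk (foldl coset_step c u) v"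
proof (induction u arbitrary: c)
  case (Cons a u)
  then show ?case by (simp add: F2_mult coset_walk_lcons AutF2.m_assoc)
qed (simp add: F2_mult)

lemma foldl_coset_step:
  "foldl coset_step (r, s) w = (r \<noteq> odd (expsum GX w), s \<noteq> odd (expsum GY w))"
proof (induction w arbitrary: r s)
  case (Cons a w)
  then show ?case by (cases "((r, s), a)" rule: coset_step.cases) (auto simp: expsum_Cons)
qed simp

lemma e_in_Delta: "e1 \<in> Delta" "e2 \<in> Delta" "e3 \<in> Delta" "e4 \<in> Delta" "e5 \<in> Delta"
  by (simp_all add: Delta_def e_words expsum_Cons F2_def inv_letter_def)

lemma is_pi_coset_walk: "is_pi (restrict (coset_walk (False, False)) Delta)"
proof -
  have step: "foldl coset_step (False, False) u = (False, False)" if "u \<in> Delta" for u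
    using that by (simp add: Delta_def foldl_coset_step)
  have "coset_walk (False, False) e1 = aut_alpha" "coset_walk (False, False) e2 = \<one>\<^bsub>AutF2\<^esub>"
    "coset_walk (False, False) e3 = aut_beta" "coset_walk (False, False) e4 = inv\<^bsub>AutF2\<^esub> aut_alpha"
    "coset_walk (False, False) e5 = inv\<^bsub>AutF2\<^esub> aut_beta"
    by (simp_all add: e_words aut_alpha_closed aut_beta_closed)
  moreover have "restrict (coset_walk (False, False)) Delta
      \<in> hom (F2\<lparr>carrier := Delta\<rparr>) (AutF2\<lparr>carrier := AB\<rparr>)"
    by (rule homI)
      (simp_all add: coset_walk_AB coset_walk_mult step subgroup.m_closed[OF subgroup_Delta])
  ultimately show ?thesis
    by (simp add: is_pi_def e_in_Delta)
qed

fun coset_rep :: "bool \<times> bool \<Rightarrow> word" where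
  "coset_rep (r, s) = (if r then [(GX, False)] else []) @ (if s then [(GY, False)] else [])"

lemma coset_rep_closed [simp]: "coset_rep c \<in> carrier F2"
  by (cases c) (auto simp: F2_def inv_letter_def)

lemma F2_inv_cancel:
  "u \<in> carrier F2 \<Longrightarrow> v \<in> carrier F2 \<Longrightarrow> inv\<^bsub>F2\<^esub> u \<otimes>\<^bsub>F2\<^esub> (u \<otimes>\<^bsub>F2\<^esub> v) = v"
  by (simp flip: F2.m_assoc)

lemma inv_coset_rep: "inv\<^bsub>F2\<^esub> coset_rep c = map inv_letter (rev (coset_rep c))"
  by (cases c, rule F2.inv_equality) (auto simp: F2_def inv_letter_def)

lemma inv_e_words:
  "inv\<^bsub>F2\<^esub> e1 = [(GX, True), (GX, True)]"
  "inv\<^bsub>F2\<^esub> e2 = [(GX, False), (GY, False), (GX, True), (GY, True)]"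
  "inv\<^bsub>F2\<^esub> e3 = [(GY, True), (GY, True)]"
  "inv\<^bsub>F2\<^esub> e4 = [(GY, False), (GX, True), (GY, True), (GX, True)]"
  "inv\<^bsub>F2\<^esub> e5 = [(GX, False), (GY, True), (GY, True), (GX, True)]"
  by (rule F2.inv_equality; simp add: e_words F2_def inv_letter_def)+

lemma is_pi_group_hom: "is_pi f \<Longrightarrow> group_hom (F2\<lparr>carrier := Delta\<rparr>) (AutF2\<lparr>carrier := AB\<rparr>) f"
  by (simp add: is_pi_def group_hom_def group_hom_axioms_def
      subgroup.subgroup_is_group[OF subgroup_Delta group_F2]
      subgroup.subgroup_is_group[OF subgroup_AB AutF2.is_group])

lemma is_pi_inv:
  assumes "is_pi f" "w \<in> Delta"
  shows "f (inv\<^bsub>F2\<^esub> w) = inv\<^bsub>AutF2\<^esub> f w"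
proof -
  interpret group_hom "F2\<lparr>carrier := Delta\<rparr>" "AutF2\<lparr>carrier := AB\<rparr>" f
    using assms(1) by (rule is_pi_group_hom)
  show ?thesis
    using hom_inv[of w] hom_closed[of w] assms(2)
    by (simp add: F2.m_inv_consistent[OF subgroup_Delta] AutF2.m_inv_consistent[OF subgroup_AB])
qed

lemma is_pi_label:
  assumes "is_pi f"
  defines "g \<equiv> \<lambda>c a. coset_rep c \<otimes>\<^bsub>F2\<^esub> [a] \<otimes>\<^bsub>F2\<^esub> inv\<^bsub>F2\<^esub> coset_rep (coset_step c a)"
  shows "g c a \<in> Delta \<and> f (g c a) = coset_label c a"
proof -
  interpret f: group_hom "F2\<lparr>carrier := Delta\<rparr>" "AutF2\<lparr>carrier := AB\<rparr>" f
    using assms(1) by (rule is_pi_group_hom)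
  have D: "[] \<in> Delta" "inv\<^bsub>F2\<^esub> e1 \<in> Delta" "inv\<^bsub>F2\<^esub> e2 \<in> Delta" "inv\<^bsub>F2\<^esub> e3 \<in> Delta"
    "inv\<^bsub>F2\<^esub> e4 \<in> Delta" "inv\<^bsub>F2\<^esub> e5 \<in> Delta"
    using e_in_Delta subgroup.one_closed[OF subgroup_Delta] subgroup.m_inv_closed[OF subgroup_Delta]
    by (auto simp: F2_def)
  have F: "f [] = \<one>\<^bsub>AutF2\<^esub>"
    using f.hom_one by (simp add: F2_def)
  have F': "f e1 = aut_alpha" "f e2 = \<one>\<^bsub>AutF2\<^esub>" "f e3 = aut_beta"
    "f e4 = inv\<^bsub>AutF2\<^esub> aut_alpha" "f e5 = inv\<^bsub>AutF2\<^esub> aut_beta"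
    using assms(1) by (simp_all add: is_pi_def)
  have I: "f (inv\<^bsub>F2\<^esub> e1) = inv\<^bsub>AutF2\<^esub> aut_alpha" "f (inv\<^bsub>F2\<^esub> e2) = \<one>\<^bsub>AutF2\<^esub>"
    "f (inv\<^bsub>F2\<^esub> e3) = inv\<^bsub>AutF2\<^esub> aut_beta" "f (inv\<^bsub>F2\<^esub> e4) = aut_alpha"
    "f (inv\<^bsub>F2\<^esub> e5) = aut_beta"
    by (simp_all add: is_pi_inv[OF assms(1)] e_in_Delta F' aut_alpha_closed aut_beta_closed)
  show ?thesis
    unfolding g_def inv_coset_rep F2_mult
    using D F e_in_Delta[unfolded e_words] D(2-)[unfolded inv_e_words]
      F'[unfolded e_words] I[unfolded inv_e_words]
    by (cases "(c, a)" rule: coset_label.cases) (auto simp: inv_letter_def)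
qed

lemma is_pi_coset_rep:
  assumes "is_pi f" "reduced_word w"
  defines "d \<equiv> \<lambda>c w. coset_rep c \<otimes>\<^bsub>F2\<^esub> w \<otimes>\<^bsub>F2\<^esub> inv\<^bsub>F2\<^esub> coset_rep (foldl coset_step c w)"
  shows "d c w \<in> Delta \<and> f (d c w) = coset_walk c w"
proof -
  interpret f: group_hom "F2\<lparr>carrier := Delta\<rparr>" "AutF2\<lparr>carrier := AB\<rparr>" f
    using assms(1) by (rule is_pi_group_hom)
  show ?thesis
    using assms(2)
  proof (induction w arbitrary: c)
    case Nil
    have "d c [] = \<one>\<^bsub>F2\<^esub>"
      by (simp add: d_def F2_one) (metis F2.r_inv F2.r_one F2_one coset_rep_closed)
    then show ?case
      using f.hom_one subgroup.one_closed[OF subgroup_Delta] by simp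
  next
    case (Cons a w)
    let ?c = "coset_step c a"
    define g where "g = coset_rep c \<otimes>\<^bsub>F2\<^esub> [a] \<otimes>\<^bsub>F2\<^esub> inv\<^bsub>F2\<^esub> coset_rep ?c"
    have g: "g \<in> Delta" "f g = coset_label c a"
      using is_pi_label[OF assms(1)] by (auto simp: g_def)
    have IH: "d ?c w \<in> Delta" "f (d ?c w) = coset_walk ?c w"
      using Cons.IH[OF reduced_ConsD[OF Cons.prems], of ?c] by blast+
    have [simp]: "[a] \<in> carrier F2" "w \<in> carrier F2"
      using Cons.prems by (auto simp: F2_def dest: reduced_ConsD)
    have "d c (a # w) = g \<otimes>\<^bsub>F2\<^esub> d ?c w"
      unfolding d_def g_def foldl.simps unfolding lcons_mult[OF Cons.prems]
      by (simp add: F2.m_assoc F2_inv_cancel)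
    then show ?case
      using g IH f.hom_mult[of g "d ?c w"] subgroup.m_closed[OF subgroup_Delta] by simp
  qed
qed

lemma is_pi_unique:
  assumes "is_pi f" "w \<in> Delta"
  shows "f w = coset_walk (False, False) w"
proof -
  have w: "w \<in> carrier F2" "reduced_word w" "foldl coset_step (False, False) w = (False, False)"
    using assms(2) by (simp_all add: Delta_def F2_def foldl_coset_step)
  then have "coset_rep (False, False) \<otimes>\<^bsub>F2\<^esub> w \<otimes>\<^bsub>F2\<^esub> inv\<^bsub>F2\<^esub> coset_rep (False, False) = w"
    using F2.inv_one by (simp add: F2_one F2_mult foldr_lcons_Nil)
  then show ?thesis
    using is_pi_coset_rep[OF assms(1) w(2), of "(False, False)"] w(3) by simp
qed

lemma pi_unique: "\<exists>!f. is_pi f"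
proof -
  have "f = restrict (coset_walk (False, False)) Delta" if f: "is_pi f" for f
    using f by (intro extensionalityI[of f Delta]) (auto simp: is_pi_def is_pi_unique[OF f])
  then show ?thesis
    using is_pi_coset_walk by blast
qed

definition pi_hom :: "word \<Rightarrow> word \<Rightarrow> word" where
  "pi_hom = (THE f. is_pi f)"

definition K_sub :: "(word \<Rightarrow> word) set \<Rightarrow> (word \<Rightarrow> word) set" where
  "K_sub H = H \<inter> AB"

definition pi_preimage :: "(word \<Rightarrow> word) set \<Rightarrow> word set" where
  "pi_preimage K = {w \<in> Delta. pi_hom w \<in> K}"

definition N_sub :: "(word \<Rightarrow> word) set \<Rightarrow> word set" where
  "N_sub H = derived_power (carrier F2) 6 \<inter>
     (\<Inter>t\<in>{\<one>\<^bsub>F2\<^esub>, gx, gy, gx \<otimes>\<^bsub>F2\<^esub> gy}.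
        (\<lambda>w. inv\<^bsub>F2\<^esub> t \<otimes>\<^bsub>F2\<^esub> w \<otimes>\<^bsub>F2\<^esub> t) ` pi_preimage (K_sub H))"

definition M_sub :: "(word \<Rightarrow> word) set \<Rightarrow> nat \<Rightarrow> word set" where
  "M_sub H p = derived_power (carrier F2) 4 \<inter> derived_power (N_sub H) p"

end

theory Submission
  imports Defs "HOL-Algebra.SndIsomorphismGrp" "HOL-Algebra.Multiplicative_Group"
begin

text \<open>
  Write \<open>F\<close> for the free group, \<open>c = [x, y]\<close> and \<open>D = N' N\<^sup>p\<close>. An automorphism \<open>\<sigma>\<close> acting trivially
  on \<open>F/M\<close> is the identity on the abelianization modulo \<open>4\<close>. Nielsen reduction shows that the cosets
  of \<open>Inn(F) \<langle>\<alpha>, \<beta>\<rangle>\<close> in \<open>Aut(F)\<close> are represented by 24 explicit automorphisms, of which only the identity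
  has this property modulo \<open>4\<close>; hence \<open>\<sigma>\<close> is conjugation by some \<open>g\<close> after some \<open>\<delta>\<close> in \<open>\<langle>\<alpha>, \<beta>\<rangle>\<close>.

  As \<open>\<alpha>\<close> and \<open>\<beta>\<close> fix \<open>c\<close>, the element \<open>g\<close> commutes with \<open>c\<close> modulo \<open>D\<close>. Counting modulo \<open>p\<close> how
  often the loop \<open>c\<^sup>m\<close> (where \<open>m\<close> is the order of \<open>c\<close> modulo \<open>N\<close>) and its translate by \<open>g\<close> traverse each
  edge of the Cayley graph of \<open>F/N\<close> gives \<open>g \<in> \<langle>c\<rangle> N\<close>.

  On \<open>\<Delta>\<close> one has \<open>\<pi>(\<delta> d) = u \<pi>(d) u\<inverse>\<close>, where \<open>u\<close> arises from \<open>\<delta>\<close> by inverting \<open>\<alpha>\<close> and \<open>\<beta>\<close>; modulo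
  inner automorphisms, \<open>u\<close> is the conjugate of \<open>\<delta>\<close> by \<open>x \<mapsto> x\<inverse>, y \<mapsto> y\<close>. So \<open>\<pi>(g) u\<close> is central modulo
  \<open>K' K\<^sup>p\<close>, and edge counts in the Cayley graph of \<open>\<langle>\<alpha>, \<beta>\<rangle>/K\<close> put it into \<open>K\<close>. Since \<open>\<pi>(c) = 1\<close> and
  \<open>\<pi>(N) \<subseteq> K\<close>, also \<open>u\<close> is in \<open>K\<close>, and \<open>\<delta>\<close> is in the normal subgroup \<open>H\<close>. The freeness of
  \<open>\<langle>\<alpha>, \<beta>\<rangle>\<close> is avoided by lifting \<open>\<pi>\<close> to a homomorphism \<open>\<Delta> \<rightarrow> F\<close>.

  The index of \<open>M\<close> comes from \<open>[F : N] | 36 n\<^sup>4\<close>, from the Schreier bound \<open>[F : N] + 1\<close> on the number of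
  generators of \<open>N\<close>, and from \<open>D \<subseteq> F' F\<^sup>6\<close>, whose image in \<open>F/F' F\<^sup>4\<close> has order \<open>4\<close>.
\<close>

abbreviation F2_times :: "word \<Rightarrow> word \<Rightarrow> word" (infixl "\<cdot>" 70) where
  "u \<cdot> v \<equiv> u \<otimes>\<^bsub>F2\<^esub> v"

abbreviation AutF2_times :: "(word \<Rightarrow> word) \<Rightarrow> (word \<Rightarrow> word) \<Rightarrow> word \<Rightarrow> word" (infixl "\<star>" 70) where
  "\<sigma> \<star> \<tau> \<equiv> \<sigma> \<otimes>\<^bsub>AutF2\<^esub> \<tau>"

abbreviation F2_inverse :: "word \<Rightarrow> word" ("inv\<^sub>F _" [81] 80) where
  "inv\<^sub>F u \<equiv> inv\<^bsub>F2\<^esub> u"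

abbreviation AutF2_inverse :: "(word \<Rightarrow> word) \<Rightarrow> word \<Rightarrow> word" ("inv\<^sub>A _" [81] 80) where
  "inv\<^sub>A \<sigma> \<equiv> inv\<^bsub>AutF2\<^esub> \<sigma>"

abbreviation F2_unit :: word ("\<one>\<^sub>F") where
  "\<one>\<^sub>F \<equiv> \<one>\<^bsub>F2\<^esub>"

abbreviation AutF2_unit :: "word \<Rightarrow> word" ("\<one>\<^sub>A") where
  "\<one>\<^sub>A \<equiv> \<one>\<^bsub>AutF2\<^esub>"

abbreviation F2_coset :: "word set \<Rightarrow> word \<Rightarrow> word set" (infixl "#>\<^sub>F" 60) where
  "S #>\<^sub>F w \<equiv> S #>\<^bsub>F2\<^esub> w"

abbreviation AutF2_coset :: "(word \<Rightarrow> word) set \<Rightarrow> (word \<Rightarrow> word) \<Rightarrow> (word \<Rightarrow> word) set"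
  (infixl "#>\<^sub>A" 60) where
  "S #>\<^sub>A \<sigma> \<equiv> S #>\<^bsub>AutF2\<^esub> \<sigma>"

abbreviation F2_rcosets :: "word set \<Rightarrow> word set set" ("rcosets\<^sub>F _" [81] 80) where
  "rcosets\<^sub>F S \<equiv> rcosets\<^bsub>F2\<^esub> S"

section \<open>Indices of subgroups\<close>

lemma (in group) r_coset_eq_iff:
  assumes "subgroup H G" "x \<in> carrier G" "y \<in> carrier G"
  shows "H #> x = H #> y \<longleftrightarrow> x \<otimes> inv y \<in> H"
proof -
  have "H #> x = H #> y \<longleftrightarrow> x \<in> H #> y"
    using assms by (metis repr_independence rcos_self)
  also have "\<dots> \<longleftrightarrow> x \<otimes> inv y \<in> H"
    using subgroup.rcos_module[OF assms(1) is_group assms(3,2)] .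
  finally show ?thesis .
qed

text \<open>A fixed representative \<open>\<rho> C\<close> of every coset of \<open>B\<close> turns
  a coset \<open>C\<close> of \<open>B\<close> and a coset \<open>X\<close> of \<open>A\<close>
  inside \<open>B\<close> into the coset \<open>X #> \<rho> C\<close> of \<open>A\<close>. This
  correspondence is bijective, which gives the tower law.\<close>

lemma (in group) index_tower:
  assumes A: "subgroup A G" and B: "subgroup B G" and "A \<subseteq> B"
    and finB: "finite (rcosets B)" and finA: "finite (rcosets\<^bsub>G\<lparr>carrier := B\<rparr>\<^esub> A)"
  shows "finite (rcosets A) \<and>
    card (rcosets A) = card (rcosets B) * card (rcosets\<^bsub>G\<lparr>carrier := B\<rparr>\<^esub> A)"
proof -
  interpret B: group "G\<lparr>carrier := B\<rparr>"
    using B is_group by (rule subgroup.subgroup_is_group)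
  have BG: "B \<subseteq> carrier G" using B by (rule subgroup.subset)
  define \<rho> where "\<rho> C = (SOME x. x \<in> carrier G \<and> C = B #> x)" for C
  have \<rho>: "\<rho> C \<in> carrier G \<and> B #> \<rho> C = C" if "C \<in> rcosets B" for C
    using that someI_ex[of "\<lambda>x. x \<in> carrier G \<and> C = B #> x"] by (auto simp: RCOSETS_def \<rho>_def)
  have rA: "rcosets\<^bsub>G\<lparr>carrier := B\<rparr>\<^esub> A = (\<lambda>x. A #> x) ` B"
    by (auto simp: RCOSETS_def r_coset_def)
  have AG: "A \<subseteq> carrier G" using A by (rule subgroup.subset)
  have "bij_betw (\<lambda>(C, X). X #> \<rho> C) ((rcosets B) \<times> (rcosets\<^bsub>G\<lparr>carrier := B\<rparr>\<^esub> A)) (rcosets A)"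
    unfolding bij_betw_def
  proof
    show "inj_on (\<lambda>(C, X). X #> \<rho> C) ((rcosets B) \<times> (rcosets\<^bsub>G\<lparr>carrier := B\<rparr>\<^esub> A))"
    proof (rule inj_onI, clarify)
      fix C X C' X'
      assume C: "C \<in> rcosets B" "C' \<in> rcosets B"
        and X: "X \<in> rcosets\<^bsub>G\<lparr>carrier := B\<rparr>\<^esub> A" "X' \<in> rcosets\<^bsub>G\<lparr>carrier := B\<rparr>\<^esub> A"
        and eq: "X #> \<rho> C = X' #> \<rho> C'"
      obtain b b' where b: "b \<in> B" "b' \<in> B" "X = A #> b" "X' = A #> b'"
        using X unfolding rA by auto
      have bG: "b \<in> carrier G" "b' \<in> carrier G" using b BG by auto
      have eq': "A #> (b \<otimes> \<rho> C) = A #> (b' \<otimes> \<rho> C')"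
        using eq \<rho> C b bG by (simp add: coset_mult_assoc[OF AG])
      then have in_A: "b \<otimes> \<rho> C \<otimes> inv (b' \<otimes> \<rho> C') \<in> A"
        using r_coset_eq_iff[OF A] bG \<rho> C by simp
      \<comment> \<open>Cancelling \<open>b\<close> and \<open>b'\<close>, which lie in
        \<open>B\<close>, shows that the two representatives lie in the same coset of
        \<open>B\<close>.\<close>
      have "\<rho> C \<otimes> inv \<rho> C' = inv b \<otimes> (b \<otimes> \<rho> C \<otimes> inv (b' \<otimes> \<rho> C')) \<otimes> b'"
        using bG \<rho> C by (simp add: inv_mult_group m_assoc) (simp flip: m_assoc)
      also have "\<dots> \<in> B"
        using in_A \<open>A \<subseteq> B\<close> b by (meson B subgroup.m_closed subgroup.m_inv_closed subsetD)
      finally have CC: "C = C'"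
        using r_coset_eq_iff[OF B] \<rho> C by metis
      have "A #> b = A #> b'"
        using in_A r_coset_eq_iff[OF A] bG \<rho> C unfolding CC
        by (simp add: inv_mult_group m_assoc) (simp flip: m_assoc)
      then show "C = C' \<and> X = X'" using CC b by simp
    qed
    show "(\<lambda>(C, X). X #> \<rho> C) ` ((rcosets B) \<times> (rcosets\<^bsub>G\<lparr>carrier := B\<rparr>\<^esub> A)) = rcosets A"
    proof (intro subset_antisym subsetI)
      fix Y assume "Y \<in> (\<lambda>(C, X). X #> \<rho> C) ` ((rcosets B) \<times> (rcosets\<^bsub>G\<lparr>carrier := B\<rparr>\<^esub> A))"
      then obtain C b where "C \<in> rcosets B" "b \<in> B" "Y = A #> b #> \<rho> C"
        unfolding rA by auto
      moreover from this have "Y = A #> (b \<otimes> \<rho> C)"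
        using BG \<rho> by (simp add: coset_mult_assoc[OF AG] subset_iff)
      ultimately show "Y \<in> rcosets A"
        using BG \<rho> rcosetsI[OF AG, of "b \<otimes> \<rho> C"] by (simp add: subset_iff)
    next
      fix Y assume "Y \<in> rcosets A"
      then obtain h where h: "h \<in> carrier G" "Y = A #> h" by (auto simp: RCOSETS_def)
      define C where "C = B #> h"
      have C: "C \<in> rcosets B" using h by (auto simp: C_def RCOSETS_def)
      have b: "h \<otimes> inv \<rho> C \<in> B"
        using r_coset_eq_iff[OF B h(1), of "\<rho> C"] \<rho>[OF C] by (simp add: C_def)
      have "Y = A #> (h \<otimes> inv \<rho> C) #> \<rho> C"
        using h \<rho>[OF C] by (simp add: coset_mult_assoc[OF AG] m_assoc)
      then show "Y \<in> (\<lambda>(C, X). X #> \<rho> C) ` ((rcosets B) \<times> (rcosets\<^bsub>G\<lparr>carrier := B\<rparr>\<^esub> A))"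
        using b C unfolding rA by force
    qed
  qed
  from bij_betw_finite[OF this] bij_betw_same_card[OF this] show ?thesis
    using finA finB by (simp add: card_cartesian_product)
qed

text \<open>By the first isomorphism theorem the cosets of the kernel correspond to the elements of
  the image, whose order divides that of \<open>J\<close> by Lagrange. The conditions that cut
  \<open>N\<close> and \<open>M\<close> out of larger groups are kernels of this kind.\<close>

lemma (in group) index_kernel_dvd:
  assumes X: "subgroup X G" and Q: "group Q" and h: "h \<in> hom (G\<lparr>carrier := X\<rparr>) Q"
    and J: "subgroup J Q" "finite J" "h ` X \<subseteq> J"
  shows "finite (rcosets\<^bsub>G\<lparr>carrier := X\<rparr>\<^esub> {x \<in> X. h x = \<one>\<^bsub>Q\<^esub>}) \<and>
    card (rcosets\<^bsub>G\<lparr>carrier := X\<rparr>\<^esub> {x \<in> X. h x = \<one>\<^bsub>Q\<^esub>}) dvd card J"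
proof -
  interpret Q: group Q by fact
  interpret J: group "Q\<lparr>carrier := J\<rparr>"
    using J(1) Q by (rule subgroup.subgroup_is_group)
  interpret h: group_hom "G\<lparr>carrier := X\<rparr>" Q h
    using h Q X by (simp add: group_hom_def group_hom_axioms_def subgroup.subgroup_is_group is_group)
  have img: "subgroup (h ` X) Q"
    using h.subgroup_img_is_subgroup[of X] subgroup.subgroup_is_group[OF X is_group]
      group.subgroup_self by fastforce
  then have img': "subgroup (h ` X) (Q\<lparr>carrier := J\<rparr>)"
    using J Q.subgroup_incl by blast
  have "group_hom (G\<lparr>carrier := X\<rparr>) (Q\<lparr>carrier := h ` X\<rparr>) h"
    using h Q.subgroup_imp_group[OF img] X
    by (auto simp: group_hom_def group_hom_axioms_def subgroup.subgroup_is_group is_group hom_def)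
  then have "(\<lambda>Y. the_elem (h ` Y)) \<in> iso (G\<lparr>carrier := X\<rparr> Mod kernel (G\<lparr>carrier := X\<rparr>) (Q\<lparr>carrier := h ` X\<rparr>) h)
      (Q\<lparr>carrier := h ` X\<rparr>)"
    by (rule group_hom.FactGroup_iso_set) simp
  then have bij: "bij_betw (\<lambda>Y. the_elem (h ` Y)) (rcosets\<^bsub>G\<lparr>carrier := X\<rparr>\<^esub> {x \<in> X. h x = \<one>\<^bsub>Q\<^esub>}) (h ` X)"
    by (simp add: iso_def FactGroup_def kernel_def)
  have "finite (h ` X)" using J finite_subset by blast
  moreover have "card J = card (rcosets\<^bsub>Q\<lparr>carrier := J\<rparr>\<^esub> (h ` X)) * card (h ` X)"
    using J.lagrange[OF img'] by (simp add: order_def)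
  then have "card (h ` X) dvd card J" by simp
  ultimately show ?thesis
    using bij_betw_finite[OF bij] bij_betw_same_card[OF bij] by simp
qed

lemma (in group) subgroup_mult_mem_iff:
  assumes "subgroup H G" "y \<in> H" "x \<in> carrier G"
  shows "x \<otimes> y \<in> H \<longleftrightarrow> x \<in> H"
proof -
  have "x = (x \<otimes> y) \<otimes> inv y"
    using assms subgroup.mem_carrier[OF assms(1,2)] by (simp add: m_assoc)
  then show ?thesis
    using assms subgroup.m_closed subgroup.m_inv_closed by metis
qed

lemma (in group_hom) hom_commute_iff:
  assumes "x \<in> carrier G" "y \<in> carrier G"
  shows "h (x \<otimes> y \<otimes> inv x \<otimes> inv y) = \<one>\<^bsub>H\<^esub> \<longleftrightarrow> h x \<otimes>\<^bsub>H\<^esub> h y = h y \<otimes>\<^bsub>H\<^esub> h x"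
proof -
  have "h (x \<otimes> y \<otimes> inv x \<otimes> inv y) = h x \<otimes>\<^bsub>H\<^esub> h y \<otimes>\<^bsub>H\<^esub> inv\<^bsub>H\<^esub> (h y \<otimes>\<^bsub>H\<^esub> h x)"
    using assms by (simp add: H.inv_mult_group H.m_assoc)
  then show ?thesis
    using assms by (metis H.inv_closed H.inv_equality H.inv_inv H.m_closed H.r_inv hom_closed)
qed

text \<open>Induction on the generators. If \<open>B\<close> is generated by the earlier ones and
  \<open>d\<close> is the least positive exponent that brings \<open>g\<close> into
  \<open>B\<close>, then \<open>d\<close> divides \<open>k\<close>, and the products
  \<open>b \<otimes> g [^] i\<close> with \<open>i < d\<close> run once through the enlarged group.
  So its order is that of \<open>B\<close> times \<open>d\<close>.\<close>

lemma (in comm_group) card_generate_dvd: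
  assumes "finite S" "S \<subseteq> carrier G" "0 < (k::nat)" "\<And>s. s \<in> S \<Longrightarrow> s [^] k = \<one>"
  shows "finite (generate G S) \<and> card (generate G S) dvd k ^ card S"
  using assms(1,2,4)
proof (induction S)
  case empty
  then show ?case by (simp add: generate_empty)
next
  case (insert g S)
  define B where "B = generate G S"
  have g: "g \<in> carrier G" "g [^] k = \<one>" and S: "S \<subseteq> carrier G" using insert by auto
  have B: "subgroup B G" unfolding B_def using S by (rule generate_is_subgroup)
  have BG: "B \<subseteq> carrier G" using B by (rule subgroup.subset)
  have finB: "finite B" "card B dvd k ^ card S" using insert by (auto simp: B_def)
  define d where "d = (LEAST d::nat. 0 < d \<and> g [^] d \<in> B)"
  have d: "0 < d" "g [^] d \<in> B"
    using LeastI[of "\<lambda>d::nat. 0 < d \<and> g [^] d \<in> B" k] assms(3) g subgroup.one_closed[OF B]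
    by (auto simp: d_def)
  have min: "g [^] i \<notin> B" if "0 < i" "i < d" for i
    using not_less_Least[of i "\<lambda>d::nat. 0 < d \<and> g [^] d \<in> B"] that by (auto simp: d_def)
  have mod: "g [^] i \<in> B \<longleftrightarrow> g [^] (i mod d) \<in> B" for i :: nat
  proof -
    have "g [^] i = g [^] (i mod d) \<otimes> (g [^] d) [^] (i div d)"
      using g by (simp add: nat_pow_pow nat_pow_mult)
    moreover have "(g [^] d) [^] (i div d) \<in> B"
      using d B by (metis subgroup_int_pow_closed int_pow_int)
    ultimately show ?thesis
      using subgroup_mult_mem_iff[OF B] g by simp
  qed
  have "g [^] (k mod d) \<in> B"
    using mod[of k] g subgroup.one_closed[OF B] by simp
  then have "d dvd k"
    using min[of "k mod d"] d(1) by (metis dvd_eq_mod_eq_0 gr0I mod_less_divisor)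
  let ?T = "(\<lambda>(b, i). b \<otimes> g [^] i) ` (B \<times> {..<d})"
  have T: "b \<otimes> g [^] i \<in> ?T" if "b \<in> B" for b and i :: nat
  proof -
    have "b \<otimes> g [^] i = (b \<otimes> (g [^] d) [^] (i div d)) \<otimes> g [^] (i mod d)"
      using g that BG by (simp add: m_assoc nat_pow_pow nat_pow_mult subset_iff)
    moreover have "b \<otimes> (g [^] d) [^] (i div d) \<in> B"
      using d B that by (metis subgroup_int_pow_closed int_pow_int subgroup.m_closed)
    ultimately show ?thesis using d(1) by force
  qed
  have "subgroup ?T G"
  proof (rule subgroupI)
    show "?T \<subseteq> carrier G" using BG g by auto
    show "?T \<noteq> {}" using T subgroup.one_closed[OF B] by blast
    fix a assume "a \<in> ?T"
    then obtain b i where b: "b \<in> B" "a = b \<otimes> g [^] i" "i < d" by auto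
    \<comment> \<open>The power \<open>g [^] d\<close> lies in \<open>B\<close>, so pulling out its
      inverse leaves the nonnegative exponent \<open>d - i\<close>.\<close>
    then have "inv a = (inv b \<otimes> inv (g [^] d)) \<otimes> g [^] (d - i)"
    proof -
      have "g [^] d = g [^] i \<otimes> g [^] (d - i)" using b g by (simp add: nat_pow_mult)
      then show ?thesis
        using b BG g by (simp add: inv_mult m_assoc subset_iff)
    qed
    moreover have "inv b \<otimes> inv (g [^] d) \<in> B"
      using b d B by (meson subgroup.m_closed subgroup.m_inv_closed)
    ultimately show "inv a \<in> ?T" using T by metis
    fix a' assume "a' \<in> ?T"
    then obtain b' i' where b': "b' \<in> B" "a' = b' \<otimes> g [^] i'" "i' < d" by auto
    have "a \<otimes> a' = (b \<otimes> b') \<otimes> g [^] (i + i')"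
      using b b' BG g by (simp add: m_ac subset_iff flip: nat_pow_mult)
    then show "a \<otimes> a' \<in> ?T" using T subgroup.m_closed[OF B b(1) b'(1)] by metis
  qed
  moreover have "insert g S \<subseteq> ?T"
  proof -
    have "b \<in> ?T" if "b \<in> B" for b
      using T[OF that, of 0] that BG by (auto simp: subset_iff)
    moreover have "g \<in> ?T"
      using T[OF subgroup.one_closed[OF B], of 1] g by simp
    ultimately show ?thesis using generate.incl[of _ S G] by (auto simp: B_def)
  qed
  ultimately have 1: "generate G (insert g S) \<subseteq> ?T"
    using generate_subgroup_incl by blast
  have 2: "?T \<subseteq> generate G (insert g S)"
  proof -
    have sub: "subgroup (generate G (insert g S)) G"
      using g S by (intro generate_is_subgroup) auto
    have "B \<subseteq> generate G (insert g S)"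
      unfolding B_def by (rule mono_generate) auto
    moreover have "g [^] i \<in> generate G (insert g S)" for i :: nat
      using subgroup_int_pow_closed[OF sub generate.incl[of g]] by (metis insertI1 int_pow_int)
    ultimately show ?thesis using subgroup.m_closed[OF sub] by auto
  qed
  have inj: "inj_on (\<lambda>(b, i). b \<otimes> g [^] i) (B \<times> {..<d})"
  proof -
    have *: "b = b' \<and> i = i'" if b: "b \<in> B" "b' \<in> B" and i: "i \<le> i'" "i' < d"
      and eq: "b \<otimes> g [^] i = b' \<otimes> g [^] i'" for b b' and i i' :: nat
    proof -
      have bG: "b \<in> carrier G" "b' \<in> carrier G" using b BG by auto
      have "b \<otimes> g [^] i = b' \<otimes> g [^] (i' - i) \<otimes> g [^] i"
        using eq i bG g by (simp add: m_assoc nat_pow_mult)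
      then have eq': "b = b' \<otimes> g [^] (i' - i)"
        using bG g by simp
      then have "g [^] (i' - i) = inv b' \<otimes> b"
        using bG g by (simp add: inv_solve_left)
      then have "g [^] (i' - i) \<in> B"
        using b B by (metis subgroup.m_closed subgroup.m_inv_closed)
      then have "i = i'" using min[of "i' - i"] i by fastforce
      then show ?thesis using eq' bG by simp
    qed
    show ?thesis
    proof (rule inj_onI, clarify)
      fix b b' i i'
      assume "b \<in> B" "b' \<in> B" "i < d" "i' < d" "b \<otimes> g [^] i = b' \<otimes> g [^] i'"
      then show "b = b' \<and> i = i'"
        using *[of b b' i i'] *[of b' b i' i] by (cases "i \<le> i'") auto
    qed
  qed
  have "finite ?T" using finB by simp
  moreover have "card ?T dvd k ^ card S * k"
    using finB \<open>d dvd k\<close> by (simp add: card_image[OF inj] card_cartesian_product mult_dvd_mono)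
  moreover have "generate G (insert g S) = ?T" using 1 2 by blast
  ultimately show ?case using insert(1,2) by (simp add: mult.commute)
qed

section \<open>The subgroups \<open>S' S\<^sup>k\<close>\<close>

text \<open>Both factors of \<open>derived_power S k\<close> are generated by elements of the two
  kinds tested here. The later upper bounds for such subgroups all come from this criterion.\<close>

lemma derived_power_least:
  assumes "subgroup T F2" "\<And>x y. x \<in> S \<Longrightarrow> y \<in> S \<Longrightarrow> x \<cdot> y \<cdot> inv\<^sub>F x \<cdot> inv\<^sub>F y \<in> T"
    and "\<And>x. x \<in> S \<Longrightarrow> x [^]\<^bsub>F2\<^esub> k \<in> T"
  shows "derived_power S k \<subseteq> T"
proof -
  have "derived F2 S \<subseteq> T"
    unfolding derived_def by (rule F2.generate_subgroup_incl[OF _ assms(1)]) (use assms in auto)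
  moreover have "power_subgroup F2 S k \<subseteq> T"
    unfolding power_subgroup_def by (rule F2.generate_subgroup_incl[OF _ assms(1)]) (use assms in auto)
  ultimately show ?thesis
    using subgroup.m_closed[OF assms(1)] by (auto simp: derived_power_def set_mult_def)
qed

text \<open>A conjugate of a k-th power is the k-th power of a conjugate, so normality of
  \<open>S\<close> passes to the generators of the power subgroup; the derived subgroup of
  \<open>S\<close> is normal as well.\<close>

lemma derived_power_normal:
  assumes "S \<lhd> F2"
  shows "derived_power S k \<lhd> F2"
proof -
  interpret S: normal S F2 by fact
  have "power_subgroup F2 S k \<lhd> F2"
    unfolding power_subgroup_def
  proof (rule F2.normal_generateI)
    show "(\<lambda>g. g [^]\<^bsub>F2\<^esub> k) ` S \<subseteq> carrier F2" by auto
    fix h g assume "h \<in> (\<lambda>g. g [^]\<^bsub>F2\<^esub> k) ` S" and g: "g \<in> carrier F2"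
    then obtain s where s: "s \<in> S" "h = s [^]\<^bsub>F2\<^esub> k" by auto
    have "g \<cdot> h \<cdot> inv\<^sub>F g = (g \<cdot> s \<cdot> inv\<^sub>F g) [^]\<^bsub>F2\<^esub> k"
      unfolding s(2) using g s(1)
    proof (induction k)
      case (Suc k)
      have "(g \<cdot> s \<cdot> inv\<^sub>F g) [^]\<^bsub>F2\<^esub> Suc k
          = (g \<cdot> s [^]\<^bsub>F2\<^esub> k \<cdot> inv\<^sub>F g) \<cdot> (g \<cdot> s \<cdot> inv\<^sub>F g)"
        using Suc by simp
      then show ?case using Suc(2,3) by (simp add: F2.m_assoc F2_inv_cancel)
    qed simp
    then show "g \<cdot> h \<cdot> inv\<^sub>F g \<in> (\<lambda>g. g [^]\<^bsub>F2\<^esub> k) ` S"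
      using S.inv_op_closed2[OF g s(1)] by blast
  qed
  then show ?thesis
    unfolding derived_power_def
    using F2.derived_is_normal[OF assms] group.normal_subgroup_set_mult_closed[OF group_F2] by blast
qed

lemma derived_power_memI:
  assumes "subgroup S F2" "x \<in> S"
  shows "y \<in> S \<Longrightarrow> x \<cdot> y \<cdot> inv\<^sub>F x \<cdot> inv\<^sub>F y \<in> derived_power S k"
    and "x [^]\<^bsub>F2\<^esub> k \<in> derived_power S k"
proof -
  have SG: "S \<subseteq> carrier F2" using assms(1) by (rule subgroup.subset)
  have xS: "x \<in> carrier F2" using assms SG by auto
  have p: "x [^]\<^bsub>F2\<^esub> k \<in> power_subgroup F2 S k"
    unfolding power_subgroup_def using assms(2) by (auto intro: generate.incl)
  have 1: "\<one>\<^sub>F \<in> power_subgroup F2 S k" "\<one>\<^sub>F \<in> derived F2 S"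
    unfolding power_subgroup_def derived_def by (rule generate.one)+
  have "\<one>\<^sub>F \<cdot> x [^]\<^bsub>F2\<^esub> k \<in> derived_power S k"
    unfolding derived_power_def set_mult_def using p 1 by blast
  then show "x [^]\<^bsub>F2\<^esub> k \<in> derived_power S k" using xS by simp
  assume y: "y \<in> S"
  let ?c = "x \<cdot> y \<cdot> inv\<^sub>F x \<cdot> inv\<^sub>F y"
  have "?c \<in> derived F2 S"
    unfolding derived_def using assms(2) y by (auto intro!: generate.incl)
  then have "?c \<cdot> \<one>\<^sub>F \<in> derived_power S k"
    unfolding derived_power_def set_mult_def using 1 by blast
  then show "?c \<in> derived_power S k" using xS y SG by (simp add: subset_iff)
qed

lemma derived_power_subset:
  assumes "subgroup S F2"
  shows "derived_power S k \<subseteq> S"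
  using assms by (intro derived_power_least)
    (auto intro: subgroup.m_closed subgroup.m_inv_closed, metis F2.subgroup_int_pow_closed int_pow_int)

text \<open>The quotient of \<open>N\<close> by \<open>derived_power N k\<close> is abelian and
  generated by the classes of \<open>S\<close>, each of which is killed by \<open>k\<close>. Its
  order therefore divides \<open>k ^ card S\<close>, and this divides \<open>k ^ r\<close>.\<close>

lemma index_derived_power:
  assumes N: "N \<lhd> F2" and S: "finite S" "N = generate F2 S" "card S \<le> r" and k: "0 < k"
  shows "finite (rcosets\<^bsub>F2\<lparr>carrier := N\<rparr>\<^esub> (derived_power N k)) \<and>
    card (rcosets\<^bsub>F2\<lparr>carrier := N\<rparr>\<^esub> (derived_power N k)) dvd k ^ r"
proof -
  let ?D = "derived_power N k"
  let ?G = "F2\<lparr>carrier := N\<rparr>"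
  let ?Q = "?G Mod ?D"
  have subN: "subgroup N F2" using N by (rule normal_imp_subgroup)
  have D: "?D \<lhd> ?G"
    using F2.normal_restrict_supergroup[OF subN derived_power_normal[OF N] derived_power_subset[OF subN]] .
  interpret N: group ?G using F2.subgroup_imp_group[OF subN] .
  interpret D: normal ?D ?G by fact
  interpret Q: group ?Q by (rule D.factorgroup_is_group)
  have SN: "S \<subseteq> N" using generate.incl[of _ S F2] unfolding S(2) by (rule subsetI)
  interpret h: group_hom ?G ?Q "\<lambda>a. ?D #>\<^bsub>?G\<^esub> a"
    using D.r_coset_hom_Mod by (simp add: group_hom_def group_hom_axioms_def)
  have car: "carrier ?Q = (\<lambda>a. ?D #>\<^bsub>?G\<^esub> a) ` N"
    by (simp add: carrier_FactGroup)
  have one: "?D #>\<^bsub>?G\<^esub> d = \<one>\<^bsub>?Q\<^esub>" if "d \<in> ?D" for d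
    using that D.rcos_const[OF N.is_group] by simp
  have "comm_group ?Q"
  proof (rule Q.group_comm_groupI)
    fix X Y assume "X \<in> carrier ?Q" "Y \<in> carrier ?Q"
    then obtain x y where x: "x \<in> N" "X = ?D #>\<^bsub>?G\<^esub> x" and y: "y \<in> N" "Y = ?D #>\<^bsub>?G\<^esub> y"
      unfolding car by auto
    have "x \<cdot> y \<cdot> inv\<^sub>F x \<cdot> inv\<^sub>F y \<in> ?D"
      using derived_power_memI(1)[OF subN x(1) y(1)] .
    then have "x \<otimes>\<^bsub>?G\<^esub> y \<otimes>\<^bsub>?G\<^esub> inv\<^bsub>?G\<^esub> x \<otimes>\<^bsub>?G\<^esub> inv\<^bsub>?G\<^esub> y \<in> ?D"
      using x y by (simp add: F2.m_inv_consistent[OF subN])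
    then have "?D #>\<^bsub>?G\<^esub> (x \<otimes>\<^bsub>?G\<^esub> y \<otimes>\<^bsub>?G\<^esub> inv\<^bsub>?G\<^esub> x \<otimes>\<^bsub>?G\<^esub> inv\<^bsub>?G\<^esub> y) = \<one>\<^bsub>?Q\<^esub>"
      by (rule one)
    then show "X \<otimes>\<^bsub>?Q\<^esub> Y = Y \<otimes>\<^bsub>?Q\<^esub> X"
      unfolding x(2) y(2) by (subst (asm) h.hom_commute_iff) (use x y in simp_all)
  qed
  then interpret Q: comm_group ?Q .
  have gen: "carrier ?Q = generate ?Q ((\<lambda>a. ?D #>\<^bsub>?G\<^esub> a) ` S)"
    unfolding car using h.generate_img[of S] SN F2.generate_consistent[OF SN subN] S(2) by simp
  have pow: "s [^]\<^bsub>?Q\<^esub> k = \<one>\<^bsub>?Q\<^esub>" if "s \<in> (\<lambda>a. ?D #>\<^bsub>?G\<^esub> a) ` S" for s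
  proof -
    obtain x where x: "x \<in> S" "s = ?D #>\<^bsub>?G\<^esub> x" using \<open>s \<in> _\<close> by auto
    then have "s [^]\<^bsub>?Q\<^esub> k = ?D #>\<^bsub>?G\<^esub> (x [^]\<^bsub>?G\<^esub> k)"
      using SN h.hom_nat_pow[of x k] by auto
    also have "x [^]\<^bsub>?G\<^esub> k = x [^]\<^bsub>F2\<^esub> k" by (simp add: F2.nat_pow_consistent[symmetric])
    finally show ?thesis using one derived_power_memI(2)[OF subN] x SN by auto
  qed
  have sub: "(\<lambda>a. ?D #>\<^bsub>?G\<^esub> a) ` S \<subseteq> carrier ?Q" using SN unfolding car by blast
  have "finite (carrier ?Q) \<and> card (carrier ?Q) dvd k ^ card ((\<lambda>a. ?D #>\<^bsub>?G\<^esub> a) ` S)"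
    unfolding gen by (rule Q.card_generate_dvd[OF finite_imageI[OF S(1)] sub k pow])
  moreover have "card ((\<lambda>a. ?D #>\<^bsub>?G\<^esub> a) ` S) \<le> r"
    using card_image_le[OF S(1)] S(3) le_trans by blast
  ultimately show ?thesis
    by (auto simp: FactGroup_def intro: dvd_trans le_imp_power_dvd)
qed

section \<open>Edge counts in Cayley graphs\<close>

lemma F2_singleton [simp]: "[a] \<in> carrier F2"
  by (simp add: F2_def)

lemma inv_letter_single: "[inv_letter a] = inv\<^sub>F [a]"
  by (simp add: inv_single)

lemma inv_letter_sel [simp]: "fst (inv_letter a) = fst a" "snd (inv_letter a) = (\<not> snd a)"
  by (simp_all add: inv_letter_def)

lemma F2_carrier_iff: "w \<in> carrier F2 \<longleftrightarrow> reduced_word w"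
  by (simp add: F2_def)

lemma F2_induct [consumes 1, case_names one letter]:
  assumes "w \<in> carrier F2" "P \<one>\<^sub>F"
    and "\<And>a w. w \<in> carrier F2 \<Longrightarrow> P w \<Longrightarrow> P ([a] \<cdot> w)"
  shows "P w"
  using assms(1)
proof (induction w)
  case Nil
  then show ?case using assms(2) by (simp add: F2_one)
next
  case (Cons a w)
  then have "w \<in> carrier F2" by (auto simp: F2_carrier_iff dest: reduced_ConsD)
  then show ?case using assms(3) Cons lcons_mult by (metis F2_carrier_iff)
qed

lemma (in group) inv_mult_cancel:
  "a \<in> carrier G \<Longrightarrow> b \<in> carrier G \<Longrightarrow> inv a \<otimes> (a \<otimes> b) = b"
  "a \<in> carrier G \<Longrightarrow> b \<in> carrier G \<Longrightarrow> a \<otimes> (inv a \<otimes> b) = b"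
  by (simp_all flip: m_assoc)

text \<open>The classes of \<open>x\<close> and \<open>y\<close> commute in \<open>G Mod H\<close>,
  so the class of \<open>x\<close> commutes with all powers of the class of
  \<open>y\<close>.\<close>

lemma (in normal) commutator_pow:
  assumes "x \<in> carrier G" "y \<in> carrier G" "x \<otimes> y \<otimes> inv x \<otimes> inv y \<in> H"
  shows "x \<otimes> y [^] (n::nat) \<otimes> inv x \<otimes> inv (y [^] n) \<in> H"
proof -
  interpret h: group_hom G "G Mod H" "\<lambda>a. H #> a"
    using r_coset_hom_Mod factorgroup_is_group is_group
    by (simp add: group_hom_def group_hom_axioms_def)
  have mem: "H #> z = \<one>\<^bsub>G Mod H\<^esub> \<longleftrightarrow> z \<in> H" if "z \<in> carrier G" for z
    using coset_join1[OF _ that subgroup_axioms] coset_join2[OF that subgroup_axioms] by auto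
  have "(H #> x) \<otimes>\<^bsub>G Mod H\<^esub> (H #> y) = (H #> y) \<otimes>\<^bsub>G Mod H\<^esub> (H #> x)"
    using iffD1[OF h.hom_commute_iff[OF assms(1,2)] iffD2[OF mem assms(3)]] assms by blast
  then have "(H #> y) [^]\<^bsub>G Mod H\<^esub> n \<otimes>\<^bsub>G Mod H\<^esub> (H #> x)
      = (H #> x) \<otimes>\<^bsub>G Mod H\<^esub> (H #> y) [^]\<^bsub>G Mod H\<^esub> n"
    by (rule h.H.group_commutes_pow[OF sym]) (use assms in \<open>auto intro: h.hom_closed\<close>)
  then have "H #> (x \<otimes> y [^] n \<otimes> inv x \<otimes> inv (y [^] n)) = \<one>\<^bsub>G Mod H\<^esub>"
    using assms(1,2) by (subst h.hom_commute_iff) (simp_all add: h.hom_nat_pow)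
  then show ?thesis
    by (subst (asm) mem) (use assms in simp_all)
qed

text \<open>Reading a word from the vertex \<open>r\<close> gives a path in the Cayley graph, whose
  edge \<open>(v, g)\<close> leads from v to v q(g). An inverse letter passes an edge backwards,
  which counts -1 and is recorded at the end of the step, because that is where the edge
  starts.\<close>

fun traversals :: "('r, 'm) monoid_scheme \<Rightarrow> (word \<Rightarrow> 'r) \<Rightarrow> 'r \<Rightarrow> word \<Rightarrow> 'r \<times> gen \<Rightarrow> int" where
  "traversals R q r [] e = 0"
| "traversals R q r (a # w) e =
     (if snd a then - of_bool (e = (r \<otimes>\<^bsub>R\<^esub> q [a], fst a)) else of_bool (e = (r, fst a)))
     + traversals R q (r \<otimes>\<^bsub>R\<^esub> q [a]) w e"

locale cayley = group_hom F2 R q for R (structure) and q :: "word \<Rightarrow> 'r"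
begin

abbreviation "trav \<equiv> traversals R q"

lemma q_inv_letter: "q [inv_letter a] = inv q [a]"
  by (simp add: inv_letter_single)

text \<open>Free reduction removes an edge that is passed and at once passed back, and such a pair
  contributes 0.\<close>

lemma traversals_lcons:
  assumes "r \<in> carrier R"
  shows "trav r (lcons a w) e = trav r (a # w) e"
proof (cases w)
  case (Cons b v)
  show ?thesis
  proof (cases "b = inv_letter a")
    case True
    have "r \<otimes> q [a] \<otimes> q [inv_letter a] = r"
      using assms by (simp add: H.m_assoc q_inv_letter)
    then show ?thesis
      using Cons True by simp
  qed (simp add: Cons)
qed simp

lemma traversals_mult:
  assumes "r \<in> carrier R" "u \<in> carrier F2" "v \<in> carrier F2"
  shows "trav r (u \<cdot> v) e = trav r u e + trav (r \<otimes> q u) v e"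
  using assms(2,1)
proof (induction u arbitrary: r)
  case Nil
  then show ?case
    using hom_one by (simp add: F2_mult F2_one)
next
  case (Cons a u)
  have red: "reduced_word (a # u)" and u: "u \<in> carrier F2"
    using Cons.prems by (auto simp: F2_carrier_iff dest: reduced_ConsD)
  have "q (a # u) = q [a] \<otimes> q u"
    using lcons_mult[OF red] hom_mult[of "[a]" u] u by simp
  moreover have "trav (r \<otimes> q [a]) (u \<cdot> v) e
      = trav (r \<otimes> q [a]) u e + trav (r \<otimes> q [a] \<otimes> q u) v e"
    using Cons u by simp
  ultimately show ?case
    using traversals_lcons[OF Cons.prems(2), of a "u \<cdot> v" e] Cons.prems(2) u
    by (simp add: F2_mult H.m_assoc)
qed

lemma traversals_one [simp]: "trav r \<one>\<^sub>F e = 0"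
  by (simp add: F2_one)

lemma traversals_inv:
  assumes "r \<in> carrier R" "u \<in> carrier F2"
  shows "trav r (inv\<^sub>F u) e = - trav (r \<otimes> inv q u) u e"
  using traversals_mult[of r "inv\<^sub>F u" u e] assms by simp

text \<open>Left multiplication by \<open>h\<close> is a symmetry of the Cayley graph: it carries
  the path read from \<open>r\<close> to the path read from \<open>h \<otimes> r\<close>.\<close>

lemma traversals_translate:
  assumes "h \<in> carrier R" "r \<in> carrier R" "v \<in> carrier R"
  shows "trav (h \<otimes> r) w (h \<otimes> v, g) = trav r w (v, g)"
  using assms(2)
proof (induction w arbitrary: r)
  case (Cons a w)
  have "h \<otimes> v = h \<otimes> r \<longleftrightarrow> v = r" "h \<otimes> v = h \<otimes> r \<otimes> q [a] \<longleftrightarrow> v = r \<otimes> q [a]"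
    using assms Cons.prems by (simp_all add: H.m_assoc)
  then show ?case
    using Cons assms by (simp add: H.m_assoc)
qed simp

lemma traversals_nat_pow:
  assumes "r \<in> carrier R" "u \<in> carrier F2"
  shows "trav r (u [^]\<^bsub>F2\<^esub> (m::nat)) e = (\<Sum>i<m. trav (r \<otimes> q u [^] i) u e)"
  using assms by (induction m) (simp_all add: traversals_mult hom_nat_pow)

abbreviation "K \<equiv> kernel F2 R q"

lemma subgroup_K: "subgroup K F2"
  by (rule subgroup_kernel)

lemma K_D: "u \<in> K \<Longrightarrow> u \<in> carrier F2" "u \<in> K \<Longrightarrow> q u = \<one>"
  by (auto simp: kernel_def)

text \<open>The loop \<open>u\<close> returns to its starting vertex, so the way out along
  \<open>f\<close> and the way back pass the same edges in opposite directions and cancel.\<close>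

lemma traversals_conj:
  assumes "r \<in> carrier R" "u \<in> K" "f \<in> carrier F2"
  shows "trav r (f \<cdot> u \<cdot> inv\<^sub>F f) e = trav (r \<otimes> q f) u e"
  using assms K_D[OF assms(2)] by (simp add: traversals_mult traversals_inv H.m_assoc)

text \<open>Elements of \<open>K\<close> are loops at every vertex, so on \<open>K\<close> the count
  is additive. A commutator then counts 0 and a k-th power counts a multiple of
  \<open>k\<close>.\<close>

lemma traversals_derived_power:
  assumes "w \<in> derived_power K k"
  shows "w \<in> K \<and> (\<forall>r\<in>carrier R. int k dvd trav r w e)"
proof -
  define S where "S = {w \<in> K. \<forall>r\<in>carrier R. int k dvd trav r w e}"
  have S: "subgroup S F2"
  proof
    show "S \<subseteq> carrier F2" by (auto simp: S_def kernel_def)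
    show "\<one>\<^sub>F \<in> S" by (simp add: S_def kernel_def)
    show "x \<cdot> y \<in> S" if "x \<in> S" "y \<in> S" for x y
      using that by (auto simp: S_def kernel_def traversals_mult)
    show "inv\<^sub>F x \<in> S" if "x \<in> S" for x
      using that by (auto simp: S_def kernel_def traversals_inv)
  qed
  have "derived_power K k \<subseteq> S"
    by (rule derived_power_least[OF S])
      (auto simp: S_def kernel_def traversals_mult traversals_inv traversals_nat_pow hom_nat_pow)
  then have "w \<in> S" using assms by blast
  then show ?thesis by (simp add: S_def)
qed

text \<open>Modulo \<open>derived_power K k\<close> the loop \<open>u\<close> agrees with its
  conjugate by \<open>f\<close>, and the edge counts of the conjugate are those of \<open>u\<close>
  translated by \<open>q f\<close>.\<close>

lemma traversals_commute:
  assumes u: "u \<in> K" and f: "f \<in> carrier F2" and v: "v \<in> carrier R"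
    and comm: "f \<cdot> u \<cdot> inv\<^sub>F f \<cdot> inv\<^sub>F u \<in> derived_power K k"
  shows "int k dvd trav \<one> u (inv q f \<otimes> v, g) - trav \<one> u (v, g)"
proof -
  let ?d = "f \<cdot> u \<cdot> inv\<^sub>F f \<cdot> inv\<^sub>F u"
  have uc: "u \<in> carrier F2" "q u = \<one>" using K_D[OF u] by auto
  have "int k dvd trav \<one> ?d (v, g)"
    using traversals_derived_power[OF comm, of "(v, g)"] by simp
  also have "trav \<one> ?d (v, g) = trav (q f) u (v, g) - trav \<one> u (v, g)"
    using traversals_conj[OF _ u f, of \<one>] uc f
    by (simp add: traversals_mult[where u = "f \<cdot> u \<cdot> inv\<^sub>F f"] traversals_inv)
  also have "trav (q f) u (v, g) = trav \<one> u (inv q f \<otimes> v, g)"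
    using traversals_translate[of "q f" \<one> "inv q f \<otimes> v" u g] f v
    by (simp add: H.inv_mult_cancel)
  finally show ?thesis .
qed

end

text \<open>As no exponent strictly between 0 and \<open>m\<close> makes \<open>c\<close> trivial,
  the first \<open>n\<close> powers are distinct and \<open>v\<close> is met at most once.\<close>

lemma (in group) sum_powers_of_bool:
  assumes "c \<in> carrier G" and min: "\<forall>i. 0 < i \<and> i < m \<longrightarrow> c [^] i \<noteq> \<one>" and "n \<le> m"
  shows "(\<Sum>i<n. of_bool (c [^] i = v)) = (of_bool (v \<in> (\<lambda>i::nat. c [^] i) ` {..<n}) :: int)"
proof -
  have *: "i = j" if "i \<le> j" "j < m" "c [^] i = c [^] j" for i j :: nat
  proof (rule ccontr)
    assume "i \<noteq> j"
    have "c [^] i \<otimes> c [^] (j - i) = c [^] (i + (j - i))"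
      using assms(1) by (rule nat_pow_mult)
    then have "c [^] i \<otimes> c [^] (j - i) = c [^] i \<otimes> \<one>"
      using assms(1) that(3) le_add_diff_inverse[OF that(1)] by simp
    then have "c [^] (j - i) = \<one>"
      using assms(1) by (metis Units_l_cancel Units_eq nat_pow_closed one_closed)
    then show False using min[rule_format, of "j - i"] that \<open>i \<noteq> j\<close> by simp
  qed
  then have inj: "inj_on (\<lambda>i::nat. c [^] i) {..<n}"
    using assms(3) by (intro inj_onI) (metis lessThan_iff nat_le_linear order_less_le_trans)
  have "(\<Sum>i<n. of_bool (c [^] i = v)) = (\<Sum>w\<in>(\<lambda>i::nat. c [^] i) ` {..<n}. of_bool (w = v) :: int)"
    by (simp add: sum.reindex[OF inj])
  also have "\<dots> = of_bool (v \<in> (\<lambda>i::nat. c [^] i) ` {..<n})"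
    by (simp add: of_bool_def sum.delta)
  finally show ?thesis .
qed

lemma (in group) finite_order_least:
  assumes c: "c \<in> carrier G" and "0 < (k::nat)" "c [^] k = \<one>"
  obtains m :: nat where "0 < m" "c [^] m = \<one>" "\<forall>i. 0 < i \<and> i < m \<longrightarrow> c [^] i \<noteq> \<one>"
    "generate G {c} = (\<lambda>i. c [^] i) ` {..<m}"
proof -
  define m where "m = (LEAST m::nat. 0 < m \<and> c [^] m = \<one>)"
  have m: "0 < m" "c [^] m = \<one>"
    using LeastI[of "\<lambda>m::nat. 0 < m \<and> c [^] m = \<one>" k] assms by (auto simp: m_def)
  have min: "c [^] i \<noteq> \<one>" if "0 < i" "i < m" for i
    using not_less_Least[of i "\<lambda>m::nat. 0 < m \<and> c [^] m = \<one>"] that by (auto simp: m_def)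
  have 1: "c [^] (z::int) \<in> (\<lambda>i. c [^] i) ` {..<m}" for z
  proof -
    have cm: "c [^] int m = \<one>" by (simp add: int_pow_int m)
    have "c [^] z = c [^] (int m * (z div int m) + z mod int m)" by simp
    also have "\<dots> = (c [^] int m) [^] (z div int m) \<otimes> c [^] (z mod int m)"
      using c by (simp only: int_pow_mult int_pow_pow)
    also have "\<dots> = c [^] (z mod int m)"
      using c unfolding cm by simp
    also have "\<dots> = c [^] nat (z mod int m)"
      using m(1) by (metis int_nat_eq int_pow_int mod_int_pos_iff of_nat_0_less_iff)
    finally show ?thesis using m(1) by (metis image_eqI lessThan_iff nat_less_iff pos_mod_bound pos_mod_sign of_nat_0_less_iff)
  qed
  have "generate G {c} = (\<lambda>i. c [^] i) ` {..<m}"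
    using 1 unfolding generate_pow[OF c] by (auto, metis int_pow_int)
  then show ?thesis using m min that by blast
qed

context cayley
begin

lemma traversals_gen_pow:
  assumes "r \<in> carrier R" "g' = (if g = GX then gx else gy)"
  shows "trav r (g' [^]\<^bsub>F2\<^esub> (m::nat)) (v, h) = (\<Sum>i<m. of_bool (h = g \<and> r \<otimes> q g' [^] i = v))"
proof -
  have "trav s g' (v, h) = of_bool (h = g \<and> s = v)" for s
    using assms(2) by (cases g) (auto simp: gx_def gy_def)
  moreover have "g' \<in> carrier F2" using assms(2) by simp
  ultimately show ?thesis using assms(1) by (simp add: traversals_nat_pow)
qed

text \<open>If \<open>m\<close> is the order of \<open>q g'\<close>, the \<open>m\<close>-th power
  of \<open>g'\<close> is a loop that passes the \<open>g\<close>-edges at the vertices of the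
  cyclic group of \<open>q g'\<close>, once each. Its translate by \<open>q f\<close> has the same
  counts modulo \<open>k\<close>, and \<open>1 < k\<close> separates 0 from 1; the claim is the
  comparison at the vertex 1.\<close>

lemma commuting_in_cyclic:
  assumes f: "f \<in> carrier F2" and k: "1 < k" and g': "g' = (if g = GX then gx else gy)"
    and m: "0 < (m::nat)" "q g' [^] m = \<one>"
    and comm: "\<And>u. u \<in> K \<Longrightarrow>
      f \<cdot> u \<cdot> inv\<^sub>F f \<cdot> inv\<^sub>F u \<in> derived_power K k"
  shows "inv q f \<in> generate R {q g'}"
proof -
  have g'c: "g' \<in> carrier F2" using g' by simp
  obtain m :: nat where m: "0 < m" "q g' [^] m = \<one>" and
    min: "\<forall>i. 0 < i \<and> i < m \<longrightarrow> q g' [^] i \<noteq> \<one>"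
    and gen: "generate R {q g'} = (\<lambda>i. q g' [^] i) ` {..<m}"
    using H.finite_order_least[OF hom_closed[OF g'c] m] by blast
  have u: "g' [^]\<^bsub>F2\<^esub> m \<in> K"
    using g'c m by (simp add: kernel_def hom_nat_pow)
  have trav: "trav \<one> (g' [^]\<^bsub>F2\<^esub> m) (v, g) = of_bool (v \<in> generate R {q g'})" for v
    using H.sum_powers_of_bool[OF _ min order_refl, of v] g'c
    by (simp add: traversals_gen_pow[OF _ g'] gen)
  have "int k dvd of_bool (inv q f \<in> generate R {q g'}) - of_bool (\<one> \<in> generate R {q g'})"
    using traversals_commute[OF u f _ comm[OF u], of \<one> g] f unfolding trav by simp
  moreover have "\<one> \<in> generate R {q g'}" by (rule generate.one)
  ultimately show ?thesis using k by (auto split: if_splits simp: of_bool_def)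
qed

text \<open>The loops \<open>x\<^sup>m\<close> and \<open>y\<^sup>m\<close> give \<open>q f\<inverse> = q x\<^sup>i = q y\<^sup>j\<close>; the loop \<open>x\<^sup>i y\<^sup>-\<^sup>j\<close> then forces \<open>i = 0\<close>.\<close>

lemma commuting_trivial:
  assumes f: "f \<in> carrier F2" and k: "1 < k"
    and m: "0 < (m::nat)" "q gx [^] m = \<one>" "q gy [^] m = \<one>"
    and comm: "\<And>u. u \<in> K \<Longrightarrow>
      f \<cdot> u \<cdot> inv\<^sub>F f \<cdot> inv\<^sub>F u \<in> derived_power K k"
  shows "f \<in> K"
proof -
  obtain l :: nat where l: "0 < l" "q gx [^] l = \<one>" and
    min: "\<forall>i. 0 < i \<and> i < l \<longrightarrow> q gx [^] i \<noteq> \<one>"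
    and gen: "generate R {q gx} = (\<lambda>i. q gx [^] i) ` {..<l}"
    using H.finite_order_least[OF hom_closed[OF gx_carrier] m(1,2)] by blast
  obtain l' :: nat where gen': "generate R {q gy} = (\<lambda>i. q gy [^] i) ` {..<l'}"
    using H.finite_order_least[OF hom_closed[OF gy_carrier] m(1,3)] by blast
  have "inv q f \<in> generate R {q gx}" "inv q f \<in> generate R {q gy}"
    using commuting_in_cyclic[OF f k _ m(1) _ comm, of gx GX]
      commuting_in_cyclic[OF f k _ m(1) _ comm, of gy GY] m by simp_all
  then obtain i j where i: "i < l" "inv q f = q gx [^] i" and j: "inv q f = q gy [^] (j::nat)"
    unfolding gen gen' by auto
  define u where "u = gx [^]\<^bsub>F2\<^esub> i \<cdot> inv\<^sub>F (gy [^]\<^bsub>F2\<^esub> j)"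
  have u: "u \<in> K"
    using f i(2) j by (simp add: u_def kernel_def hom_nat_pow)
  have trav: "trav \<one> u (v, GX) = of_bool (v \<in> (\<lambda>i. q gx [^] i) ` {..<i})" for v
    using H.sum_powers_of_bool[OF _ min, of i v] i(1)
    by (simp add: u_def traversals_mult traversals_inv traversals_gen_pow[where g = GX]
        traversals_gen_pow[where g = GY])
  have "inv q f \<notin> (\<lambda>i. q gx [^] i) ` {..<i}"
  proof
    assume "inv q f \<in> (\<lambda>i. q gx [^] i) ` {..<i}"
    then obtain t where t: "t < i" "q gx [^] t = q gx [^] i" using i(2) by auto
    have "q gx [^] t \<otimes> q gx [^] (i - t) = q gx [^] (t + (i - t))"
      by (rule H.nat_pow_mult) simp
    then have "q gx [^] t \<otimes> q gx [^] (i - t) = q gx [^] t \<otimes> \<one>"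
      using t le_add_diff_inverse[OF less_imp_le[OF t(1)]] by simp
    then have "q gx [^] (i - t) = \<one>"
      by (metis H.Units_l_cancel H.Units_eq H.nat_pow_closed H.one_closed gx_carrier hom_closed)
    then show False using min[rule_format, of "i - t"] t i by simp
  qed
  \<comment> \<open>Comparison at the vertex 1: the count of \<open>u\<close> at the translated
    vertex \<open>inv q f\<close> is 0, so the count at 1 vanishes modulo \<open>k\<close> and no
    exponent below \<open>i\<close> gives 1.\<close>
  then have "int k dvd 0 - of_bool (\<one> \<in> (\<lambda>i. q gx [^] i) ` {..<i})"
    using traversals_commute[OF u f _ comm[OF u], of \<one> GX] f unfolding trav by simp
  then have "\<one> \<notin> (\<lambda>i. q gx [^] i) ` {..<i}" using k by (auto simp: of_bool_def split: if_splits)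
  then have "i = 0" by (metis H.nat_pow_0 gr0I image_eqI lessThan_iff)
  then show ?thesis using i f by (simp add: kernel_def)
qed

text \<open>The function \<open>E\<close> of the proof is invariant under right multiplication by \<open>q x\<close> and \<open>q y\<close>, hence
  constant modulo \<open>k\<close>; but if \<open>q f \<notin> \<langle>q c\<rangle>\<close>, it takes the values \<open>-1\<close> at \<open>1\<close> and \<open>1\<close> at \<open>q f\<close>.\<close>

lemma commutator_centralizer:
  defines "c \<equiv> gx \<cdot> gy \<cdot> inv\<^sub>F gx \<cdot> inv\<^sub>F gy"
  assumes f: "f \<in> carrier F2" and k: "2 < k"
    and m: "0 < (m::nat)" "q c [^] m = \<one>"
    and comm: "f \<cdot> c \<cdot> inv\<^sub>F f \<cdot> inv\<^sub>F c \<in> derived_power K k"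
  shows "q f \<in> generate R {q c}"
proof (rule ccontr)
  define C where "C = generate R {q c}"
  define ind where "ind v = (of_bool (v \<in> C) :: int)" for v
  define E where "E v = (ind (inv q f \<otimes> v) - ind v) mod int k" for v
  define a where "a = q gx"
  define b where "b = q gy"
  have ab [simp]: "a \<in> carrier R" "b \<in> carrier R"
    by (simp_all add: a_def b_def)
  have cc [simp]: "c \<in> carrier F2" by (simp add: c_def)
  have qf [simp]: "q f \<in> carrier R" using f by simp
  have qc: "q c = a \<otimes> b \<otimes> inv a \<otimes> inv b"
    by (simp add: c_def a_def b_def)
  obtain m :: nat where m: "0 < m" "q c [^] m = \<one>" and
    min: "\<forall>i. 0 < i \<and> i < m \<longrightarrow> q c [^] i \<noteq> \<one>"
    and gen: "generate R {q c} = (\<lambda>i. q c [^] i) ` {..<m}"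
    using H.finite_order_least[OF hom_closed[OF cc] m] by blast
  have sub: "subgroup C R"
    unfolding C_def by (rule H.generate_is_subgroup) simp
  have u: "c [^]\<^bsub>F2\<^esub> m \<in> K"
    using m by (simp add: kernel_def hom_nat_pow)
  have sum: "(\<Sum>i<m. of_bool (q c [^] i = v)) = ind v" for v
    using H.sum_powers_of_bool[OF _ min order_refl, of v] by (simp add: gen C_def ind_def)
  have ind_c: "ind (v \<otimes> inv q c) = ind v" if "v \<in> carrier R" for v
  proof -
    have "q c \<in> C" unfolding C_def by (rule generate.incl) simp
    then have "v \<otimes> inv q c \<in> C \<longleftrightarrow> v \<in> C"
      using subgroup.m_closed[OF sub] subgroup.m_inv_closed[OF sub] that
      by (metis H.inv_closed H.inv_inv H.m_assoc H.r_inv H.r_one cc hom_closed)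
    then show ?thesis by (simp add: ind_def)
  qed
  \<comment> \<open>From \<open>r\<close> the word \<open>c\<close> runs forwards through the x-edge
    at \<open>r\<close> and the y-edge at \<open>r \<otimes> a\<close>, then backwards through the
    x-edge at \<open>r \<otimes> (a \<otimes> b \<otimes> inv a)\<close> and the y-edge at
    \<open>r \<otimes> q c\<close>.\<close>
  have trav_c: "trav r c (v, GX) = of_bool (r = v) - of_bool (r = v \<otimes> inv (a \<otimes> b \<otimes> inv a))"
    "trav r c (v, GY) = of_bool (r = v \<otimes> inv a) - of_bool (r = v \<otimes> inv q c)"
    if "r \<in> carrier R" "v \<in> carrier R" for r v
  proof -
    have x: "trav s gx (w, h) = of_bool (h = GX \<and> s = w)"
      and y: "trav s gy (w, h) = of_bool (h = GY \<and> s = w)" for s w h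
      by (auto simp: gx_def gy_def)
    show "trav r c (v, GX) = of_bool (r = v) - of_bool (r = v \<otimes> inv (a \<otimes> b \<otimes> inv a))"
      "trav r c (v, GY) = of_bool (r = v \<otimes> inv a) - of_bool (r = v \<otimes> inv q c)"
      using that unfolding qc
      by (simp_all add: c_def traversals_mult traversals_inv x y H.inv_solve_right H.m_assoc flip: a_def b_def)
  qed
  \<comment> \<open>Summing over the \<open>m\<close> rounds replaces single vertices by the
    indicator of \<open>C\<close>, and \<open>ind_c\<close> absorbs the shift by
    \<open>q c\<close>.\<close>
  have trav: "trav \<one> (c [^]\<^bsub>F2\<^esub> m) (v, GX) = ind v - ind (v \<otimes> inv (a \<otimes> b \<otimes> inv a))"
    "trav \<one> (c [^]\<^bsub>F2\<^esub> m) (v, GY) = ind (v \<otimes> inv a) - ind v" if "v \<in> carrier R" for v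
    using that ind_c[OF that] by (simp_all add: traversals_nat_pow trav_c sum_subtractf sum)
  have comm': "f \<cdot> (c [^]\<^bsub>F2\<^esub> m) \<cdot> inv\<^sub>F f \<cdot> inv\<^sub>F (c [^]\<^bsub>F2\<^esub> m)
      \<in> derived_power K k"
    by (rule normal.commutator_pow[OF derived_power_normal[OF normal_kernel] f cc comm])
  note dvd = traversals_commute[OF u f _ comm']
  \<comment> \<open>The comparison of counts at the x-edge and at the y-edge of \<open>v\<close>
    becomes invariance of \<open>E\<close> under two right translations, from which those by
    \<open>a\<close> and \<open>b\<close> follow.\<close>
  have EX: "E v = E (v \<otimes> inv (a \<otimes> b \<otimes> inv a))" and EY: "E v = E (v \<otimes> inv a)"
    if v: "v \<in> carrier R" for v
  proof -
    have "int k dvd (ind (inv q f \<otimes> v) - ind v)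
        - (ind (inv q f \<otimes> (v \<otimes> inv (a \<otimes> b \<otimes> inv a))) - ind (v \<otimes> inv (a \<otimes> b \<otimes> inv a)))"
      using dvd[OF v, of GX] v by (simp add: trav H.m_assoc algebra_simps)
    then show "E v = E (v \<otimes> inv (a \<otimes> b \<otimes> inv a))"
      by (simp add: E_def mod_eq_dvd_iff)
    have "int k dvd (ind (inv q f \<otimes> (v \<otimes> inv a)) - ind (v \<otimes> inv a)) - (ind (inv q f \<otimes> v) - ind v)"
      using dvd[OF v, of GY] v by (simp add: trav H.m_assoc algebra_simps)
    then show "E v = E (v \<otimes> inv a)"
      unfolding E_def by (metis mod_eq_dvd_iff)
  qed
  have Ea: "E (v \<otimes> a) = E v" if "v \<in> carrier R" for v
    using EY[of "v \<otimes> a"] that by (simp add: H.m_assoc)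
  have Eb: "E (v \<otimes> b) = E v" if v: "v \<in> carrier R" for v
  proof -
    have *: "E (w \<otimes> inv b) = E w" if w: "w \<in> carrier R" for w
    proof -
      have "E w = E (w \<otimes> inv a)" using EY[OF w] .
      \<comment> \<open>Right multiplication by \<open>inv (a \<otimes> b \<otimes> inv a)\<close>
        turns \<open>inv a\<close> into \<open>inv b \<otimes> inv a\<close>.\<close>
      also have "\<dots> = E (w \<otimes> inv b \<otimes> inv a)"
        using EX[of "w \<otimes> inv a"] w
        by (simp add: H.inv_mult_group H.m_assoc H.inv_mult_cancel)
      also have "\<dots> = E (w \<otimes> inv b)" using EY[of "w \<otimes> inv b"] w by simp
      finally show ?thesis by simp
    qed
    show ?thesis using *[of "v \<otimes> b"] v by (simp add: H.m_assoc)
  qed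
  have E_letter: "E (v \<otimes> q [l]) = E v" if "v \<in> carrier R" for v l
  proof -
    have "[l] \<in> {gx, inv\<^sub>F gx, gy, inv\<^sub>F gy}"
      by (cases l; cases "fst l"; cases "snd l") (auto simp: gx_def gy_def inv_single inv_letter_def)
    then show ?thesis
      using that Ea[OF that] Eb[OF that] Ea[of "v \<otimes> inv a"] Eb[of "v \<otimes> inv b"]
      by (auto simp: H.m_assoc simp flip: a_def b_def)
  qed
  have E_const: "E (v \<otimes> q w) = E v" if "w \<in> carrier F2" "v \<in> carrier R" for v w
    using that
  proof (induction arbitrary: v rule: F2_induct)
    case (letter l w)
    then show ?case using E_letter[of v l] by (simp flip: H.m_assoc)
  qed simp
  assume "q f \<notin> generate R {q c}"
  moreover from this have "inv q f \<notin> C"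
    using subgroup.m_inv_closed[OF sub] by (metis C_def H.inv_inv qf)
  moreover have "\<one> \<in> C" using subgroup.one_closed[OF sub] .
  ultimately have "E \<one> = (-1) mod int k" "E (q f) = 1 mod int k"
    using f by (simp_all add: E_def ind_def C_def)
  moreover have "E (q f) = E \<one>"
    using E_const[OF f, of \<one>] by simp
  \<comment> \<open>The values -1 and 1 can agree only modulo a divisor of 2; this is where
    \<open>2 < k\<close> enters.\<close>
  ultimately have "int k dvd -1 - 1" by (metis mod_eq_dvd_iff)
  then have "int k dvd 2" by simp
  then show False using k by (auto dest: zdvd_imp_le)
qed

end

section \<open>Schreier generators\<close>

lemma UNIV_gen: "(UNIV :: gen set) = {GX, GY}"
  by (auto intro: gen.exhaust)

context cayley
begin

text \<open>The Schreier generator attached to an edge of the Cayley graph, where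
  \<open>\<tau>\<close> chooses a path from the base vertex to every vertex.\<close>

definition schreier :: "('r \<Rightarrow> word) \<Rightarrow> 'r \<times> gen \<Rightarrow> word" where
  "schreier \<tau> = (\<lambda>(r, g). \<tau> r \<cdot> [(g, False)] \<cdot> inv\<^sub>F \<tau> (r \<otimes> q [(g, False)]))"

text \<open>A set that contains 1 and is closed under right multiplication by letters contains
  \<open>q w\<close> for every word \<open>w\<close>, hence every vertex. So some edge leaves a
  proper subset.\<close>

lemma leaves_subset:
  assumes surj: "carrier R \<subseteq> q ` carrier F2" and "\<one> \<in> T" "T \<subset> carrier R"
  obtains r a where "r \<in> T" "r \<otimes> q [a] \<notin> T"
proof -
  have False if closed: "\<forall>r\<in>T. \<forall>a. r \<otimes> q [a] \<in> T"
  proof -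
    have "r \<otimes> q w \<in> T" if "w \<in> carrier F2" "r \<in> T" for w r
      using that
    proof (induction arbitrary: r rule: F2_induct)
      case (letter a w)
      have "r \<otimes> q [a] \<otimes> q w \<in> T" using letter closed by blast
      moreover have "r \<in> carrier R" using letter assms(3) by blast
      ultimately show ?case using letter by (simp add: H.m_assoc)
    qed (use assms(3) in auto)
    then have "q w \<in> T" if "w \<in> carrier F2" for w
      using that assms(2) by (metis H.l_one hom_closed)
    then show False using surj assms(3) by blast
  qed
  then show ?thesis using that by blast
qed

text \<open>A spanning tree is grown vertex by vertex: \<open>T\<close> are its vertices,
  \<open>E\<close> its edges and \<open>\<tau>\<close> the paths inside it. Tree edges have trivial
  Schreier generators, and a tree with n + 1 vertices has n edges.\<close>

lemma partial_transversal:
  assumes fin: "finite (carrier R)" and surj: "carrier R \<subseteq> q ` carrier F2"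
    and "n < card (carrier R)"
  shows "\<exists>T \<tau> E. T \<subseteq> carrier R \<and> card T = Suc n \<and> \<one> \<in> T \<and> \<tau> \<one> = \<one>\<^sub>F \<and>
    (\<forall>r\<in>T. \<tau> r \<in> carrier F2 \<and> q (\<tau> r) = r) \<and> card E = n \<and> finite E \<and>
    (\<forall>r g. (r, g) \<in> E \<longrightarrow> r \<in> T \<and> r \<otimes> q [(g, False)] \<in> T \<and> schreier \<tau> (r, g) = \<one>\<^sub>F)"
  using assms(3)
proof (induction n)
  case 0
  show ?case
    by (rule exI[of _ "{\<one>}"], rule exI[of _ "\<lambda>_. \<one>\<^sub>F"], rule exI[of _ "{}"]) simp
next
  case (Suc n)
  then obtain T \<tau> E where T: "T \<subseteq> carrier R" "card T = Suc n" "\<one> \<in> T" "\<tau> \<one> = \<one>\<^sub>F"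
    and \<tau>0: "\<forall>r\<in>T. \<tau> r \<in> carrier F2 \<and> q (\<tau> r) = r"
    and E: "card E = n" "finite E"
    "\<forall>r g. (r, g) \<in> E \<longrightarrow> r \<in> T \<and> r \<otimes> q [(g, False)] \<in> T \<and> schreier \<tau> (r, g) = \<one>\<^sub>F"
    using Suc_lessD by blast
  have \<tau>: "\<tau> r \<in> carrier F2" "q (\<tau> r) = r" if "r \<in> T" for r using \<tau>0 that by blast+
  have finT: "finite T" using T fin finite_subset by blast
  have "T \<subset> carrier R" using T Suc.prems by (metis less_irrefl psubsetI)
  then obtain r a where r: "r \<in> T" and ra: "r \<otimes> q [a] \<notin> T"
    using leaves_subset[OF surj T(3)] by blast
  have rR: "r \<in> carrier R" using r T by blast
  define r' where "r' = r \<otimes> q [a]"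
  define \<tau>' where "\<tau>' = \<tau>(r' := \<tau> r \<cdot> [a])"
  \<comment> \<open>Edges are listed by their start in the direction of the positive generator, so
    the new tree edge starts at the new vertex \<open>r'\<close> if \<open>a\<close> is an inverse
    letter.\<close>
  define e where "e = (if snd a then r' else r, fst a)"
  have r': "r' \<in> carrier R" "r' \<notin> T" using rR ra by (simp_all add: r'_def)
  have r_inv: "r' \<otimes> q [inv_letter a] = r"
    using rR by (simp add: r'_def H.m_assoc q_inv_letter)
  have \<tau>'T: "\<tau>' s = \<tau> s" if "s \<in> T" for s using that r' by (auto simp: \<tau>'_def)
  have e_new: "schreier \<tau>' e = \<one>\<^sub>F \<and> (fst e = r' \<or> fst e \<otimes> q [(snd e, False)] = r') \<and>
      fst e \<in> insert r' T \<and> fst e \<otimes> q [(snd e, False)] \<in> insert r' T"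
  proof (cases "snd a")
    case True
    then have inv: "(fst a, False) = inv_letter a" by (simp add: inv_letter_def)
    have "\<tau> r \<cdot> [a] \<cdot> [inv_letter a] = \<tau> r"
      using \<tau>(1)[OF r] by (simp add: inv_letter_single F2.m_assoc)
    then show ?thesis
      using True r r_inv \<tau>(1)[OF r] \<tau>'T[OF r] by (simp add: e_def schreier_def inv) (simp add: \<tau>'_def)
  next
    case False
    then have "a = (fst a, False)" by (simp add: prod_eq_iff)
    then have "r \<otimes> q [(fst a, False)] = r'" "[(fst a, False)] = [a]" by (simp_all add: r'_def)
    then show ?thesis
      using False r \<tau>(1)[OF r] \<tau>'T[OF r] by (simp add: e_def schreier_def) (simp add: \<tau>'_def)
  qed
  have e_notin: "e \<notin> E" using e_new E(3)[rule_format, of "fst e" "snd e"] r' by auto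
  show ?case
  proof (rule exI[of _ "insert r' T"], rule exI[of _ \<tau>'], rule exI[of _ "insert e E"], intro conjI)
    show "insert r' T \<subseteq> carrier R" using T r' by blast
    show "card (insert r' T) = Suc (Suc n)" using T r' finT by simp
    show "\<one> \<in> insert r' T" using T by blast
    show "\<tau>' \<one> = \<one>\<^sub>F" using T \<tau>'T by simp
    show "\<forall>s\<in>insert r' T. \<tau>' s \<in> carrier F2 \<and> q (\<tau>' s) = s"
      using \<tau> r \<tau>'T by (auto simp: \<tau>'_def r'_def)
    show "card (insert e E) = Suc n" "finite (insert e E)" using E e_notin by simp_all
    show "\<forall>s g. (s, g) \<in> insert e E \<longrightarrow> s \<in> insert r' T \<and> s \<otimes> q [(g, False)] \<in> insert r' T \<and>
        schreier \<tau>' (s, g) = \<one>\<^sub>F"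
    proof (clarify, elim insertE)
      fix s g assume "(s, g) = e"
      then show "s \<in> insert r' T \<and> s \<otimes> q [(g, False)] \<in> insert r' T \<and> schreier \<tau>' (s, g) = \<one>\<^sub>F"
        using e_new by (metis fst_conv snd_conv)
    next
      fix s g assume "(s, g) \<in> E"
      then show "s \<in> insert r' T \<and> s \<otimes> q [(g, False)] \<in> insert r' T \<and> schreier \<tau>' (s, g) = \<one>\<^sub>F"
        using E(3)[rule_format, of s g] \<tau>'T by (simp add: schreier_def)
    qed
  qed
qed

text \<open>Schreier's lemma with its count. The graph has two edges for every vertex, and the edges
  of a spanning tree, one fewer than the vertices, give trivial generators; what remains is one more
  than the number of vertices.\<close>

lemma kernel_generators:
  assumes fin: "finite (carrier R)" and surj: "carrier R \<subseteq> q ` carrier F2"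
  shows "\<exists>S. finite S \<and> card S \<le> card (carrier R) + 1 \<and> K = generate F2 S"
proof -
  have pos: "0 < card (carrier R)" using fin H.one_closed by (metis card_gt_0_iff empty_iff)
  obtain T \<tau> E where T: "T \<subseteq> carrier R" "card T = Suc (card (carrier R) - 1)" "\<one> \<in> T" "\<tau> \<one> = \<one>\<^sub>F"
    and \<tau>: "\<forall>r\<in>T. \<tau> r \<in> carrier F2 \<and> q (\<tau> r) = r"
    and E: "card E = card (carrier R) - 1" "finite E"
    "\<forall>r g. (r, g) \<in> E \<longrightarrow> r \<in> T \<and> r \<otimes> q [(g, False)] \<in> T \<and> schreier \<tau> (r, g) = \<one>\<^sub>F"
    using partial_transversal[OF fin surj, of "card (carrier R) - 1"] pos by force
  have TR: "T = carrier R"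
    using T pos fin by (intro card_subset_eq) auto
  have \<tau>1: "\<tau> r \<in> carrier F2" "q (\<tau> r) = r" if "r \<in> carrier R" for r
    using \<tau> TR that by blast+
  define S where "S = schreier \<tau> ` (carrier R \<times> UNIV - E)"
  have sch: "schreier \<tau> (r, g) \<in> K" if "r \<in> carrier R" for r g
    using that \<tau>1 by (simp add: schreier_def kernel_def)
  have SK: "S \<subseteq> K" using sch by (auto simp: S_def)
  have finG: "finite (UNIV :: gen set)" "card (UNIV :: gen set) = 2"
    by (simp_all add: UNIV_gen)
  have "E \<subseteq> carrier R \<times> UNIV" using E(3) TR by auto
  then have "card (carrier R \<times> (UNIV :: gen set) - E) = card (carrier R) + 1"
    using pos by (simp add: card_Diff_subset E finG card_cartesian_product)
  then have card: "card S \<le> card (carrier R) + 1"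
    using card_image_le[of "carrier R \<times> (UNIV :: gen set) - E" "schreier \<tau>"] fin finG by (simp add: S_def)
  have sub: "subgroup (generate F2 S) F2"
    using SK by (intro F2.generate_is_subgroup) (auto simp: kernel_def)
  have gen_edge: "schreier \<tau> (r, g) \<in> generate F2 S" if "r \<in> carrier R" for r g
  proof (cases "(r, g) \<in> E")
    case True
    then show ?thesis using E(3) subgroup.one_closed[OF sub] by simp
  next
    case False
    then show ?thesis using that by (auto simp: S_def intro: generate.incl)
  qed
  have gen_letter: "\<tau> r \<cdot> [a] \<cdot> inv\<^sub>F \<tau> (r \<otimes> q [a]) \<in> generate F2 S" if r: "r \<in> carrier R" for r a
  proof (cases "snd a")
    case True
    let ?r = "r \<otimes> q [a]"
    have inv: "(fst a, False) = inv_letter a" using True by (simp add: inv_letter_def)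
    have "?r \<otimes> q [inv_letter a] = r"
      using r by (simp add: H.m_assoc q_inv_letter)
    \<comment> \<open>An inverse letter passes its edge backwards and so yields the inverse of the
      generator of that edge.\<close>
    then have "schreier \<tau> (?r, fst a) = inv\<^sub>F (\<tau> r \<cdot> [a] \<cdot> inv\<^sub>F \<tau> ?r)"
      using r \<tau>1
      by (simp add: schreier_def inv F2.inv_mult_group F2.m_assoc inv_letter_single)
    moreover have "\<tau> r \<cdot> [a] \<cdot> inv\<^sub>F \<tau> ?r \<in> carrier F2" using r \<tau>1 by simp
    ultimately show ?thesis
      using gen_edge[of ?r "fst a"] r subgroup.m_inv_closed[OF sub] by (metis F2.inv_inv F2_singleton H.m_closed hom_closed)
  next
    case False
    then have "a = (fst a, False)" by (simp add: prod_eq_iff)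
    then show ?thesis using gen_edge[OF r, of "fst a"] by (simp add: schreier_def)
  qed
  have gen_word: "\<tau> r \<cdot> w \<cdot> inv\<^sub>F \<tau> (r \<otimes> q w) \<in> generate F2 S"
    if "w \<in> carrier F2" "r \<in> carrier R" for w r
    using that
  proof (induction arbitrary: r rule: F2_induct)
    case one
    then show ?case using subgroup.one_closed[OF sub] \<tau>1 by simp
  next
    case (letter a w)
    let ?r = "r \<otimes> q [a]"
    \<comment> \<open>Returning to the base vertex along \<open>\<tau> ?r\<close> and going out
      again changes nothing, so a closed path splits into one closed path for each letter.\<close>
    have eq: "\<tau> r \<cdot> ([a] \<cdot> w) \<cdot> inv\<^sub>F \<tau> (r \<otimes> q ([a] \<cdot> w))
      = (\<tau> r \<cdot> [a] \<cdot> inv\<^sub>F \<tau> ?r) \<cdot> (\<tau> ?r \<cdot> w \<cdot> inv\<^sub>F \<tau> (?r \<otimes> q w))"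
      using letter \<tau>1 by (simp add: F2.m_assoc F2_inv_cancel H.m_assoc)
    show ?case
      unfolding eq by (rule subgroup.m_closed[OF sub gen_letter[OF letter.prems] letter.IH])
        (use letter.prems in simp)
  qed
  have "K \<subseteq> generate F2 S"
  proof
    fix w assume "w \<in> K"
    then show "w \<in> generate F2 S"
      using gen_word[of w \<one>] T(4) K_D[of w] by simp
  qed
  moreover have "generate F2 S \<subseteq> K"
    by (rule F2.generate_subgroup_incl[OF SK subgroup_K])
  ultimately show ?thesis using card fin finG by (intro exI[of _ S]) (auto simp: S_def)
qed

end

section \<open>Nielsen reduction\<close>

abbreviation winv :: "word \<Rightarrow> word" where
  "winv w \<equiv> map inv_letter (rev w)"

lemma inv_letter_eq_iff: "inv_letter a = b \<longleftrightarrow> a = inv_letter b"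
  by (metis inv_letter_inv)

lemma winv_winv [simp]: "winv (winv w) = w"
  by (simp add: rev_map comp_def)

lemma reduced_append:
  "reduced_word (u @ v) \<longleftrightarrow>
    reduced_word u \<and> reduced_word v \<and> (u \<noteq> [] \<longrightarrow> v \<noteq> [] \<longrightarrow> hd v \<noteq> inv_letter (last u))"
  by (auto simp: reduced_word_def successively_append_iff)

lemma reduced_winv [simp]: "reduced_word (winv w) \<longleftrightarrow> reduced_word w"
proof (induction w)
  case (Cons a w)
  then show ?case
    by (cases w) (auto simp: reduced_append inv_letter_eq_iff)
qed simp

lemma F2_append: "reduced_word (u @ v) \<Longrightarrow> u \<cdot> v = u @ v"
proof (induction u)
  case (Cons a u)
  then have "reduced_word (a # (u @ v))" by simp
  then show ?case
    using Cons.IH reduced_ConsD[of a "u @ v"] lcons_eq_Cons[of a "u @ v"] by (simp add: F2_mult)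
qed (simp add: F2_mult)

lemma F2_inv: "w \<in> carrier F2 \<Longrightarrow> inv\<^sub>F w = winv w"
  using foldr_lcons_inverse[of w "[]"]
  by (intro F2.inv_equality) (simp_all add: F2_def foldr_lcons_Nil)

text \<open>Letters cancel at the joint one pair at a time; the cancelled pairs form
  \<open>e\<close>, and what is left is reduced.\<close>

lemma F2_mult_cases:
  assumes "reduced_word u" "reduced_word v"
  obtains u' e v' where "u = u' @ e" "v = winv e @ v'" "reduced_word (u' @ v')"
    "u \<cdot> v = u' @ v'"
  using assms
proof (induction v arbitrary: u thesis)
  case Nil
  then show ?case using foldr_lcons_Nil[of u] by (force simp: F2_mult)
next
  case (Cons b v)
  show ?case
  proof (cases "u = [] \<or> last u \<noteq> inv_letter b")
    case True
    then have "reduced_word (u @ b # v)"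
      using Cons.prems by (auto simp: reduced_append inv_letter_eq_iff)
    then show ?thesis using Cons.prems(1)[of u "[]" "b # v"] F2_append by simp
  next
    case False
    define u0 where "u0 = butlast u"
    have u: "u = u0 @ [inv_letter b]" using False by (metis append_butlast_last_id u0_def)
    have "reduced_word u0" using Cons.prems(2) u by (simp add: reduced_append)
    moreover have "reduced_word v" using Cons.prems(3) reduced_ConsD by blast
    ultimately obtain u' e v' where *: "u0 = u' @ e" "v = winv e @ v'" "reduced_word (u' @ v')"
      "u0 \<cdot> v = u' @ v'"
      using Cons.IH by metis
    have "u \<cdot> (b # v) = u0 \<cdot> v"
      by (simp add: u F2_mult)
    then show ?thesis
      using Cons.prems(1)[of u' "e @ [inv_letter b]" v'] * u by simp
  qed
qed

lemma F2_mult_length: "length (u \<cdot> v) \<le> length u + length v"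
proof (induction u)
  case (Cons a u)
  have "length (lcons a w) \<le> Suc (length w)" for w by (cases w) auto
  from this[of "u \<cdot> v"] Cons show ?case by (simp add: F2_mult)
qed (simp add: F2_mult)

lemma reduced_append_winv: "reduced_word (w @ winv w) \<Longrightarrow> w = []"
  by (auto simp: reduced_append last_rev hd_map hd_rev split: if_splits)

text \<open>The outer letters of such a word are inverse to each other. Peeling them off ends with a
  single letter, which is not its own inverse, or with a cancelling pair, which is not
  reduced.\<close>

lemma reduced_eq_winv: "reduced_word w \<Longrightarrow> w = winv w \<Longrightarrow> w = []"
proof (induction "length w" arbitrary: w rule: less_induct)
  case less
  show ?case
  proof (rule ccontr)
    assume "w \<noteq> []"
    then obtain a v where w: "w = a # v" by (cases w) auto
    show False
    proof (cases "v = []")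
      case True
      then show False using less.prems w by simp
    next
      case False
      then obtain v' b where v: "v = v' @ [b]" by (metis rev_exhaust)
      have "a # (v' @ [b]) = winv (a # (v' @ [b]))" using less.prems(2) w v by metis
      moreover have "winv (a # (v' @ [b])) = inv_letter b # (winv v' @ [inv_letter a])" by simp
      ultimately have "a = inv_letter b" "v' = winv v'" by (metis append1_eq_conv list.inject)+
      moreover have "reduced_word v'"
        using less.prems(1) w v by (metis reduced_ConsD reduced_append)
      ultimately have "v' = []" using less.hyps[of v'] w v by simp
      then show False using less.prems(1) w v \<open>a = inv_letter b\<close> by simp
    qed
  qed
qed

text \<open>If more than half of \<open>b\<close> cancelled in the square of \<open>b\<close>, the
  two cancelling pieces would overlap in a nonempty word that is its own inverse.\<close>

lemma self_cancellation:
  assumes "reduced_word b" "b = b' @ e" "b = winv e @ d"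
  shows "2 * length e \<le> length b"
proof (rule ccontr)
  assume len: "\<not> ?thesis"
  have lens: "length b = length b' + length e" "length b = length e + length d"
    using arg_cong[OF assms(2), of length] arg_cong[OF assms(3), of length] by simp_all
  then have "length b' < length e" using len by simp
  then obtain r where r: "winv e = b' @ r" "e = r @ d"
    using assms(2,3) by (auto simp: append_eq_append_conv2)
  have "winv d @ winv r = b' @ r" using r by (metis map_append rev_append)
  then have "winv r = r" using r lens by (metis append_eq_append_conv length_map length_rev)
  moreover have "reduced_word r" using assms(1,2) r by (simp add: reduced_append)
  ultimately have "r = []" using reduced_eq_winv by metis
  then show False using r \<open>length b' < length e\<close> by (metis append_Nil2 length_map length_rev nat_neq_iff)
qed

text \<open>\<open>no_half\<close> prevents \<open>A k\<close> from cancelling completely in the product \<open>A l \<cdot> A k \<cdot> A l\<close>.\<close>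

locale nielsen_reduced =
  fixes A :: "letter \<Rightarrow> word"
  assumes red: "reduced_word (A a)" and nonempty: "A a \<noteq> []"
    and A_inv: "A (inv_letter a) = winv (A a)"
    and no_shortening: "fst k \<noteq> fst l \<Longrightarrow> length (A k) \<le> length (A k \<cdot> A l)"
    and no_half: "fst k \<noteq> fst l \<Longrightarrow> A k = s @ t \<Longrightarrow> A l = p @ winv s \<Longrightarrow> A l = winv t @ d \<Longrightarrow>
      length s = length t \<Longrightarrow> False"
begin

text \<open>For different generators, \<open>no_shortening\<close> applied to the product bounds
  \<open>e\<close> by half of \<open>A l\<close>, and applied to the inverse product by half of
  \<open>A k\<close>. For equal letters \<open>self_cancellation\<close> applies.\<close>

lemma cancellation:
  assumes "l \<noteq> inv_letter k" "A k = b @ e" "A l = winv e @ d" "A k \<cdot> A l = b @ d"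
  shows "2 * length e \<le> length (A k) \<and> 2 * length e \<le> length (A l)"
proof (cases "fst k = fst l")
  case True
  then have "l = k" using assms(1) by (auto simp: inv_letter_def prod_eq_iff)
  then show ?thesis using self_cancellation[OF red assms(2)] assms(3) by simp
next
  case False
  have lens: "length (A k) = length b + length e" "length (A l) = length e + length d"
    using assms by simp_all
  have 1: "length (A k) \<le> length b + length d"
    using no_shortening[OF False] assms(4) by simp
  have car: "A k \<in> carrier F2" "A l \<in> carrier F2" using red by (simp_all add: F2_carrier_iff)
  have "A (inv_letter l) \<cdot> A (inv_letter k) = inv\<^sub>F (A k \<cdot> A l)"
    using car by (simp add: A_inv F2_inv[symmetric] F2.inv_mult_group)
  also have "\<dots> = winv (b @ d)"
    using F2_inv[OF F2.m_closed[OF car]] assms(4) by simp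
  finally have "length (A (inv_letter l)) \<le> length b + length d"
    using no_shortening[of "inv_letter l" "inv_letter k"] False by auto
  then have 2: "length (A l) \<le> length b + length d" by (simp add: A_inv)
  show ?thesis using 1 2 lens by simp
qed

text \<open>Every factor of a reduced product survives at least in part: \<open>t\<close> is what is left of the
  last one after cancellation against its predecessor.\<close>

lemma product_invariant:
  assumes "reduced_word (w @ [l])"
    and \<sigma>: "\<sigma> \<in> hom F2 F2" "\<And>a. \<sigma> [a] = A a"
  shows "\<exists>W s t. \<sigma> (w @ [l]) = W @ t \<and> reduced_word (W @ t) \<and> A l = s @ t \<and>
    length s \<le> length t \<and> length w \<le> length W \<and>
    (s \<noteq> [] \<longrightarrow> (\<exists>l' p. l' \<noteq> inv_letter l \<and> A l' = p @ winv s))"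
  using assms(1)
proof (induction w arbitrary: l rule: rev_induct)
  case Nil
  show ?case
    by (rule exI[of _ "[]"], rule exI[of _ "[]"], rule exI[of _ "A l"]) (simp add: \<sigma>(2) red)
next
  case (snoc k w)
  have redk: "reduced_word (w @ [k])" and lk: "l \<noteq> inv_letter k"
    using snoc.prems by (auto simp: reduced_append)
  obtain W s t where IH: "\<sigma> (w @ [k]) = W @ t" "reduced_word (W @ t)" "A k = s @ t"
    "length s \<le> length t" "length w \<le> length W"
    "s \<noteq> [] \<longrightarrow> (\<exists>l' p. l' \<noteq> inv_letter k \<and> A l' = p @ winv s)"
    using snoc.IH[OF redk] by blast
  obtain b e d where e: "A k = b @ e" "A l = winv e @ d" "reduced_word (b @ d)"
    "A k \<cdot> A l = b @ d"
    using F2_mult_cases[OF red red] by metis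
  have half: "2 * length e \<le> length (A k)" "2 * length e \<le> length (A l)"
    using cancellation[OF lk e(1,2,4)] by auto
  have step: "\<sigma> ((w @ [k]) @ [l]) = (W @ t) \<cdot> A l"
    using F2_append[OF snoc.prems] redk IH(1) hom_mult[OF \<sigma>(1), of "w @ [k]" "[l]"]
    by (simp add: F2_carrier_iff \<sigma>(2))
  show ?case
  \<comment> \<open>If less than the surviving part \<open>t\<close> cancels, a nonempty middle
    piece of \<open>A k\<close> is left and joins \<open>W\<close>.\<close>
  proof (cases "length e < length t")
    case True
    then obtain t' where t': "t = t' @ e" "b = s @ t'"
      using e(1) IH(3) by (auto simp: append_eq_append_conv2)
    then have "t' \<noteq> []" using True by auto
    have red': "reduced_word ((W @ t') @ d)"
      using IH(2) e(3) \<open>t' \<noteq> []\<close> unfolding t' by (simp add: reduced_append)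
    have cars: "W @ t' \<in> carrier F2" "e \<in> carrier F2" "winv e \<in> carrier F2" "d \<in> carrier F2"
      using red' IH(2) t' red[of l] e(2) by (auto simp: F2_carrier_iff reduced_append)
    have "(W @ t) \<cdot> A l = ((W @ t') \<cdot> e) \<cdot> (inv\<^sub>F e \<cdot> d)"
      using F2_append[of "W @ t'" e] F2_append[of "winv e" d] IH(2) t' red[of l] e(2) cars
      by (simp add: F2_inv)
    also have "\<dots> = (W @ t') \<cdot> d"
      using cars by (simp add: F2.m_assoc F2.inv_mult_cancel)
    also have "\<dots> = (W @ t') @ d" using F2_append[OF red'] .
    finally have eq: "\<sigma> ((w @ [k]) @ [l]) = (W @ t') @ d" using step by simp
    show ?thesis
    proof (rule exI[of _ "W @ t'"], rule exI[of _ "winv e"], rule exI[of _ d], intro conjI impI)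
      show "\<exists>l' p. l' \<noteq> inv_letter l \<and> A l' = p @ winv (winv e)"
        using lk e(1) by (metis inv_letter_inv winv_winv)
      show "length (w @ [k]) \<le> length (W @ t')"
        using IH(5) \<open>t' \<noteq> []\<close> by (cases t') auto
      show "length (winv e) \<le> length d" using half(2) e(2) by simp
    qed (use eq red' e in simp_all)
  next
    case False
    \<comment> \<open>Now all of \<open>t\<close> cancels, and the length bounds leave only the case
      that \<open>s\<close>, \<open>t\<close> and \<open>e\<close> have equal length. So
      \<open>A k\<close> would vanish completely between \<open>l'\<close> and \<open>l\<close>;
      both belong to the other generator, which gives \<open>l = l'\<close> and contradicts
      \<open>no_half\<close>.\<close>
    have "length (A k) = length s + length t" "length (A k) = length b + length e"
      by (simp add: IH(3), simp add: e(1))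
    then have len: "length s = length t" "length e = length t"
      using False IH(4) half(1) by simp_all
    have "b @ e = s @ t" using e(1) IH(3) by metis
    then have et: "e = t" "b = s" using len(2) by (metis append_eq_append_conv)+
    have "s \<noteq> []" "t \<noteq> []" using nonempty[of k] IH(3) len by auto
    then obtain l' p where l': "l' \<noteq> inv_letter k" "A l' = p @ winv s" using IH(6) by blast
    have not_inv: "\<not> reduced_word (s @ winv s)" "\<not> reduced_word (winv t @ t)"
      using reduced_append_winv[of s] reduced_append_winv[of "winv t"] \<open>s \<noteq> []\<close> \<open>t \<noteq> []\<close> by auto
    have st: "t \<noteq> winv s" "s \<noteq> winv t" using not_inv red[of k] IH(3) by metis+
    have "fst l' \<noteq> fst k"
    proof
      assume "fst l' = fst k"
      then have "l' = k" using l'(1) by (auto simp: inv_letter_def prod_eq_iff)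
      then show False using l'(2) IH(3) st len by simp
    qed
    moreover have l_k: "fst l \<noteq> fst k"
    proof
      assume "fst l = fst k"
      then have "l = k" using lk by (auto simp: inv_letter_def prod_eq_iff)
      then show False using e(2) IH(3) st len et by simp
    qed
    ultimately have "fst l = fst l'" by (cases "fst l"; cases "fst l'"; cases "fst k") auto
    moreover have "l \<noteq> inv_letter l'"
    proof
      assume "l = inv_letter l'"
      then have "A l = s @ winv p" using l'(2) A_inv[of l'] by simp
      then show False using e(2) st len et by simp
    qed
    ultimately have "l = l'" by (auto simp: inv_letter_def prod_eq_iff)
    then have False using no_half[of k l s t p d] l_k IH(3) l'(2) e(2) len et by auto
    then show ?thesis ..
  qed
qed

text \<open>Every factor before the last leaves at least one letter in \<open>W\<close>, and the
  nonempty remainder \<open>t\<close> of the last factor supplies one more.\<close>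

lemma length_product:
  assumes "\<sigma> \<in> hom F2 F2" "\<And>a. \<sigma> [a] = A a" "reduced_word w"
  shows "length w \<le> length (\<sigma> w)"
proof (cases w rule: rev_cases)
  case (snoc w' l)
  obtain W s t where "\<sigma> w = W @ t" "A l = s @ t" "length s \<le> length t" "length w' \<le> length W"
    using product_invariant[of w' l \<sigma>] assms snoc by blast
  moreover have "t \<noteq> []" using calculation nonempty[of l] by auto
  ultimately show ?thesis using snoc by (cases t) auto
qed simp

end

section \<open>Automorphisms congruent to the identity modulo 4\<close>

lemma AutF2_mult [simp]:
  "f \<in> carrier AutF2 \<Longrightarrow> g \<in> carrier AutF2 \<Longrightarrow> w \<in> carrier F2 \<Longrightarrow> (f \<star> g) w = f (g w)"
  by (simp add: AutoGroup_def auto_def BijGroup_def compose_def)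

lemma AutF2_one [simp]: "w \<in> carrier F2 \<Longrightarrow> \<one>\<^sub>A w = w"
  by (simp add: AutoGroup_def BijGroup_def)

lemma AutF2_hom: "f \<in> carrier AutF2 \<Longrightarrow> f \<in> hom F2 F2"
  by (simp add: AutoGroup_def auto_def)

lemma AutF2_group_hom: "f \<in> carrier AutF2 \<Longrightarrow> group_hom F2 F2 f"
  by (simp add: group_hom_def group_hom_axioms_def group_F2 AutF2_hom)

lemma AutF2_closed [simp]: "f \<in> carrier AutF2 \<Longrightarrow> w \<in> carrier F2 \<Longrightarrow> f w \<in> carrier F2"
  using AutF2_hom hom_in_carrier by metis

lemma AutF2_apply_mult [simp]:
  "f \<in> carrier AutF2 \<Longrightarrow> u \<in> carrier F2 \<Longrightarrow> v \<in> carrier F2 \<Longrightarrow>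
    f (u \<cdot> v) = f u \<cdot> f v"
  using AutF2_hom hom_mult by metis

lemma AutF2_apply_inv [simp]:
  "f \<in> carrier AutF2 \<Longrightarrow> u \<in> carrier F2 \<Longrightarrow> f (inv\<^sub>F u) = inv\<^sub>F f u"
  using AutF2_group_hom group_hom.hom_inv by metis

lemma AutF2_inv_apply [simp]:
  assumes "f \<in> carrier AutF2" "w \<in> carrier F2"
  shows "f ((inv\<^sub>A f) w) = w" "(inv\<^sub>A f) (f w) = w"
  using AutF2_mult[of f "inv\<^sub>A f" w] AutF2_mult[of "inv\<^sub>A f" f w] assms by simp_all

lemma AutF2_eqI:
  assumes "f \<in> carrier AutF2" "g \<in> carrier AutF2" "f gx = g gx" "f gy = g gy"
  shows "f = g"
proof (rule extensionalityI[of f "carrier F2"])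
  show "f \<in> extensional (carrier F2)" "g \<in> extensional (carrier F2)"
    using assms(1,2) by (auto simp: AutoGroup_def auto_def Bij_def)
  show "f w = g w" if "w \<in> carrier F2" for w
    using F2_hom_eqI[OF group_F2 AutF2_hom AutF2_hom] assms that by blast
qed

lemma AutF2_surj: "f \<in> carrier AutF2 \<Longrightarrow> w \<in> carrier F2 \<Longrightarrow> \<exists>v\<in>carrier F2. f v = w"
  using AutF2_inv_apply(1) AutF2.inv_closed AutF2_closed by metis

definition inner_aut :: "word \<Rightarrow> word \<Rightarrow> word" where
  "inner_aut g = (\<lambda>w\<in>carrier F2. g \<cdot> w \<cdot> inv\<^sub>F g)"

lemma InnF2_eq: "InnF2 = inner_aut ` carrier F2"
  by (simp add: InnF2_def inner_aut_def[abs_def])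

lemma inner_apply [simp]:
  "w \<in> carrier F2 \<Longrightarrow> inner_aut g w = g \<cdot> w \<cdot> inv\<^sub>F g"
  by (simp add: inner_aut_def)

lemma inner_closed [simp]:
  assumes "g \<in> carrier F2"
  shows "inner_aut g \<in> carrier AutF2"
proof -
  have "inner_aut g \<in> hom F2 F2"
    using assms by (auto simp: hom_def F2.m_assoc F2_inv_cancel)
  moreover have "bij_betw (inner_aut g) (carrier F2) (carrier F2)"
    using assms by (intro bij_betw_byWitness[where f' = "inner_aut (inv\<^sub>F g)"])
      (auto simp: F2.m_assoc F2_inv_cancel F2.inv_mult_cancel)
  ultimately show ?thesis
    by (simp add: AutoGroup_def auto_def Bij_def inner_aut_def)
qed

lemma aut_inner:
  "f \<in> carrier AutF2 \<Longrightarrow> g \<in> carrier F2 \<Longrightarrow> f \<star> inner_aut g = inner_aut (f g) \<star> f"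
  by (rule AutF2_eqI) (simp_all add: F2.m_assoc F2_inv_cancel)

lemma inner_mult:
  "g \<in> carrier F2 \<Longrightarrow> h \<in> carrier F2 \<Longrightarrow> inner_aut g \<star> inner_aut h = inner_aut (g \<cdot> h)"
  by (rule AutF2_eqI) (simp_all add: F2.m_assoc F2.inv_mult_group F2_inv_cancel)

lemma inner_inv: "g \<in> carrier F2 \<Longrightarrow> inv\<^sub>A (inner_aut g) = inner_aut (inv\<^sub>F g)"
  by (rule AutF2.inv_equality)
    (auto simp: inner_mult intro!: AutF2_eqI)

lemma inner_one: "inner_aut \<one>\<^sub>F = \<one>\<^sub>A"
  by (rule AutF2_eqI) simp_all


section \<open>Elementary automorphisms and their relations\<close>

lemma letter_cases: "[a] \<in> {gx, inv\<^sub>F gx, gy, inv\<^sub>F gy}"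
  by (cases a; cases "fst a"; cases "snd a") (auto simp: gx_def gy_def inv_single inv_letter_def)

definition swap :: "word \<Rightarrow> word" where "swap = endo gy gx"
definition flip :: "word \<Rightarrow> word" where "flip = endo (inv\<^sub>F gx) gy"
definition transv_x :: "word \<Rightarrow> word" where "transv_x = endo (gx \<cdot> gy) gy"
definition transv_x_inv :: "word \<Rightarrow> word" where "transv_x_inv = endo (gx \<cdot> inv\<^sub>F gy) gy"
definition transv_y :: "word \<Rightarrow> word" where "transv_y = endo gx (gy \<cdot> gx)"

lemma endo_mult [simp]:
  "a \<in> carrier F2 \<Longrightarrow> b \<in> carrier F2 \<Longrightarrow> u \<in> carrier F2 \<Longrightarrow> v \<in> carrier F2 \<Longrightarrow>
    endo a b (u \<cdot> v) = endo a b u \<cdot> endo a b v"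
  using endo_hom hom_mult by metis

lemma endo_inv [simp]:
  assumes "a \<in> carrier F2" "b \<in> carrier F2" "u \<in> carrier F2"
  shows "endo a b (inv\<^sub>F u) = inv\<^sub>F endo a b u"
proof -
  interpret group_hom F2 F2 "endo a b"
    using endo_hom[OF assms(1,2)] by (simp add: group_hom_def group_hom_axioms_def group_F2)
  show ?thesis using assms(3) by simp
qed

lemma F2_sq: "w \<in> carrier F2 \<Longrightarrow> w [^]\<^bsub>F2\<^esub> (2::nat) = w \<cdot> w"
  by (simp add: numeral_2_eq_2)

lemma auts_closed [simp]:
  "swap \<in> carrier AutF2" "flip \<in> carrier AutF2" "transv_x \<in> carrier AutF2"
  "transv_x_inv \<in> carrier AutF2" "transv_y \<in> carrier AutF2"
  "aut_alpha \<in> carrier AutF2" "aut_beta \<in> carrier AutF2"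
proof -
  show "swap \<in> carrier AutF2"
    unfolding swap_def by (rule endo_auto[where c = gy and d = gx]) simp_all
  show "flip \<in> carrier AutF2"
    unfolding flip_def by (rule endo_auto[where c = "inv\<^sub>F gx" and d = gy]) simp_all
  show "transv_x \<in> carrier AutF2"
    unfolding transv_x_def
    by (rule endo_auto[where c = "gx \<cdot> inv\<^sub>F gy" and d = gy]) (simp_all add: F2.m_assoc)
  show "transv_x_inv \<in> carrier AutF2"
    unfolding transv_x_inv_def
    by (rule endo_auto[where c = "gx \<cdot> gy" and d = gy]) (simp_all add: F2.m_assoc)
  show "transv_y \<in> carrier AutF2"
    unfolding transv_y_def
    by (rule endo_auto[where c = gx and d = "gy \<cdot> inv\<^sub>F gx"]) (simp_all add: F2.m_assoc)
qed (rule aut_alpha_closed aut_beta_closed)+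

lemma auts_apply [simp]:
  "swap gx = gy" "swap gy = gx" "flip gx = inv\<^sub>F gx" "flip gy = gy"
  "transv_x gx = gx \<cdot> gy" "transv_x gy = gy"
  "transv_x_inv gx = gx \<cdot> inv\<^sub>F gy" "transv_x_inv gy = gy"
  "transv_y gx = gx" "transv_y gy = gy \<cdot> gx"
  "aut_alpha gx = gx" "aut_alpha gy = gy \<cdot> (gx \<cdot> gx)"
  "aut_beta gx = gx \<cdot> (gy \<cdot> gy)" "aut_beta gy = gy"
  by (simp_all add: swap_def flip_def transv_x_def transv_x_inv_def transv_y_def
      aut_alpha_def aut_beta_def F2_sq)

text \<open>The relations needed to enumerate cosets: how \<open>swap\<close> and
  \<open>flip\<close> conjugate \<alpha> and \<beta>, and how a transvection is moved past a
  generator. Each is checked at x and y.\<close>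

lemma aut_relations:
  "swap \<star> swap = \<one>\<^sub>A" "flip \<star> flip = \<one>\<^sub>A"
  "swap \<star> aut_alpha \<star> swap = aut_beta"
  "swap \<star> aut_beta \<star> swap = aut_alpha"
  "flip \<star> aut_alpha \<star> flip \<star> aut_alpha = \<one>\<^sub>A"
  "flip \<star> aut_beta \<star> flip \<star> aut_beta = inner_aut (inv\<^sub>F (gy \<cdot> gy))"
  "transv_x \<star> transv_x_inv = \<one>\<^sub>A"
  "transv_x \<star> swap = swap \<star> transv_y"
  "transv_y \<star> swap = swap \<star> transv_x"
  "aut_alpha \<star> flip \<star> (transv_y \<star> flip) = transv_y"
  "aut_beta \<star> flip \<star> inner_aut gy \<star> (transv_x \<star> flip) = transv_x"
  "aut_beta \<star> transv_x_inv = transv_x"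
  "transv_y \<star> transv_x_inv
    = inner_aut gy \<star> aut_beta \<star> swap \<star> flip \<star> transv_y"
  by (auto intro!: AutF2_eqI simp: F2.m_assoc F2.inv_mult_group F2.inv_mult_cancel F2_sq)

lemma AB_closed [simp]: "\<delta> \<in> AB \<Longrightarrow> \<delta> \<in> carrier AutF2"
  using subgroup.mem_carrier[OF subgroup_AB] .

section \<open>The product of the inner automorphisms with the group generated by \<alpha> and
  \<beta>\<close>

definition InnAB :: "(word \<Rightarrow> word) set" where
  "InnAB = {inner_aut g \<star> \<delta> | g \<delta>. g \<in> carrier F2 \<and> \<delta> \<in> AB}"

lemma InnABI: "g \<in> carrier F2 \<Longrightarrow> \<delta> \<in> AB \<Longrightarrow> inner_aut g \<star> \<delta> \<in> InnAB"
  by (auto simp: InnAB_def)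

lemma inner_in_InnAB: "g \<in> carrier F2 \<Longrightarrow> inner_aut g \<in> InnAB"
  using InnABI[OF _ subgroup.one_closed[OF subgroup_AB], of g] by simp

lemma AB_in_InnAB: "\<delta> \<in> AB \<Longrightarrow> \<delta> \<in> InnAB"
  using InnABI[OF F2.one_closed, of \<delta>] by (simp add: inner_one)

text \<open>By \<open>aut_inner\<close> an inner automorphism moves to the left past any
  automorphism, which brings products and inverses back into the required form.\<close>

lemma subgroup_InnAB: "subgroup InnAB AutF2"
proof (rule AutF2.subgroupI)
  show "InnAB \<subseteq> carrier AutF2" by (auto simp: InnAB_def)
  show "InnAB \<noteq> {}" using inner_in_InnAB[OF F2.one_closed] by blast
  fix \<sigma> assume "\<sigma> \<in> InnAB"
  then obtain g \<delta> where \<sigma>: "\<sigma> = inner_aut g \<star> \<delta>" "g \<in> carrier F2" "\<delta> \<in> AB"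
    by (auto simp: InnAB_def)
  have \<delta>': "inv\<^sub>A \<delta> \<in> AB" using subgroup.m_inv_closed[OF subgroup_AB \<sigma>(3)] .
  have "inv\<^sub>A \<sigma> = inv\<^sub>A \<delta> \<star> inner_aut (inv\<^sub>F g)"
    using \<sigma> by (simp add: AutF2.inv_mult_group inner_inv)
  also have "\<dots> = inner_aut ((inv\<^sub>A \<delta>) (inv\<^sub>F g)) \<star> inv\<^sub>A \<delta>"
    using \<sigma> \<delta>' by (intro aut_inner) simp_all
  also have "\<dots> \<in> InnAB"
    by (rule InnABI[OF AutF2_closed[OF AB_closed[OF \<delta>'] F2.inv_closed[OF \<sigma>(2)]] \<delta>'])
  finally show "inv\<^sub>A \<sigma> \<in> InnAB" .
  fix \<sigma>' assume "\<sigma>' \<in> InnAB"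
  then obtain g' \<delta>2 where \<sigma>': "\<sigma>' = inner_aut g' \<star> \<delta>2" "g' \<in> carrier F2" "\<delta>2 \<in> AB"
    by (auto simp: InnAB_def)
  have "\<sigma> \<star> \<sigma>' = inner_aut g \<star> (\<delta> \<star> inner_aut g') \<star> \<delta>2"
    using \<sigma> \<sigma>' by (simp add: AutF2.m_assoc)
  also have "\<dots> = inner_aut (g \<cdot> \<delta> g') \<star> (\<delta> \<star> \<delta>2)"
    using \<sigma> \<sigma>' aut_inner[of \<delta> g'] by (simp add: inner_mult[symmetric] AutF2.m_assoc)
  also have "\<dots> \<in> InnAB"
    using \<sigma> \<sigma>' subgroup.m_closed[OF subgroup_AB \<sigma>(3) \<sigma>'(3)] by (intro InnABI) simp_all
  finally show "\<sigma> \<star> \<sigma>' \<in> InnAB" .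
qed

lemma swap_inv: "inv\<^sub>A swap = swap" and flip_inv: "inv\<^sub>A flip = flip"
  by (rule AutF2.inv_equality; simp add: aut_relations)+

section \<open>Signed permutations of the generators\<close>

definition SignedPerm :: "(word \<Rightarrow> word) set" where
  "SignedPerm = generate AutF2 {swap, flip}"

lemma subgroup_SignedPerm: "subgroup SignedPerm AutF2"
  unfolding SignedPerm_def by (rule AutF2.generate_is_subgroup) simp

lemma SignedPerm_closed [simp]: "w \<in> SignedPerm \<Longrightarrow> w \<in> carrier AutF2"
  using subgroup.mem_carrier[OF subgroup_SignedPerm] .

lemma SignedPerm_gens: "swap \<in> SignedPerm" "flip \<in> SignedPerm"
  by (auto simp: SignedPerm_def intro: generate.incl)

text \<open>Both generators are involutions, so the case of an inverse reduces to
  \<open>swap\<close> and \<open>flip\<close> themselves.\<close>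

lemma SignedPerm_induct [consumes 1, case_names one swap flip mult]:
  assumes "w \<in> SignedPerm" "P \<one>\<^sub>A" "P swap" "P flip"
    "\<And>u v. u \<in> SignedPerm \<Longrightarrow> P u \<Longrightarrow> v \<in> SignedPerm \<Longrightarrow> P v \<Longrightarrow> P (u \<star> v)"
  shows "P w"
  using assms(1) unfolding SignedPerm_def
proof (induction rule: generate.induct)
  case (inv h)
  then show ?case using assms(3,4) by (auto simp: swap_inv flip_inv)
next
  case (eng h1 h2)
  then show ?case using assms(5) by (simp add: SignedPerm_def)
qed (use assms in auto)

lemma SignedPerm_letter: "w \<in> SignedPerm \<Longrightarrow> \<exists>b. w [a] = [b]"
proof (induction arbitrary: a rule: SignedPerm_induct)
  case one
  then show ?case by auto
next
  case swap
  have "swap [a] \<in> {gx, inv\<^sub>F gx, gy, inv\<^sub>F gy}" using letter_cases[of a] by auto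
  then show ?case by (auto simp: inv_gen) (auto simp: gx_def gy_def)
next
  case flip
  have "flip [a] \<in> {gx, inv\<^sub>F gx, gy, inv\<^sub>F gy}" using letter_cases[of a] by auto
  then show ?case by (auto simp: inv_gen) (auto simp: gx_def gy_def)
next
  case (mult u v)
  obtain b where "v [a] = [b]" using mult by blast
  then show ?case using mult by simp
qed

lemma SignedPerm_exists:
  assumes "fst k \<noteq> fst l"
  shows "\<exists>w\<in>SignedPerm. w gx = [k] \<and> w gy = [l]"
proof -
  note m = subgroup.m_closed[OF subgroup_SignedPerm]
  note c = SignedPerm_gens subgroup.one_closed[OF subgroup_SignedPerm]
  let ?s = "swap" and ?f = "flip"
  have kl: "[k] \<in> {gx, inv\<^sub>F gx, gy, inv\<^sub>F gy}" "[l] \<in> {gx, inv\<^sub>F gx, gy, inv\<^sub>F gy}"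
    using letter_cases[of k] letter_cases[of l] by simp_all
  have 1: "([k] = gx \<or> [k] = inv\<^sub>F gx) \<and> ([l] = gy \<or> [l] = inv\<^sub>F gy) \<or>
      ([k] = gy \<or> [k] = inv\<^sub>F gy) \<and> ([l] = gx \<or> [l] = inv\<^sub>F gx)"
    using kl assms by (auto simp: inv_gen) (auto simp: gx_def gy_def)
  \<comment> \<open>One product for each of the eight pairs of signed generators.\<close>
  have W: "\<one>\<^sub>A \<in> SignedPerm" "?f \<in> SignedPerm" "?s \<star> ?f \<star> ?s \<in> SignedPerm"
    "?f \<star> ?s \<star> ?f \<star> ?s \<in> SignedPerm" "?s \<in> SignedPerm"
    "?s \<star> ?f \<in> SignedPerm" "?f \<star> ?s \<in> SignedPerm"
    "?f \<star> ?s \<star> ?f \<in> SignedPerm"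
    by (simp_all add: m c)
  show ?thesis
    using 1
    by (elim disjE conjE)
      (rule bexI[OF _ W(1)], simp,
       rule bexI[OF _ W(3)], simp,
       rule bexI[OF _ W(2)], simp,
       rule bexI[OF _ W(4)], simp,
       rule bexI[OF _ W(5)], simp,
       rule bexI[OF _ W(7)], simp,
       rule bexI[OF _ W(6)], simp,
       rule bexI[OF _ W(8)], simp)
qed

definition InnAB_signed :: "(word \<Rightarrow> word) set" where
  "InnAB_signed = {\<kappa> \<star> w | \<kappa> w. \<kappa> \<in> InnAB \<and> w \<in> SignedPerm}"

lemma InnAB_closed [simp]: "\<kappa> \<in> InnAB \<Longrightarrow> \<kappa> \<in> carrier AutF2"
  using subgroup.mem_carrier[OF subgroup_InnAB] .

text \<open>Conjugates of inner automorphisms are inner, so only the generators \<alpha> and \<beta>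
  of the other factor have to be tested.\<close>

lemma conj_InnAB_gen:
  assumes w: "w \<in> carrier AutF2"
    and a: "w \<star> aut_alpha \<star> inv\<^sub>A w \<in> InnAB"
    and b: "w \<star> aut_beta \<star> inv\<^sub>A w \<in> InnAB"
    and \<kappa>: "\<kappa> \<in> InnAB"
  shows "w \<star> \<kappa> \<star> inv\<^sub>A w \<in> InnAB"
proof -
  let ?c = "\<lambda>\<kappa>. w \<star> \<kappa> \<star> inv\<^sub>A w"
  have c_mult: "?c (\<sigma> \<star> \<tau>) = ?c \<sigma> \<star> ?c \<tau>"
    if "\<sigma> \<in> carrier AutF2" "\<tau> \<in> carrier AutF2" for \<sigma> \<tau>
    using that w by (simp add: AutF2.m_assoc AutF2.inv_mult_cancel)
  have c_inv: "?c (inv\<^sub>A \<sigma>) = inv\<^sub>A (?c \<sigma>)" if "\<sigma> \<in> carrier AutF2" for \<sigma>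
    using that w by (simp add: AutF2.m_assoc AutF2.inv_mult_group)
  have AB: "?c \<delta> \<in> InnAB" if "\<delta> \<in> AB" for \<delta>
    using that unfolding AB_def
  proof (induction rule: generate.induct)
    case one
    then show ?case using w subgroup.one_closed[OF subgroup_InnAB] by simp
  next
    case (incl h)
    then show ?case using a b by auto
  next
    case (inv h)
    then have "?c h \<in> InnAB" "h \<in> carrier AutF2" using a b by auto
    then show ?case using subgroup.m_inv_closed[OF subgroup_InnAB] c_inv by metis
  next
    case (eng h1 h2)
    then have "h1 \<in> carrier AutF2" "h2 \<in> carrier AutF2"
      using AutF2.generate_in_carrier[of "{aut_alpha, aut_beta}"] by auto
    then show ?case using eng subgroup.m_closed[OF subgroup_InnAB] c_mult by metis
  qed
  obtain g \<delta> where \<kappa>': "\<kappa> = inner_aut g \<star> \<delta>" "g \<in> carrier F2" "\<delta> \<in> AB"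
    using \<kappa> by (auto simp: InnAB_def)
  have "?c (inner_aut g) = inner_aut (w g)"
    using w \<kappa>'(2) by (simp add: aut_inner[OF w \<kappa>'(2)] AutF2.m_assoc)
  then have "?c (inner_aut g) \<in> InnAB" using w \<kappa>'(2) inner_in_InnAB by simp
  then show ?thesis
    using c_mult[of "inner_aut g" \<delta>] AB[OF \<kappa>'(3)] subgroup.m_closed[OF subgroup_InnAB] \<kappa>' by simp
qed

text \<open>\<open>swap\<close> exchanges \<alpha> and \<beta>, while \<open>flip\<close> inverts
  \<alpha> and, up to an inner automorphism, also \<beta>. Hence the signed permutations normalize
  \<open>InnAB\<close>.\<close>

lemma conj_InnAB:
  assumes "w \<in> SignedPerm" "\<kappa> \<in> InnAB"
  shows "w \<star> \<kappa> \<star> inv\<^sub>A w \<in> InnAB"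
  using assms
proof (induction arbitrary: \<kappa> rule: SignedPerm_induct)
  case swap
  show ?case
    by (rule conj_InnAB_gen[OF _ _ _ swap])
      (simp_all add: swap_inv aut_relations AB_in_InnAB aut_in_AB)
next
  case flip
  have inv_AB: "inv\<^sub>A aut_alpha \<in> AB" "inv\<^sub>A aut_beta \<in> AB"
    using subgroup.m_inv_closed[OF subgroup_AB] aut_in_AB by auto
  have "flip \<star> aut_alpha \<star> flip = inv\<^sub>A aut_alpha"
    using aut_relations(5) by (intro AutF2.inv_equality[symmetric]) simp_all
  moreover have "flip \<star> aut_beta \<star> flip
      = inner_aut (inv\<^sub>F (gy \<cdot> gy)) \<star> inv\<^sub>A aut_beta"
    using aut_relations(6) by (intro AutF2.inv_solve_right[THEN iffD2]) simp_all
  ultimately show ?case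
    using inv_AB by (intro conj_InnAB_gen[OF _ _ _ flip]) (simp_all add: flip_inv AB_in_InnAB InnABI)
next
  case (mult u v)
  have "u \<star> v \<star> \<kappa> \<star> inv\<^sub>A (u \<star> v)
      = u \<star> (v \<star> \<kappa> \<star> inv\<^sub>A v) \<star> inv\<^sub>A u"
    using mult by (simp add: AutF2.m_assoc AutF2.inv_mult_group)
  then show ?case using mult by metis
qed simp

lemma InnAB_signedI: "\<kappa> \<in> InnAB \<Longrightarrow> w \<in> SignedPerm \<Longrightarrow> \<kappa> \<star> w \<in> InnAB_signed"
  by (auto simp: InnAB_signed_def)

lemma subgroup_InnAB_signed: "subgroup InnAB_signed AutF2"
proof (rule AutF2.subgroupI)
  show "InnAB_signed \<subseteq> carrier AutF2" by (auto simp: InnAB_signed_def)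
  show "InnAB_signed \<noteq> {}"
    using subgroup.one_closed[OF subgroup_InnAB] subgroup.one_closed[OF subgroup_SignedPerm]
    by (auto simp: InnAB_signed_def)
  fix \<gamma> assume "\<gamma> \<in> InnAB_signed"
  then obtain \<kappa> w where \<gamma>: "\<gamma> = \<kappa> \<star> w" "\<kappa> \<in> InnAB" "w \<in> SignedPerm"
    by (auto simp: InnAB_signed_def)
  have w': "inv\<^sub>A w \<in> SignedPerm" and \<kappa>': "inv\<^sub>A \<kappa> \<in> InnAB"
    using \<gamma> subgroup.m_inv_closed[OF subgroup_SignedPerm] subgroup.m_inv_closed[OF subgroup_InnAB]
    by auto
  have "inv\<^sub>A \<gamma> = (inv\<^sub>A w \<star> inv\<^sub>A \<kappa> \<star> inv\<^sub>A (inv\<^sub>A w))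
      \<star> inv\<^sub>A w"
    using \<gamma> by (simp add: AutF2.inv_mult_group AutF2.m_assoc)
  then show "inv\<^sub>A \<gamma> \<in> InnAB_signed"
    using InnAB_signedI[OF conj_InnAB[OF w' \<kappa>'] w'] by simp
  fix \<gamma>' assume "\<gamma>' \<in> InnAB_signed"
  then obtain \<kappa>2 w2 where \<gamma>': "\<gamma>' = \<kappa>2 \<star> w2" "\<kappa>2 \<in> InnAB" "w2 \<in> SignedPerm"
    by (auto simp: InnAB_signed_def)
  have "\<gamma> \<star> \<gamma>' = (\<kappa> \<star> (w \<star> \<kappa>2 \<star> inv\<^sub>A w)) \<star> (w \<star> w2)"
    using \<gamma> \<gamma>' by (simp add: AutF2.m_assoc AutF2.inv_mult_cancel)
  also have "\<dots> \<in> InnAB_signed"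
    using subgroup.m_closed[OF subgroup_InnAB \<gamma>(2) conj_InnAB[OF \<gamma>(3) \<gamma>'(2)]]
      subgroup.m_closed[OF subgroup_SignedPerm \<gamma>(3) \<gamma>'(3)] by (rule InnAB_signedI)
  finally show "\<gamma> \<star> \<gamma>' \<in> InnAB_signed" .
qed

lemma InnAB_in_InnAB_signed: "\<kappa> \<in> InnAB \<Longrightarrow> \<kappa> \<in> InnAB_signed"
  using InnAB_signedI[OF _ subgroup.one_closed[OF subgroup_SignedPerm], of \<kappa>] by simp

lemma SignedPerm_in_InnAB_signed: "w \<in> SignedPerm \<Longrightarrow> w \<in> InnAB_signed"
  using InnAB_signedI[OF subgroup.one_closed[OF subgroup_InnAB], of w] by simp

lemma InnAB_signed_closed [simp]: "\<gamma> \<in> InnAB_signed \<Longrightarrow> \<gamma> \<in> carrier AutF2"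
  using subgroup.mem_carrier[OF subgroup_InnAB_signed] .

text \<open>A union of right cosets of \<open>InnAB_signed\<close>; combined with the signed
  permutations its three representatives give the 24 representatives modulo \<open>InnAB\<close>.
  Nielsen reduction will show that it is the whole automorphism group.\<close>

definition InnAB_transv :: "(word \<Rightarrow> word) set" where
  "InnAB_transv = {\<gamma> \<star> t | \<gamma> t. \<gamma> \<in> InnAB_signed \<and> t \<in> {\<one>\<^sub>A, transv_x, transv_y}}"

lemma InnAB_transvI:
  assumes "\<gamma> \<in> InnAB_signed" "\<delta> \<in> InnAB_signed" "t \<in> {\<one>\<^sub>A, transv_x, transv_y}" "\<sigma> \<in> carrier AutF2"
    and eq: "\<gamma> \<star> \<sigma> = \<delta> \<star> t"
  shows "\<sigma> \<in> InnAB_transv"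
proof -
  have t: "t \<in> carrier AutF2" using assms(3) by auto
  have "\<sigma> = inv\<^sub>A \<gamma> \<star> (\<gamma> \<star> \<sigma>)"
    using InnAB_signed_closed[OF assms(1)] assms(4) by (simp add: AutF2.inv_mult_cancel)
  also have "\<dots> = (inv\<^sub>A \<gamma> \<star> \<delta>) \<star> t"
    unfolding eq using assms t by (simp add: AutF2.m_assoc)
  finally show ?thesis
    using assms subgroup.m_closed[OF subgroup_InnAB_signed subgroup.m_inv_closed[OF subgroup_InnAB_signed]]
    unfolding InnAB_transv_def by blast
qed

lemma InnAB_transv_closed [simp]: "\<sigma> \<in> InnAB_transv \<Longrightarrow> \<sigma> \<in> carrier AutF2"
  by (auto simp: InnAB_transv_def)

lemma InnAB_transv_left: "\<gamma> \<in> InnAB_signed \<Longrightarrow> \<sigma> \<in> InnAB_transv \<Longrightarrow> \<gamma> \<star> \<sigma> \<in> InnAB_transv"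
proof -
  assume \<gamma>: "\<gamma> \<in> InnAB_signed" and "\<sigma> \<in> InnAB_transv"
  then obtain \<delta> t where \<sigma>: "\<sigma> = \<delta> \<star> t" "\<delta> \<in> InnAB_signed" "t \<in> {\<one>\<^sub>A, transv_x, transv_y}"
    by (auto simp: InnAB_transv_def)
  then have "\<gamma> \<star> \<sigma> = (\<gamma> \<star> \<delta>) \<star> t"
    using \<gamma> by (auto simp: AutF2.m_assoc)
  then show ?thesis
    using subgroup.m_closed[OF subgroup_InnAB_signed \<gamma> \<sigma>(2)] \<sigma>(3) unfolding InnAB_transv_def by blast
qed

text \<open>A coset table: each of the nine products of a representative with a generator is
  rewritten by \<open>aut_relations\<close> as an element of \<open>InnAB_signed\<close> times a
  representative. The generator \<open>transv_x_inv\<close> is the one that undoes a Nielsen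
  move.\<close>

lemma InnAB_transv_right:
  assumes "\<sigma> \<in> InnAB_transv" "g \<in> {swap, flip, transv_x_inv}"
  shows "\<sigma> \<star> g \<in> InnAB_transv"
proof -
  obtain \<delta> t where \<sigma>: "\<sigma> = \<delta> \<star> t" "\<delta> \<in> InnAB_signed" "t \<in> {\<one>\<^sub>A, transv_x, transv_y}"
    using assms by (auto simp: InnAB_transv_def)
  have g: "g \<in> carrier AutF2" and t: "t \<in> carrier AutF2" using assms \<sigma> by auto
  note m = subgroup.m_closed[OF subgroup_InnAB_signed]
  have gens: "swap \<in> InnAB_signed" "flip \<in> InnAB_signed" "aut_alpha \<in> InnAB_signed" "aut_beta \<in> InnAB_signed" "inner_aut gy \<in> InnAB_signed" "\<one>\<^sub>A \<in> InnAB_signed"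
    by (simp_all add: SignedPerm_in_InnAB_signed SignedPerm_gens InnAB_in_InnAB_signed AB_in_InnAB aut_in_AB
        inner_in_InnAB subgroup.one_closed[OF subgroup_InnAB_signed])
  have "t \<star> g \<in> InnAB_transv"
  proof -
    have "\<one>\<^sub>A \<star> swap \<in> InnAB_transv"
      by (rule InnAB_transvI[OF gens(6,1) insertI1]) simp_all
    moreover have "\<one>\<^sub>A \<star> flip \<in> InnAB_transv"
      by (rule InnAB_transvI[OF gens(6,2) insertI1]) simp_all
    moreover have "\<one>\<^sub>A \<star> transv_x_inv \<in> InnAB_transv"
      by (rule InnAB_transvI[OF gens(4,6), of transv_x]) (simp_all add: aut_relations)
    moreover have "transv_x \<star> swap \<in> InnAB_transv"
      by (rule InnAB_transvI[OF gens(6,1), of transv_y]) (simp_all add: aut_relations)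
    moreover have "transv_x \<star> flip \<in> InnAB_transv"
      by (rule InnAB_transvI[OF m[OF m[OF gens(4,2)] gens(5)] gens(6), of transv_x]) (simp_all add: aut_relations)
    moreover have "transv_x \<star> transv_x_inv \<in> InnAB_transv"
      by (rule InnAB_transvI[OF gens(6,6), of "\<one>\<^sub>A"]) (simp_all add: aut_relations)
    moreover have "transv_y \<star> swap \<in> InnAB_transv"
      by (rule InnAB_transvI[OF gens(6,1), of transv_x]) (simp_all add: aut_relations)
    moreover have "transv_y \<star> flip \<in> InnAB_transv"
      by (rule InnAB_transvI[OF m[OF gens(3,2)] gens(6), of transv_y]) (simp_all add: aut_relations)
    moreover have "transv_y \<star> transv_x_inv \<in> InnAB_transv"
      by (rule InnAB_transvI[OF gens(6) m[OF m[OF m[OF gens(5,4)] gens(1)] gens(2)], of transv_y])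
        (simp_all add: aut_relations)
    ultimately show ?thesis using assms(2) \<sigma>(3) by auto
  qed
  then have "\<delta> \<star> (t \<star> g) \<in> InnAB_transv" using \<sigma>(2) InnAB_transv_left by blast
  then show ?thesis using \<sigma> g t by (simp add: AutF2.m_assoc)
qed

lemma InnAB_transv_right_SignedPerm:
  "w \<in> SignedPerm \<Longrightarrow> \<sigma> \<in> InnAB_transv \<Longrightarrow> \<sigma> \<star> w \<in> InnAB_transv"
proof (induction arbitrary: \<sigma> rule: SignedPerm_induct)
  case (mult u v)
  then have "\<sigma> \<star> u \<star> v \<in> InnAB_transv" by blast
  then show ?case using mult by (simp add: AutF2.m_assoc)
qed (use InnAB_transv_right in auto)

section \<open>Length reduction by Nielsen moves\<close>

lemma aut_eq_Nil_iff:
  assumes "\<sigma> \<in> carrier AutF2" "w \<in> carrier F2"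
  shows "\<sigma> w = [] \<longleftrightarrow> w = []"
proof -
  have nil: "\<tau> [] = []" if "\<tau> \<in> carrier AutF2" for \<tau>
    using group_hom.hom_one[OF AutF2_group_hom[OF that]] by (simp add: F2_one)
  show ?thesis
    using nil[OF assms(1)] nil[of "inv\<^sub>A \<sigma>"] AutF2_inv_apply(2)[OF assms] assms(1)
    by (metis AutF2.inv_closed)
qed

lemma aut_inv_letter: "\<sigma> \<in> carrier AutF2 \<Longrightarrow> \<sigma> [inv_letter a] = winv (\<sigma> [a])"
  using F2_inv[of "\<sigma> [a]"] by (simp add: inv_letter_single)

definition total_length :: "(word \<Rightarrow> word) \<Rightarrow> nat" where
  "total_length \<sigma> = length (\<sigma> gx) + length (\<sigma> gy)"

lemma total_length_eq:
  assumes "\<sigma> \<in> carrier AutF2" "fst k \<noteq> fst l"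
  shows "total_length \<sigma> = length (\<sigma> [k]) + length (\<sigma> [l])"
proof -
  have len: "length (\<sigma> [a]) = length (\<sigma> [(fst a, False)])" for a
  proof (cases "snd a")
    case True
    then have "a = inv_letter (fst a, False)" by (simp add: inv_letter_def prod_eq_iff)
    then show ?thesis using aut_inv_letter[OF assms(1), of "(fst a, False)"] by simp
  next
    case False
    then have "(fst a, False) = a" by (simp add: prod_eq_iff)
    then show ?thesis by simp
  qed
  then show ?thesis
    using assms(2) len[of k] len[of l]
    by (cases "fst k"; cases "fst l") (simp_all add: total_length_def gx_def gy_def)
qed

text \<open>Either some product of images of two letters is shorter than its first factor, or
  \<open>no_half\<close> fails and a conjugation helps, or the images are Nielsen reduced, which is
  possible only at total length 2.\<close>

lemma shorter_cases:
  assumes \<sigma>: "\<sigma> \<in> carrier AutF2" and long: "2 < total_length \<sigma>"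
  obtains k l g where "fst k \<noteq> fst l" "g \<in> carrier F2"
    "length (g \<cdot> (\<sigma> [k] \<cdot> \<sigma> [l]) \<cdot> inv\<^sub>F g)
      + length (g \<cdot> \<sigma> [l] \<cdot> inv\<^sub>F g) < total_length \<sigma>"
proof -
  define A where "A a = \<sigma> [a]" for a
  have car: "A a \<in> carrier F2" for a using \<sigma> by (simp add: A_def)
  have red: "reduced_word (A a)" for a using car by (simp add: F2_carrier_iff)
  have A_inv: "A (inv_letter a) = winv (A a)" for a
    using aut_inv_letter[OF \<sigma>] by (simp add: A_def)
  have nonempty: "A a \<noteq> []" for a
    using aut_eq_Nil_iff[OF \<sigma>, of "[a]"] by (simp add: A_def)
  have len: "total_length \<sigma> = length (A k) + length (A l)" if "fst k \<noteq> fst l" for k l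
    using total_length_eq[OF \<sigma> that] by (simp add: A_def)
  show ?thesis
  proof (cases "\<exists>k l. fst k \<noteq> fst l \<and> length (A k \<cdot> A l) < length (A k)")
    case True
    then obtain k l where kl: "fst k \<noteq> fst l" "length (A k \<cdot> A l) < length (A k)" by blast
    show ?thesis
      using that[of k l "\<one>\<^sub>F"] kl len[OF kl(1)] car by (simp flip: A_def)
  next
    case no_shortening: False
    show ?thesis
    proof (cases "\<exists>k l s t p d. fst k \<noteq> fst l \<and> A k = s @ t \<and> A l = p @ winv s \<and>
        A l = winv t @ d \<and> length s = length t")
      \<comment> \<open>The conjugation is by \<open>t\<close>: it takes \<open>A k\<close> to
        \<open>t \<cdot> s\<close>, which is no longer, and \<open>A l \<cdot> A k\<close> to
        \<open>d \<cdot> s\<close>, which is shorter than \<open>A l\<close> because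
        \<open>d\<close> ends in the inverse of \<open>s\<close>.\<close>
      case True
      then obtain k l s t p d where *: "fst k \<noteq> fst l" "A k = s @ t" "A l = p @ winv s"
        "A l = winv t @ d" "length s = length t" by blast
      have cars: "s \<in> carrier F2" "t \<in> carrier F2" "p \<in> carrier F2" "d \<in> carrier F2"
        "winv s \<in> carrier F2" "winv t \<in> carrier F2"
        using red[of k] red[of l] *(2,3) red[of l, unfolded *(4)]
        by (auto simp: F2_carrier_iff reduced_append)
      have k: "A k = s \<cdot> t" and l: "A l = p \<cdot> inv\<^sub>F s" "A l = inv\<^sub>F t \<cdot> d"
        using red[of k] red[of l] * F2_append[of s t] F2_append[of p "winv s"] F2_append[of "winv t" d]
          cars F2_inv[OF cars(1)] F2_inv[OF cars(2)] by metis+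
      have conj_k: "t \<cdot> A k \<cdot> inv\<^sub>F t = t \<cdot> s"
        using cars by (simp add: k F2.m_assoc)
      have conj_lk: "t \<cdot> (A l \<cdot> A k) \<cdot> inv\<^sub>F t = d \<cdot> s"
        using cars by (simp add: k l(2) F2.m_assoc F2.inv_mult_cancel)
      have "t \<noteq> []" using *(2,5) nonempty[of k] by auto
      \<comment> \<open>This bound places the inverse of \<open>s\<close> at the end of
        \<open>A l\<close> inside \<open>d\<close>. It holds because
        \<open>A l \<cdot> A k = p \<cdot> t\<close> is no longer than \<open>A l\<close>, and it
        cannot be shorter than \<open>A k\<close> by \<open>no_shortening\<close>.\<close>
      have "length (A k) \<le> length (A l)"
      proof -
        have "A l \<cdot> A k = p \<cdot> t"
          using cars by (simp add: k l(1) F2.m_assoc F2_inv_cancel)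
        then have "length (A l \<cdot> A k) \<le> length p + length t" by (simp add: F2_mult_length)
        then have "length (A l \<cdot> A k) \<le> length (A l)" using *(3,5) by simp
        moreover have "length (A k) \<le> length (A l \<cdot> A k)"
        proof -
          have "inv\<^sub>F (A l \<cdot> A k) = A (inv_letter k) \<cdot> A (inv_letter l)"
            using car by (simp add: A_inv F2_inv[symmetric] F2.inv_mult_group)
          then have *: "A (inv_letter k) \<cdot> A (inv_letter l) = winv (A l \<cdot> A k)"
            using F2_inv[OF F2.m_closed[OF car car], of l k] by metis
          have "length (A (inv_letter k) \<cdot> A (inv_letter l)) = length (A l \<cdot> A k)"
            unfolding * by simp
          moreover have "length (A (inv_letter k)) \<le> length (A (inv_letter k) \<cdot> A (inv_letter l))"
            using no_shortening \<open>fst k \<noteq> fst l\<close> by (metis inv_letter_sel(1) not_less)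
          ultimately show ?thesis by (simp add: A_inv)
        qed
        ultimately show ?thesis by simp
      qed
      then have "length t \<le> length d" using *(2,4,5) by simp
      have "length (d \<cdot> s) < length (A l)"
      proof -
        have "winv t @ d = p @ winv s" using *(3,4) by metis
        moreover from arg_cong[OF this, of length] have "length t \<le> length p"
          using \<open>length t \<le> length d\<close> *(5) by simp
        ultimately have "d = drop (length t) p @ winv s"
          by (metis append_eq_conv_conj diff_is_0_eq drop0 drop_append length_map length_rev)
        then obtain d' where d': "d = d' @ winv s" by blast
        have "d' \<in> carrier F2" using cars(4) d' by (simp add: F2_carrier_iff reduced_append)
        then have "d = d' \<cdot> inv\<^sub>F s"
          using d' F2_append[of d' "winv s"] cars(1,4) by (simp add: F2_inv F2_carrier_iff)
        then have "d \<cdot> s = d'"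
          using \<open>d' \<in> carrier F2\<close> cars by (simp add: F2.m_assoc)
        then show ?thesis using *(4) d' \<open>t \<noteq> []\<close> by simp
      qed
      moreover have "length (t \<cdot> s) \<le> length (A k)"
        using F2_mult_length[of t s] *(2) by simp
      ultimately show ?thesis
        using that[of l k t] *(1) cars(2) len[OF *(1)] conj_k conj_lk by (simp flip: A_def)
    next
      case False
      interpret nielsen_reduced A
      proof
        show "length (A k) \<le> length (A k \<cdot> A l)" if "fst k \<noteq> fst l" for k l
          using no_shortening that by (metis not_less)
      qed (use red nonempty A_inv False in blast)+
      \<comment> \<open>Applying \<sigma> does not shorten words now, so the preimage of a letter is
        itself a letter.\<close>
      have single: "\<exists>a. A a = [c]" for c
      proof -
        obtain w where w: "w \<in> carrier F2" "\<sigma> w = [c]" using AutF2_surj[OF \<sigma>, of "[c]"] by auto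
        have "length w \<le> length (\<sigma> w)"
          using length_product[OF AutF2_hom[OF \<sigma>], of w] w(1) by (simp add: A_def F2_carrier_iff)
        moreover have "w \<noteq> []" using aut_eq_Nil_iff[OF \<sigma> w(1)] w(2) by simp
        ultimately obtain a where "w = [a]" using w(2) by (cases w) auto
        then show ?thesis using w unfolding A_def by blast
      qed
      obtain a b where ab: "A a = [(GX, False)]" "A b = [(GY, False)]" using single by metis
      have "fst a \<noteq> fst b"
      proof
        assume "fst a = fst b"
        then have "b = a \<or> b = inv_letter a" by (auto simp: inv_letter_def prod_eq_iff)
        then show False using ab A_inv[of a] by (auto simp: inv_letter_def)
      qed
      then have "total_length \<sigma> = 2" using len[of a b] ab by simp
      then show ?thesis using long by simp
    qed
  qed
qed

lemma expsum_gens [simp]: "expsum GX gx = 1" "expsum GY gx = 0" "expsum GX gy = 0" "expsum GY gy = 1"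
  by (simp_all add: gx_def gy_def expsum_Cons)

lemma expsum_hom:
  assumes "\<sigma> \<in> carrier AutF2" "w \<in> carrier F2"
  shows "expsum h (\<sigma> w) = expsum GX w * expsum h (\<sigma> gx) + expsum GY w * expsum h (\<sigma> gy)"
  using assms(2)
proof (induction rule: F2_induct)
  case one
  then show ?case
    using group_hom.hom_one[OF AutF2_group_hom[OF assms(1)]] by (simp add: F2_one)
next
  case (letter a w)
  have "expsum h (\<sigma> [a]) = expsum GX [a] * expsum h (\<sigma> gx) + expsum GY [a] * expsum h (\<sigma> gy)"
    using letter_cases[of a] assms(1)
    by (auto simp: expsum_inv)
  then show ?case using letter assms(1) by (simp add: expsum_mult algebra_simps)
qed

text \<open>Induction on the total length. A shortening move is a transvection conjugated by a
  signed permutation, followed by an inner automorphism; all of these can be undone inside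
  \<open>InnAB_transv\<close>. At length 2 only signed permutations are left.\<close>

lemma InnAB_transv_UNIV: "\<sigma> \<in> carrier AutF2 \<Longrightarrow> \<sigma> \<in> InnAB_transv"
proof (induction "total_length \<sigma>" arbitrary: \<sigma> rule: less_induct)
  case less
  note \<sigma> = less.prems
  show ?case
  proof (cases "2 < total_length \<sigma>")
    case True
    obtain k l g where kl: "fst k \<noteq> fst l" and g: "g \<in> carrier F2"
      and short: "length (g \<cdot> (\<sigma> [k] \<cdot> \<sigma> [l]) \<cdot> inv\<^sub>F g)
        + length (g \<cdot> \<sigma> [l] \<cdot> inv\<^sub>F g) < total_length \<sigma>"
      using shorter_cases[OF \<sigma> True] by blast
    obtain w where w: "w \<in> SignedPerm" "w gx = [k]" "w gy = [l]"
      using SignedPerm_exists[OF kl] by blast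
    define w' where "w' = inv\<^sub>A w"
    have w': "w' \<in> SignedPerm"
      unfolding w'_def using subgroup.m_inv_closed[OF subgroup_SignedPerm w(1)] .
    have wk: "w' [k] = gx" "w' [l] = gy"
      using w AutF2_inv_apply(2)[of w gx] AutF2_inv_apply(2)[of w gy] by (simp_all add: w'_def)
    \<comment> \<open>The factor \<open>w \<star> transv_x \<star> w'\<close> sends
      \<open>[k]\<close> to \<open>[k] \<cdot> [l]\<close> and fixes \<open>[l]\<close>.\<close>
    define \<tau> where "\<tau> = inner_aut g \<star> (\<sigma> \<star> w \<star> transv_x \<star> w')"
    have \<tau>: "\<tau> \<in> carrier AutF2" using g \<sigma> w w' by (simp add: \<tau>_def)
    have "g \<cdot> (\<sigma> [k] \<cdot> \<sigma> [l]) \<cdot> inv\<^sub>F g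
        = (g \<cdot> \<sigma> [k] \<cdot> inv\<^sub>F g) \<cdot> (g \<cdot> \<sigma> [l] \<cdot> inv\<^sub>F g)"
      using g \<sigma> by (simp add: F2.m_assoc F2_inv_cancel)
    then have "total_length \<tau> < total_length \<sigma>"
      using total_length_eq[OF \<tau> kl] short g \<sigma> w w' wk by (simp add: \<tau>_def)
    then have "\<tau> \<in> InnAB_transv" using less.hyps \<tau> by blast
    then have "inner_aut (inv\<^sub>F g) \<star> \<tau> \<star> w \<star> transv_x_inv \<star> w' \<in> InnAB_transv"
      using g w w' by (intro InnAB_transv_right_SignedPerm InnAB_transv_right InnAB_transv_left InnAB_in_InnAB_signed inner_in_InnAB) auto
    moreover have "inner_aut (inv\<^sub>F g) \<star> \<tau> \<star> w \<star> transv_x_inv \<star> w' = \<sigma>"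
    proof -
      have "transv_x \<star> (transv_x_inv \<star> w') = w'"
        using aut_relations(7) w' by (simp flip: AutF2.m_assoc)
      then show ?thesis
        using g \<sigma> w(1) w' unfolding \<tau>_def inner_inv[OF g, symmetric] w'_def
        by (simp add: AutF2.m_assoc AutF2.inv_mult_cancel)
    qed
    ultimately show ?thesis by simp
  next
    case False
    have "\<sigma> gx \<noteq> []" "\<sigma> gy \<noteq> []"
      using aut_eq_Nil_iff[OF \<sigma> gx_carrier] aut_eq_Nil_iff[OF \<sigma> gy_carrier] by (auto simp: gx_def gy_def)
    then have "length (\<sigma> gx) = 1" "length (\<sigma> gy) = 1"
      using False by (cases "\<sigma> gx"; cases "\<sigma> gy"; simp add: total_length_def)+
    then obtain k l where kl: "\<sigma> gx = [k]" "\<sigma> gy = [l]" by (auto simp: length_Suc_conv)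
    have "fst k \<noteq> fst l"
    proof
      assume eq: "fst k = fst l"
      \<comment> \<open>If both images belonged to one generator, the exponent sum \<open>h\<close>
        of the other one would vanish on the image of \<sigma>, which is everything.\<close>
      define h where "h = (if fst k = GX then GY else GX)"
      have "expsum h (\<sigma> gx) = 0" "expsum h (\<sigma> gy) = 0"
        using kl eq by (cases "fst k"; simp add: h_def expsum_Cons)+
      then have "expsum h (\<sigma> w) = 0" if "w \<in> carrier F2" for w
        using expsum_hom[OF \<sigma> that] by simp
      then have "expsum h [(h, False)] = 0"
        using AutF2_surj[OF \<sigma>, of "[(h, False)]"] by fastforce
      moreover have "expsum h [(h, False)] = 1" by (simp add: expsum_Cons)
      ultimately show False by simp
    qed
    then obtain w where "w \<in> SignedPerm" "w gx = [k]" "w gy = [l]"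
      using SignedPerm_exists by blast
    then have "\<sigma> \<in> InnAB_signed" using AutF2_eqI[OF \<sigma>, of w] kl SignedPerm_in_InnAB_signed by simp
    then show ?thesis
      using InnAB_transvI[OF subgroup.one_closed[OF subgroup_InnAB_signed], of \<sigma> "\<one>\<^sub>A" \<sigma>] \<sigma> by simp
  qed
qed

section \<open>Exponent sums modulo 2 and modulo 4\<close>

lemma InnAB_signed_parity:
  assumes "\<gamma> \<in> InnAB_signed" "w \<in> carrier F2"
  shows "even (expsum GX (\<gamma> w) + expsum GY (\<gamma> w)) \<longleftrightarrow> even (expsum GX w + expsum GY w)"
proof -
  define S where "S = {\<sigma> \<in> carrier AutF2. \<forall>w\<in>carrier F2.
    even (expsum GX (\<sigma> w) + expsum GY (\<sigma> w)) \<longleftrightarrow> even (expsum GX w + expsum GY w)}"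
  have S: "subgroup S AutF2"
  proof (rule AutF2.subgroupI)
    show "S \<noteq> {}" using AutF2.one_closed by (auto simp: S_def)
    fix \<sigma> assume \<sigma>: "\<sigma> \<in> S"
    show "inv\<^sub>A \<sigma> \<in> S"
      unfolding S_def
    proof (intro CollectI conjI ballI)
      fix w assume w: "w \<in> carrier F2"
      have \<sigma>': "\<sigma> \<in> carrier AutF2" using \<sigma> by (simp add: S_def)
      define v where "v = (inv\<^sub>A \<sigma>) w"
      have v: "v \<in> carrier F2" "\<sigma> v = w" using w \<sigma>' by (simp_all add: v_def)
      have "even (expsum GX (\<sigma> v) + expsum GY (\<sigma> v)) \<longleftrightarrow> even (expsum GX v + expsum GY v)"
        using \<sigma> v(1) unfolding S_def by blast
      then show "even (expsum GX ((inv\<^sub>A \<sigma>) w) + expsum GY ((inv\<^sub>A \<sigma>) w))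
          \<longleftrightarrow> even (expsum GX w + expsum GY w)"
        unfolding v(2) unfolding v_def by blast
    qed (use \<sigma> in \<open>simp add: S_def\<close>)
  qed (auto simp: S_def)
  \<comment> \<open>The parity of the total exponent sum is preserved as soon as the images of x and
    y both have odd total, and this is easily read off the generators.\<close>
  have SI: "\<sigma> \<in> S" if "\<sigma> \<in> carrier AutF2" "odd (expsum GX (\<sigma> gx) + expsum GY (\<sigma> gx))"
    "odd (expsum GX (\<sigma> gy) + expsum GY (\<sigma> gy))" for \<sigma>
    unfolding S_def
  proof (intro CollectI conjI ballI that(1))
    fix w assume w: "w \<in> carrier F2"
    have eq: "expsum GX (\<sigma> w) + expsum GY (\<sigma> w)
      = expsum GX w * (expsum GX (\<sigma> gx) + expsum GY (\<sigma> gx))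
        + expsum GY w * (expsum GX (\<sigma> gy) + expsum GY (\<sigma> gy))"
      unfolding expsum_hom[OF that(1) w] by (simp only: algebra_simps)
    show "even (expsum GX (\<sigma> w) + expsum GY (\<sigma> w)) \<longleftrightarrow> even (expsum GX w + expsum GY w)"
      unfolding eq using that(2,3) by (simp only: even_add even_mult_iff) blast
  qed
  have inn: "inner_aut g \<in> S" if "g \<in> carrier F2" for g
    using that by (intro SI) (simp_all add: expsum_mult expsum_inv)
  have "{aut_alpha, aut_beta} \<subseteq> S"
    by (auto intro!: SI simp: expsum_mult)
  then have "AB \<subseteq> S"
    unfolding AB_def by (rule AutF2.generate_subgroup_incl[OF _ S])
  then have "InnAB \<subseteq> S"
    using inn subgroup.m_closed[OF S] by (auto simp: InnAB_def)
  moreover have "{swap, flip} \<subseteq> S"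
    by (auto intro!: SI simp: expsum_inv)
  then have "SignedPerm \<subseteq> S"
    unfolding SignedPerm_def by (rule AutF2.generate_subgroup_incl[OF _ S])
  ultimately have "InnAB_signed \<subseteq> S"
    using subgroup.m_closed[OF S] by (auto simp: InnAB_signed_def)
  then show ?thesis using assms by (auto simp: S_def)
qed

text \<open>Modulo 4 the matrices have diagonal entries 1 and off-diagonal entries 2 k and 2 l.
  Multiplication adds the parameters, because products of two off-diagonal entries vanish modulo
  4.\<close>

lemma AB_mod_4:
  assumes "\<delta> \<in> AB"
  shows "\<exists>k l. \<forall>w\<in>carrier F2. 4 dvd expsum GX (\<delta> w) - expsum GX w - 2 * k * expsum GY w \<and>
    4 dvd expsum GY (\<delta> w) - expsum GY w - 2 * l * expsum GX w"
proof -
  define P where "P \<sigma> k l \<longleftrightarrow> (\<forall>w\<in>carrier F2. 4 dvd expsum GX (\<sigma> w) - expsum GX w - 2 * k * expsum GY w \<and>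
    4 dvd expsum GY (\<sigma> w) - expsum GY w - 2 * l * expsum GX w)" for \<sigma> k l
  define S where "S = {\<sigma> \<in> carrier AutF2. \<exists>k l. P \<sigma> k l}"
  have arith: "4 dvd x - z - 2 * (k + k') * t \<and> 4 dvd y - t - 2 * (l + l') * z"
    if dvds: "4 dvd x - u - 2 * k * v" "4 dvd y - v - 2 * l * u" "4 dvd u - z - 2 * k' * t" "4 dvd v - t - 2 * l' * z"
    for x y z t u v k k' l l' :: int
  proof -
    obtain a b c d where "x - u - 2 * k * v = 4 * a" "y - v - 2 * l * u = 4 * b"
      "u - z - 2 * k' * t = 4 * c" "v - t - 2 * l' * z = 4 * d"
      using dvds unfolding dvd_def by blast
    then have "x = 4 * a + u + 2 * k * v" "y = 4 * b + v + 2 * l * u"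
      and u: "u = 4 * c + z + 2 * k' * t" and v: "v = 4 * d + t + 2 * l' * z" by simp_all
    then have "x - z - 2 * (k + k') * t = 4 * (a + c + k * (2 * d + l' * z))"
      "y - t - 2 * (l + l') * z = 4 * (b + d + l * (2 * c + k' * t))"
      by (simp_all add: algebra_simps)
    then show ?thesis by simp
  qed
  have arith': "4 dvd x - u - 2 * (- k) * v \<and> 4 dvd y - v - 2 * (- l) * u"
    if dvds: "4 dvd u - x - 2 * k * y" "4 dvd v - y - 2 * l * x" for x y u v k l :: int
  proof -
    obtain a b where "u - x - 2 * k * y = 4 * a" "v - y - 2 * l * x = 4 * b"
      using dvds unfolding dvd_def by blast
    then have u: "u = 4 * a + x + 2 * k * y" and v: "v = 4 * b + y + 2 * l * x" by simp_all
    have "x - u - 2 * (- k) * v = 4 * (- a + k * (2 * b + l * x))"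
      "y - v - 2 * (- l) * u = 4 * (- b + l * (2 * a + k * y))"
      by (simp_all add: u v algebra_simps)
    then show ?thesis by simp
  qed
  have S: "subgroup S AutF2"
  proof (rule AutF2.subgroupI)
    have "P \<one>\<^sub>A 0 0" by (simp add: P_def)
    then show "S \<noteq> {}" using AutF2.one_closed by (auto simp: S_def)
    fix \<sigma> assume "\<sigma> \<in> S"
    then obtain k l where \<sigma>: "\<sigma> \<in> carrier AutF2" "P \<sigma> k l" by (auto simp: S_def)
    have "P (inv\<^sub>A \<sigma>) (- k) (- l)"
      unfolding P_def
    proof
      fix w assume w: "w \<in> carrier F2"
      define v where "v = (inv\<^sub>A \<sigma>) w"
      have "v \<in> carrier F2" "\<sigma> v = w" using w \<sigma> by (simp_all add: v_def)
      then show "4 dvd expsum GX ((inv\<^sub>A \<sigma>) w) - expsum GX w - 2 * (- k) * expsum GY w \<and>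
          4 dvd expsum GY ((inv\<^sub>A \<sigma>) w) - expsum GY w - 2 * (- l) * expsum GX w"
        using \<sigma>(2) arith'[of "expsum GX w" "expsum GX v" k "expsum GY v" "expsum GY w" l]
        unfolding P_def v_def[symmetric] by metis
    qed
    then show "inv\<^sub>A \<sigma> \<in> S" using \<sigma> by (auto simp: S_def)
    fix \<tau> assume "\<tau> \<in> S"
    then obtain k' l' where \<tau>: "\<tau> \<in> carrier AutF2" "P \<tau> k' l'" by (auto simp: S_def)
    have "P (\<sigma> \<star> \<tau>) (k + k') (l + l')"
      unfolding P_def
    proof
      fix w assume w: "w \<in> carrier F2"
      then show "4 dvd expsum GX ((\<sigma> \<star> \<tau>) w) - expsum GX w - 2 * (k + k') * expsum GY w \<and>
          4 dvd expsum GY ((\<sigma> \<star> \<tau>) w) - expsum GY w - 2 * (l + l') * expsum GX w"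
        using \<sigma> \<tau> unfolding P_def by (simp only: AutF2_mult) (intro arith, auto)
    qed
    then show "\<sigma> \<star> \<tau> \<in> S" using \<sigma> \<tau> by (auto simp: S_def)
  qed (auto simp: S_def)
  have "P aut_alpha 1 0" "P aut_beta 0 1"
    by (simp_all add: P_def expsum_hom expsum_mult)
  then have "{aut_alpha, aut_beta} \<subseteq> S" unfolding S_def using auts_closed by blast
  then have "AB \<subseteq> S"
    unfolding AB_def by (rule AutF2.generate_subgroup_incl[OF _ S])
  then show ?thesis using assms by (auto simp: S_def P_def)
qed

text \<open>Parity rules out the two transvections: they send x or y to a word of even total
  exponent sum. The diagonal entries modulo 4 then force the signed permutation to be
  trivial.\<close>

lemma congruent_mod_4_in_InnAB:
  assumes \<sigma>: "\<sigma> \<in> carrier AutF2"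
    and cong: "\<And>w h. w \<in> carrier F2 \<Longrightarrow> 4 dvd expsum h (\<sigma> w) - expsum h w"
  shows "\<sigma> \<in> InnAB"
proof -
  obtain \<gamma> t where \<gamma>: "\<sigma> = \<gamma> \<star> t" "\<gamma> \<in> InnAB_signed" and t: "t \<in> {\<one>\<^sub>A, transv_x, transv_y}"
    using InnAB_transv_UNIV[OF \<sigma>] by (auto simp: InnAB_transv_def)
  have even: "even (expsum h (\<sigma> w) - expsum h w)" if "w \<in> carrier F2" for w h
    using cong[OF that, of h] by (metis dvd_trans even_numeral)
  have "t \<noteq> transv_x"
  proof
    assume "t = transv_x"
    then have "even (expsum GX (\<sigma> gx) + expsum GY (\<sigma> gx))"
      using InnAB_signed_parity[OF \<gamma>(2), of "gx \<cdot> gy"] \<gamma> by (simp add: expsum_mult)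
    then show False using even[of gx GX] even[of gx GY] by simp
  qed
  moreover have "t \<noteq> transv_y"
  proof
    assume "t = transv_y"
    then have "even (expsum GX (\<sigma> gy) + expsum GY (\<sigma> gy))"
      using InnAB_signed_parity[OF \<gamma>(2), of "gy \<cdot> gx"] \<gamma> by (simp add: expsum_mult)
    then show False using even[of gy GX] even[of gy GY] by simp
  qed
  ultimately have "\<sigma> \<in> InnAB_signed" using \<gamma> t by auto
  then obtain g \<delta> w where \<sigma>': "\<sigma> = inner_aut g \<star> \<delta> \<star> w"
    and g: "g \<in> carrier F2" and \<delta>: "\<delta> \<in> AB" and w: "w \<in> SignedPerm"
    by (auto simp: InnAB_signed_def InnAB_def)
  have exp: "expsum h (\<sigma> v) = expsum h (\<delta> (w v))" if "v \<in> carrier F2" for h v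
    using that g \<delta> w by (simp add: \<sigma>' expsum_mult expsum_inv)
  obtain k l where kl: "w gx = [k]" "w gy = [l]"
    using SignedPerm_letter[OF w] by (metis gx_def gy_def)
  obtain i j where ij: "\<And>v. v \<in> carrier F2 \<Longrightarrow> 4 dvd expsum GX (\<delta> v) - expsum GX v - 2 * i * expsum GY v"
    "\<And>v. v \<in> carrier F2 \<Longrightarrow> 4 dvd expsum GY (\<delta> v) - expsum GY v - 2 * j * expsum GX v"
    using AB_mod_4[OF \<delta>] by blast
  have "4 dvd (expsum GX (\<sigma> gx) - 1) - (expsum GX (\<sigma> gx) - expsum GX [k] - 2 * i * expsum GY [k])"
    by (rule dvd_diff) (use cong[of gx GX] ij(1)[of "[k]"] exp[of gx GX] kl in simp_all)
  \<comment> \<open>A y-letter makes the right side odd and the inverse of x makes it -2, so only x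
    is left.\<close>
  then have "4 dvd expsum GX [k] + 2 * i * expsum GY [k] - 1" by (simp add: algebra_simps)
  then have k: "k = (GX, False)"
    by (cases k; cases "fst k"; cases "snd k") (simp_all add: expsum_Cons, presburger+)
  have "4 dvd (expsum GY (\<sigma> gy) - 1) - (expsum GY (\<sigma> gy) - expsum GY [l] - 2 * j * expsum GX [l])"
    by (rule dvd_diff) (use cong[of gy GY] ij(2)[of "[l]"] exp[of gy GY] kl in simp_all)
  then have "4 dvd expsum GY [l] + 2 * j * expsum GX [l] - 1" by (simp add: algebra_simps)
  then have l: "l = (GY, False)"
    by (cases l; cases "fst l"; cases "snd l") (simp_all add: expsum_Cons, presburger+)
  have "w = \<one>\<^sub>A"
    using AutF2_eqI[OF SignedPerm_closed[OF w] AutF2.one_closed] kl k l by (simp add: gx_def gy_def)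
  then show ?thesis using \<sigma>' g \<delta> by (simp add: InnABI)
qed

section \<open>Lifting \<open>\<pi>\<close> to the free group\<close>

text \<open>The table of \<open>coset_label\<close> with x and y in place of \<alpha> and \<beta>.
  Identities between values are thus proved in the free group and carried to automorphisms by
  \<open>AB_eval\<close>.\<close>

fun free_label :: "bool \<times> bool \<Rightarrow> letter \<Rightarrow> word" where
  "free_label (r, s) (GX, False) =
     (if r then if s then inv\<^sub>F gx else gx else \<one>\<^sub>F)"
| "free_label (r, s) (GX, True) =
     (if r then \<one>\<^sub>F else if s then gx else inv\<^sub>F gx)"
| "free_label (r, s) (GY, False) =
     (if s then if r then inv\<^sub>F gy else gy else \<one>\<^sub>F)"
| "free_label (r, s) (GY, True) =
     (if s then \<one>\<^sub>F else if r then gy else inv\<^sub>F gy)"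

fun free_walk :: "bool \<times> bool \<Rightarrow> word \<Rightarrow> word" where
  "free_walk c [] = \<one>\<^sub>F"
| "free_walk c (a # w) = free_label c a \<cdot> free_walk (coset_step c a) w"

lemma free_label_closed [simp]: "free_label c a \<in> carrier F2"
  by (cases "(c, a)" rule: free_label.cases) auto

lemma free_walk_closed [simp]: "free_walk c w \<in> carrier F2"
  by (induction w arbitrary: c) auto

lemma free_label_inv:
  "free_label c a \<cdot> free_label (coset_step c a) (inv_letter a) = \<one>\<^sub>F"
  by (cases "(c, a)" rule: free_label.cases) (auto simp: inv_letter_def)

lemma free_walk_lcons: "free_walk c (lcons a w) = free_walk c (a # w)"
proof (cases w)
  case (Cons b v)
  show ?thesis
  proof (cases "b = inv_letter a")
    case True
    then show ?thesis
      using Cons free_label_inv[of c a] by (simp flip: F2.m_assoc)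
  qed (simp add: Cons)
qed simp

lemma free_walk_mult:
  "free_walk c (u \<cdot> v) = free_walk c u \<cdot> free_walk (foldl coset_step c u) v"
proof (induction u arbitrary: c)
  case Nil
  have "foldr lcons [] v = v" by simp
  then show ?case using F2.l_one[OF free_walk_closed[of c v]] by (simp add: F2_mult[of "[]"])
next
  case (Cons a u)
  have "(a # u) \<cdot> v = lcons a (u \<cdot> v)" by (simp add: F2_mult)
  then show ?case using Cons by (simp add: free_walk_lcons F2.m_assoc)
qed

lemma foldl_coset_step_mult:
  "foldl coset_step c (u \<cdot> v) = foldl coset_step (foldl coset_step c u) v"
  by (cases c) (auto simp: foldl_coset_step expsum_mult)

abbreviation origin :: "bool \<times> bool" where "origin \<equiv> (False, False)"

abbreviation pi_lift :: "word \<Rightarrow> word" where "pi_lift \<equiv> free_walk origin"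

lemma foldl_coset_step_Delta: "w \<in> Delta \<Longrightarrow> foldl coset_step c w = c"
  by (cases c) (simp add: Delta_def foldl_coset_step)

lemma Delta_iff: "w \<in> carrier F2 \<Longrightarrow> w \<in> Delta \<longleftrightarrow> foldl coset_step origin w = origin"
  by (simp add: Delta_def foldl_coset_step)

lemma Delta_carrier [simp]: "w \<in> Delta \<Longrightarrow> w \<in> carrier F2"
  by (simp add: Delta_def)

definition AB_eval :: "word \<Rightarrow> word \<Rightarrow> word" where
  "AB_eval = free_lift AutF2 (case_gen aut_alpha aut_beta)"

lemma AB_eval_range: "range (case_gen aut_alpha aut_beta) \<subseteq> carrier AutF2"
  by (auto split: gen.splits)

lemma AB_eval_group_hom: "group_hom F2 AutF2 AB_eval"
  using AutF2.free_lift_hom[OF AB_eval_range]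
  by (simp add: AB_eval_def group_hom_def group_hom_axioms_def group_F2 AutF2.is_group)

interpretation AB_eval: group_hom F2 AutF2 AB_eval
  by (rule AB_eval_group_hom)

lemma AB_eval_gens [simp]: "AB_eval gx = aut_alpha" "AB_eval gy = aut_beta"
  using AutF2.free_lift_gen[OF AB_eval_range] by (simp_all add: AB_eval_def)

lemma AB_eval_free_walk: "AB_eval (free_walk c w) = coset_walk c w"
proof (induction w arbitrary: c)
  case (Cons a w)
  have "AB_eval (free_label c a) = coset_label c a"
    by (cases "(c, a)" rule: free_label.cases) auto
  then show ?case using Cons by simp
qed simp

text \<open>The elements \<open>e1\<close> and \<open>e3\<close> lie over x and y, so every letter
  has a preimage in \<open>Delta\<close>.\<close>

lemma free_walk_surj:
  assumes "v \<in> carrier F2"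
  shows "\<exists>d\<in>Delta. pi_lift d = v"
  using assms
proof (induction rule: F2_induct)
  case one
  then show ?case
    using subgroup.one_closed[OF subgroup_Delta] by (intro bexI[of _ "\<one>\<^sub>F"]) (simp_all add: F2_one)
next
  case (letter a w)
  then obtain d where d: "d \<in> Delta" "pi_lift d = w" by blast
  have e: "pi_lift e1 = gx" "pi_lift e3 = gy"
    "pi_lift (inv\<^sub>F e1) = inv\<^sub>F gx" "pi_lift (inv\<^sub>F e3) = inv\<^sub>F gy"
    unfolding inv_e_words by (simp_all add: e_words)
  have "inv\<^sub>F e1 \<in> Delta" "inv\<^sub>F e3 \<in> Delta"
    using subgroup.m_inv_closed[OF subgroup_Delta] e_in_Delta by auto
  then obtain b where b: "b \<in> Delta" "pi_lift b = [a]"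
    using letter_cases[of a] e e_in_Delta by auto
  have "pi_lift (b \<cdot> d) = [a] \<cdot> w"
    using b d by (simp add: free_walk_mult foldl_coset_step_Delta)
  then show ?case using subgroup.m_closed[OF subgroup_Delta b(1) d(1)] by blast
qed

text \<open>\<open>\<delta>\<close> changes the edge labels of the Schreier graph by the coboundary of \<open>h\<close>.\<close>

lemma free_walk_cocycle:
  assumes \<delta>: "\<delta> \<in> carrier AutF2" and h: "\<And>c. h c \<in> carrier F2"
    and letter: "\<And>c a. foldl coset_step c (\<delta> [a]) = coset_step c a \<and>
      free_walk c (\<delta> [a]) = h c \<cdot> free_label c a \<cdot> inv\<^sub>F h (coset_step c a)"
    and w: "w \<in> carrier F2"
  shows "foldl coset_step c (\<delta> w) = foldl coset_step c w \<and>
    free_walk c (\<delta> w) = h c \<cdot> free_walk c w \<cdot> inv\<^sub>F h (foldl coset_step c w)"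
  using w
proof (induction arbitrary: c rule: F2_induct)
  case one
  have "\<delta> [] = []"
    using group_hom.hom_one[OF AutF2_group_hom[OF \<delta>]] by (simp add: F2_one)
  then show ?case using F2.r_inv[OF h[of c]] F2.r_one[OF h[of c]] by (simp add: F2_one[symmetric]) (simp add: F2_one)
next
  case (letter a w)
  let ?c = "coset_step c a"
  have 1: "\<delta> ([a] \<cdot> w) = \<delta> [a] \<cdot> \<delta> w"
    using \<delta> letter by simp
  have 2: "free_walk c ([a] \<cdot> w) = free_label c a \<cdot> free_walk ?c w"
    by (simp add: free_walk_mult)
  have 3: "foldl coset_step c (\<delta> [a]) = ?c"
    "free_walk c (\<delta> [a]) = h c \<cdot> free_label c a \<cdot> inv\<^sub>F h ?c"
    using assms(3) by blast+
  have 4: "foldl coset_step ?c (\<delta> w) = foldl coset_step ?c w"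
    "free_walk ?c (\<delta> w) = h ?c \<cdot> free_walk ?c w \<cdot> inv\<^sub>F h (foldl coset_step ?c w)"
    using letter.IH[of ?c] by blast+
  have "free_walk c (\<delta> [a] \<cdot> \<delta> w)
      = h c \<cdot> (free_label c a \<cdot> free_walk ?c w) \<cdot> inv\<^sub>F h (foldl coset_step ?c w)"
    using h by (simp add: free_walk_mult[of c "\<delta> [a]"] 3 4(2) F2.m_assoc F2_inv_cancel)
  then show ?case
    unfolding 1 2 by (simp add: foldl_coset_step_mult 3 4)
qed

text \<open>\<open>w\<close> is \<open>\<delta>\<close> with \<open>\<alpha>, \<beta>\<close> replaced by \<open>x\<inverse>, y\<inverse>\<close>. The last clause identifies its value in
  \<open>\<langle>\<alpha>, \<beta>\<rangle>\<close> without an appeal to freeness.\<close>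

definition twisted_by :: "(word \<Rightarrow> word) \<Rightarrow> word \<Rightarrow> bool" where
  "twisted_by \<delta> w \<longleftrightarrow> w \<in> carrier F2 \<and>
    (\<forall>d\<in>Delta. pi_lift (\<delta> d) = w \<cdot> pi_lift d \<cdot> inv\<^sub>F w) \<and>
    (\<exists>g\<in>carrier F2. flip \<star> \<delta> \<star> flip = inner_aut g \<star> AB_eval w)"

text \<open>A word of \<open>Delta\<close> leads from \<open>origin\<close> back to
  \<open>origin\<close>, so there the coboundary of \<open>h\<close> is conjugation by
  \<open>h origin\<close>.\<close>

lemma twisted_by_cocycle:
  assumes \<delta>: "\<delta> \<in> carrier AutF2" and h: "\<And>c. h c \<in> carrier F2"
    and letter: "\<And>c a. foldl coset_step c (\<delta> [a]) = coset_step c a \<and>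
      free_walk c (\<delta> [a]) = h c \<cdot> free_label c a \<cdot> inv\<^sub>F h (coset_step c a)"
    and g: "g \<in> carrier F2" "flip \<star> \<delta> \<star> flip = inner_aut g \<star> AB_eval (h origin)"
  shows "(\<forall>d\<in>carrier F2. \<delta> d \<in> Delta \<longleftrightarrow> d \<in> Delta) \<and> twisted_by \<delta> (h origin)"
proof -
  note cocycle = free_walk_cocycle[where h = h, OF \<delta> h letter]
  have 1: "\<delta> d \<in> Delta \<longleftrightarrow> d \<in> Delta" if "d \<in> carrier F2" for d
    using that cocycle[OF that, of origin] \<delta> by (simp add: Delta_iff)
  have 2: "pi_lift (\<delta> d) = h origin \<cdot> pi_lift d \<cdot> inv\<^sub>F h origin"
    if "d \<in> Delta" for d
    using that cocycle[of d origin] by (simp add: foldl_coset_step_Delta)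
  show ?thesis
    unfolding twisted_by_def by (intro conjI ballI bexI[of _ g] 1 2 g h)
qed

lemma twist_alpha:
  "(\<forall>d\<in>carrier F2. aut_alpha d \<in> Delta \<longleftrightarrow> d \<in> Delta) \<and> twisted_by aut_alpha (inv\<^sub>F gx)"
proof -
  \<comment> \<open>\<alpha> inserts two letters x after y. Their walk contributes x if the y-parity
    reached is even and the inverse of x if it is odd, which is the jump of \<open>h\<close> between
    the two rows of the Schreier graph.\<close>
  define h where "h c = (if snd c then \<one>\<^sub>F else inv\<^sub>F gx)" for c :: "bool \<times> bool"
  have "aut_alpha [(GX, False)] = [(GX, False)]" "aut_alpha [(GX, True)] = [(GX, True)]"
    "aut_alpha [(GY, False)] = [(GY, False), (GX, False), (GX, False)]"
    "aut_alpha [(GY, True)] = [(GX, True), (GX, True), (GY, True)]"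
    using auts_apply(11,12) AutF2_apply_inv[OF auts_closed(6) gx_carrier]
      AutF2_apply_inv[OF auts_closed(6) gy_carrier]
    unfolding inv_gen by (simp_all add: gx_def gy_def F2_mult inv_letter_def F2_inv F2_carrier_iff)
  then have letter: "foldl coset_step c (aut_alpha [a]) = coset_step c a \<and>
      free_walk c (aut_alpha [a]) = h c \<cdot> free_label c a \<cdot> inv\<^sub>F h (coset_step c a)" for c a
    by (cases "(c, a)" rule: free_label.cases) (auto simp: h_def F2.m_assoc F2_inv_cancel)
  have h: "h c \<in> carrier F2" for c by (simp add: h_def)
  have "flip \<star> aut_alpha \<star> flip = inner_aut \<one>\<^sub>F \<star> AB_eval (inv\<^sub>F gx)"
    using aut_relations(5) by (simp add: inner_one) (intro AutF2.inv_equality[symmetric], simp_all)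
  then show ?thesis
    using twisted_by_cocycle[OF auts_closed(6) h letter F2.one_closed] by (simp add: h_def)
qed

text \<open>The roles of x and y are exchanged; here \<open>flip\<close> inverts \<beta> only up to
  an inner automorphism, which supplies the witness in \<open>twisted_by\<close>.\<close>

lemma twist_beta:
  "(\<forall>d\<in>carrier F2. aut_beta d \<in> Delta \<longleftrightarrow> d \<in> Delta) \<and> twisted_by aut_beta (inv\<^sub>F gy)"
proof -
  define h where "h c = (if fst c then \<one>\<^sub>F else inv\<^sub>F gy)" for c :: "bool \<times> bool"
  have "aut_beta [(GY, False)] = [(GY, False)]" "aut_beta [(GY, True)] = [(GY, True)]"
    "aut_beta [(GX, False)] = [(GX, False), (GY, False), (GY, False)]"
    "aut_beta [(GX, True)] = [(GY, True), (GY, True), (GX, True)]"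
    using auts_apply(13,14) AutF2_apply_inv[OF auts_closed(7) gx_carrier]
      AutF2_apply_inv[OF auts_closed(7) gy_carrier]
    unfolding inv_gen by (simp_all add: gx_def gy_def F2_mult inv_letter_def F2_inv F2_carrier_iff)
  then have letter: "foldl coset_step c (aut_beta [a]) = coset_step c a \<and>
      free_walk c (aut_beta [a]) = h c \<cdot> free_label c a \<cdot> inv\<^sub>F h (coset_step c a)" for c a
    by (cases "(c, a)" rule: free_label.cases) (auto simp: h_def F2.m_assoc F2_inv_cancel)
  have h: "h c \<in> carrier F2" for c by (simp add: h_def)
  have "flip \<star> aut_beta \<star> flip = inner_aut (inv\<^sub>F (gy \<cdot> gy)) \<star> AB_eval (inv\<^sub>F gy)"
    using aut_relations(6) by simp (intro AutF2.inv_solve_right[THEN iffD2], simp_all)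
  then show ?thesis
    using twisted_by_cocycle[OF auts_closed(7) h letter, of "inv\<^sub>F (gy \<cdot> gy)"] by (simp add: h_def)
qed

text \<open>Twisting elements multiply along with the automorphisms, the inner parts being collected
  by \<open>aut_inner\<close>. So the automorphisms with both properties form a subgroup, and it
  contains \<alpha> and \<beta>.\<close>

lemma AB_twist:
  assumes "\<delta> \<in> AB"
  shows "(\<forall>d\<in>carrier F2. \<delta> d \<in> Delta \<longleftrightarrow> d \<in> Delta) \<and> (\<exists>w. twisted_by \<delta> w)"
proof -
  define S where "S = {\<delta> \<in> carrier AutF2.
    (\<forall>d\<in>carrier F2. \<delta> d \<in> Delta \<longleftrightarrow> d \<in> Delta) \<and> (\<exists>w. twisted_by \<delta> w)}"
  have S: "subgroup S AutF2"
  proof (rule AutF2.subgroupI)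
    have "{aut_alpha, aut_beta} \<subseteq> S" using twist_alpha twist_beta by (auto simp: S_def)
    then show "S \<noteq> {}" by auto
    fix \<sigma> assume "\<sigma> \<in> S"
    then obtain u g where \<sigma>: "\<sigma> \<in> carrier AutF2" and \<sigma>D: "\<And>d. d \<in> carrier F2 \<Longrightarrow> \<sigma> d \<in> Delta \<longleftrightarrow> d \<in> Delta"
      and u: "u \<in> carrier F2"
      "\<And>d. d \<in> Delta \<Longrightarrow> pi_lift (\<sigma> d) = u \<cdot> pi_lift d \<cdot> inv\<^sub>F u"
      and g: "g \<in> carrier F2" "flip \<star> \<sigma> \<star> flip = inner_aut g \<star> AB_eval u"
      by (auto simp: S_def twisted_by_def)
    let ?\<sigma>' = "inv\<^sub>A \<sigma>"
    have \<sigma>'D: "?\<sigma>' d \<in> Delta \<longleftrightarrow> d \<in> Delta" if "d \<in> carrier F2" for d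
      using \<sigma>D[of "?\<sigma>' d"] \<sigma> that by simp
    have 2: "pi_lift (?\<sigma>' d) = inv\<^sub>F u \<cdot> pi_lift d \<cdot> inv\<^sub>F (inv\<^sub>F u)"
      if "d \<in> Delta" for d
    proof -
      have "?\<sigma>' d \<in> Delta" using that \<sigma>'D by simp
      then have "pi_lift d = u \<cdot> pi_lift (?\<sigma>' d) \<cdot> inv\<^sub>F u"
        using u(2)[of "?\<sigma>' d"] \<sigma> that by simp
      then show ?thesis using u(1) by (simp add: F2.m_assoc F2_inv_cancel)
    qed
    have 3: "flip \<star> ?\<sigma>' \<star> flip
        = inner_aut (AB_eval (inv\<^sub>F u) (inv\<^sub>F g)) \<star> AB_eval (inv\<^sub>F u)"
    proof -
      have "flip \<star> ?\<sigma>' \<star> flip = inv\<^sub>A (flip \<star> \<sigma> \<star> flip)"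
        using \<sigma> by (simp add: AutF2.inv_mult_group flip_inv AutF2.m_assoc)
      also have "\<dots> = AB_eval (inv\<^sub>F u) \<star> inner_aut (inv\<^sub>F g)"
        unfolding g(2) using g(1) u(1) by (simp add: AutF2.inv_mult_group inner_inv)
      also have "\<dots> = inner_aut (AB_eval (inv\<^sub>F u) (inv\<^sub>F g)) \<star> AB_eval (inv\<^sub>F u)"
        by (rule aut_inner) (use g u in simp_all)
      finally show ?thesis .
    qed
    have 4: "AB_eval (inv\<^sub>F u) (inv\<^sub>F g) \<in> carrier F2"
      by (rule AutF2_closed) (use g u in simp_all)
    have "twisted_by ?\<sigma>' (inv\<^sub>F u)"
      unfolding twisted_by_def by (intro conjI ballI bexI[OF _ 4] 2 3) (use u in simp_all)
    then show "?\<sigma>' \<in> S" using \<sigma> \<sigma>'D unfolding S_def by blast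
    fix \<tau> assume "\<tau> \<in> S"
    then obtain v k where \<tau>: "\<tau> \<in> carrier AutF2" and \<tau>D: "\<And>d. d \<in> carrier F2 \<Longrightarrow> \<tau> d \<in> Delta \<longleftrightarrow> d \<in> Delta"
      and v: "v \<in> carrier F2"
      "\<And>d. d \<in> Delta \<Longrightarrow> pi_lift (\<tau> d) = v \<cdot> pi_lift d \<cdot> inv\<^sub>F v"
      and k: "k \<in> carrier F2" "flip \<star> \<tau> \<star> flip = inner_aut k \<star> AB_eval v"
      by (auto simp: S_def twisted_by_def)
    have 2: "pi_lift ((\<sigma> \<star> \<tau>) d)
        = (u \<cdot> v) \<cdot> pi_lift d \<cdot> inv\<^sub>F (u \<cdot> v)" if "d \<in> Delta" for d
      using that \<sigma> \<tau> u v \<tau>D[of d] by (simp add: F2.inv_mult_group F2.m_assoc)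
    have 3: "flip \<star> (\<sigma> \<star> \<tau>) \<star> flip
        = inner_aut (g \<cdot> AB_eval u k) \<star> AB_eval (u \<cdot> v)"
    proof -
      have "flip \<star> (\<sigma> \<star> \<tau>) \<star> flip
          = (flip \<star> \<sigma> \<star> flip) \<star> (flip \<star> \<tau> \<star> flip)"
      proof -
        have "flip \<star> (flip \<star> z) = z" if "z \<in> carrier AutF2" for z
          using that aut_relations(2) by (simp flip: AutF2.m_assoc)
        then show ?thesis using \<sigma> \<tau> by (simp add: AutF2.m_assoc)
      qed
      also have "\<dots> = inner_aut g \<star> (AB_eval u \<star> inner_aut k) \<star> AB_eval v"
        unfolding g(2) k(2) using g k u v by (simp add: AutF2.m_assoc)
      also have "AB_eval u \<star> inner_aut k = inner_aut (AB_eval u k) \<star> AB_eval u"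
        by (rule aut_inner) (use u k in simp_all)
      also have "inner_aut g \<star> (inner_aut (AB_eval u k) \<star> AB_eval u) \<star> AB_eval v
          = inner_aut (g \<cdot> AB_eval u k) \<star> AB_eval (u \<cdot> v)"
        using g k u v by (simp add: AutF2.m_assoc inner_mult[symmetric])
      finally show ?thesis .
    qed
    have 4: "u \<cdot> v \<in> carrier F2" "g \<cdot> AB_eval u k \<in> carrier F2"
      using u v g k by simp_all
    have "twisted_by (\<sigma> \<star> \<tau>) (u \<cdot> v)"
      unfolding twisted_by_def by (intro conjI ballI bexI[OF _ 4(2)] 2 3 4(1))
    moreover have "(\<sigma> \<star> \<tau>) d \<in> Delta \<longleftrightarrow> d \<in> Delta" if "d \<in> carrier F2" for d
      using that \<sigma> \<tau> \<sigma>D \<tau>D by simp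
    ultimately show "\<sigma> \<star> \<tau> \<in> S" using \<sigma> \<tau> unfolding S_def by blast
  qed (auto simp: S_def)
  have "{aut_alpha, aut_beta} \<subseteq> S" using twist_alpha twist_beta by (auto simp: S_def)
  then have "AB \<subseteq> S"
    unfolding AB_def by (rule AutF2.generate_subgroup_incl[OF _ S])
  then show ?thesis using assms by (auto simp: S_def)
qed

section \<open>The index of \<open>M\<close>\<close>

lemma F2_generate: "generate F2 {gx, gy} = carrier F2"
proof
  show "generate F2 {gx, gy} \<subseteq> carrier F2"
    using F2.generate_incl[of "{gx, gy}"] by simp
  show "carrier F2 \<subseteq> generate F2 {gx, gy}"
  proof
    fix w assume "w \<in> carrier F2"
    then show "w \<in> generate F2 {gx, gy}"
    proof (induction rule: F2_induct)
      case (letter a w)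
      have "[a] \<in> generate F2 {gx, gy}"
        using letter_cases[of a] generate.incl[of _ "{gx, gy}" F2] generate.inv[of _ "{gx, gy}" F2] by auto
      then show ?case using letter generate.eng by metis
    qed (rule generate.one)
  qed
qed

section \<open>The quotients of F by commutators and k-th powers\<close>

abbreviation E_sub :: "nat \<Rightarrow> word set" where
  "E_sub k \<equiv> derived_power (carrier F2) k"

lemma normal_E: "E_sub k \<lhd> F2"
  by (rule derived_power_normal[OF F2.normal_self])

lemma subgroup_E: "subgroup (E_sub k) F2"
  using normal_E by (rule normal_imp_subgroup)

lemma expsum_nat_pow: "expsum h (w [^]\<^bsub>F2\<^esub> (k::nat)) = int k * expsum h w"
  by (induction k) (simp_all add: expsum_mult F2_one algebra_simps)

lemma expsum_E:
  assumes "w \<in> E_sub k"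
  shows "int k dvd expsum h w"
proof -
  have "subgroup {w \<in> carrier F2. int k dvd expsum h w} F2"
    by (rule F2.subgroupI) (auto simp: expsum_mult expsum_inv intro: exI[of _ "\<one>\<^sub>F"] simp: F2_one)
  then have "E_sub k \<subseteq> {w \<in> carrier F2. int k dvd expsum h w}"
    by (rule derived_power_least) (auto simp: expsum_mult expsum_inv expsum_nat_pow)
  then show ?thesis using assms by blast
qed

lemma E_Delta: "even k \<Longrightarrow> E_sub k \<subseteq> Delta"
proof
  fix w assume "even k" "w \<in> E_sub k"
  then have "even (expsum h w)" for h
    using dvd_trans[of 2 "int k"] expsum_E[of w k h] by simp
  then show "w \<in> Delta"
    using subgroup.mem_carrier[OF subgroup_E \<open>w \<in> E_sub k\<close>] by (simp add: Delta_def del: Delta_carrier)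
qed

lemma index_E:
  assumes "0 < k"
  shows "finite (rcosets\<^sub>F (E_sub k))" "card (rcosets\<^sub>F (E_sub k)) dvd k ^ 2"
proof -
  have "card {gx, gy} \<le> 2" by (simp add: card_insert_if)
  from index_derived_power[OF F2.normal_self _ F2_generate[symmetric] this assms]
  show "finite (rcosets\<^sub>F (E_sub k))" "card (rcosets\<^sub>F (E_sub k)) dvd k ^ 2" by simp_all
qed

text \<open>The image of \<open>F' F\<^sup>6\<close> in \<open>F/F' F\<^sup>4\<close> is generated by the classes of \<open>x\<^sup>6\<close> and \<open>y\<^sup>6\<close>, which
  have order dividing \<open>2\<close>.\<close>

lemma index_Int_E4:
  assumes D: "D \<lhd> F2" "D \<subseteq> E_sub 6"
  shows "finite (rcosets\<^bsub>F2\<lparr>carrier := D\<rparr>\<^esub> (E_sub 4 \<inter> D))"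
    "card (rcosets\<^bsub>F2\<lparr>carrier := D\<rparr>\<^esub> (E_sub 4 \<inter> D)) dvd 4"
proof -
  let ?Q = "F2 Mod E_sub 4"
  let ?h = "\<lambda>w. E_sub 4 #>\<^sub>F w"
  interpret E: normal "E_sub 4" F2 by (rule normal_E)
  interpret Q: group ?Q by (rule E.factorgroup_is_group)
  interpret h: group_hom F2 ?Q ?h
    using E.r_coset_hom_Mod by (simp add: group_hom_def group_hom_axioms_def Q.is_group group_F2)
  have one: "?h w = \<one>\<^bsub>?Q\<^esub> \<longleftrightarrow> w \<in> E_sub 4" if "w \<in> carrier F2" for w
    using F2.coset_join1[OF _ that E.subgroup_axioms] F2.coset_join2[OF that E.subgroup_axioms] by auto
  have comm: "?h u \<otimes>\<^bsub>?Q\<^esub> ?h v = ?h v \<otimes>\<^bsub>?Q\<^esub> ?h u" if uv: "u \<in> carrier F2" "v \<in> carrier F2" for u v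
  proof -
    have "u \<cdot> v \<cdot> inv\<^sub>F u \<cdot> inv\<^sub>F v \<in> E_sub 4"
      using derived_power_memI(1)[OF F2.subgroup_self] uv by blast
    then show ?thesis
      using h.hom_commute_iff[OF uv] one[of "u \<cdot> v \<cdot> inv\<^sub>F u \<cdot> inv\<^sub>F v"] uv by blast
  qed
  have "comm_group ?Q"
  proof (rule Q.group_comm_groupI)
    fix X Y assume "X \<in> carrier ?Q" "Y \<in> carrier ?Q"
    then obtain u v where "u \<in> carrier F2" "X = ?h u" "v \<in> carrier F2" "Y = ?h v"
      unfolding carrier_FactGroup by blast
    then show "X \<otimes>\<^bsub>?Q\<^esub> Y = Y \<otimes>\<^bsub>?Q\<^esub> X" using comm by blast
  qed
  then interpret Q: comm_group ?Q .
  define S where "S = {?h gx [^]\<^bsub>?Q\<^esub> (6::nat), ?h gy [^]\<^bsub>?Q\<^esub> (6::nat)}"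
  define J where "J = generate ?Q S"
  have hc: "?h gx \<in> carrier ?Q" "?h gy \<in> carrier ?Q" by (rule h.hom_closed, simp)+
  have SQ: "S \<subseteq> carrier ?Q" using hc Q.nat_pow_closed unfolding S_def by blast
  have J: "subgroup J ?Q" unfolding J_def using SQ by (rule Q.generate_is_subgroup)
  have four: "?h w [^]\<^bsub>?Q\<^esub> (4::nat) = \<one>\<^bsub>?Q\<^esub>" if "w \<in> carrier F2" for w
  proof -
    have "w [^]\<^bsub>F2\<^esub> (4::nat) \<in> E_sub 4"
      using derived_power_memI(2)[OF F2.subgroup_self that] .
    then show ?thesis
      using h.hom_nat_pow[OF that, of 4] one[of "w [^]\<^bsub>F2\<^esub> (4::nat)"] that F2.nat_pow_closed by metis
  qed
  have twelve: "(?h w [^]\<^bsub>?Q\<^esub> (6::nat)) [^]\<^bsub>?Q\<^esub> (2::nat) = \<one>\<^bsub>?Q\<^esub>" if "w \<in> carrier F2" for w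
  proof -
    have "(?h w [^]\<^bsub>?Q\<^esub> (6::nat)) [^]\<^bsub>?Q\<^esub> (2::nat) = (?h w [^]\<^bsub>?Q\<^esub> (4::nat)) [^]\<^bsub>?Q\<^esub> (3::nat)"
      using Q.nat_pow_pow[OF h.hom_closed[OF that]] by simp
    then show ?thesis by (simp only: four[OF that] Q.nat_pow_one)
  qed
  have "finite S" "card S \<le> 2" by (simp_all add: S_def card_insert_if)
  moreover have "s [^]\<^bsub>?Q\<^esub> (2::nat) = \<one>\<^bsub>?Q\<^esub>" if "s \<in> S" for s
    using that twelve[OF gx_carrier] twelve[OF gy_carrier] unfolding S_def by blast
  ultimately have "finite J" "card J dvd 2 ^ card S"
    using Q.card_generate_dvd[of S 2] SQ unfolding J_def by auto
  then have cardJ: "finite J" "card J dvd 4"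
    using \<open>card S \<le> 2\<close> le_imp_power_dvd[of "card S" 2 "2::nat"] dvd_trans by auto
  \<comment> \<open>Taking sixth powers is multiplicative in the commutative quotient, so it
    suffices to treat single letters.\<close>
  have six: "?h w [^]\<^bsub>?Q\<^esub> (6::nat) \<in> J" if "w \<in> carrier F2" for w
    using that
  proof (induction rule: F2_induct)
    case one
    then show ?case using subgroup.one_closed[OF J] h.hom_one Q.nat_pow_one by metis
  next
    case (letter a w)
    have gens: "?h gx [^]\<^bsub>?Q\<^esub> (6::nat) \<in> J" "?h gy [^]\<^bsub>?Q\<^esub> (6::nat) \<in> J"
      unfolding J_def by (rule generate.incl, simp add: S_def)+
    have inv: "?h (inv\<^sub>F v) [^]\<^bsub>?Q\<^esub> (6::nat) = inv\<^bsub>?Q\<^esub> (?h v [^]\<^bsub>?Q\<^esub> (6::nat))"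
      if "v \<in> carrier F2" for v
      using h.hom_inv[OF that] Q.nat_pow_inv[OF h.hom_closed[OF that]] by metis
    have "?h [a] [^]\<^bsub>?Q\<^esub> (6::nat) \<in> J"
      using letter_cases[of a] gens inv[OF gx_carrier] inv[OF gy_carrier]
        subgroup.m_inv_closed[OF J gens(1)] subgroup.m_inv_closed[OF J gens(2)]
      by (elim insertE) (simp_all only: empty_iff)
    moreover have "?h ([a] \<cdot> w) [^]\<^bsub>?Q\<^esub> (6::nat)
        = ?h [a] [^]\<^bsub>?Q\<^esub> (6::nat) \<otimes>\<^bsub>?Q\<^esub> ?h w [^]\<^bsub>?Q\<^esub> (6::nat)"
      using h.hom_mult[of "[a]" w] letter(1) Q.nat_pow_distrib[OF h.hom_closed h.hom_closed, of "[a]" w]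
      by (simp only: F2_singleton)
    ultimately show ?case using subgroup.m_closed[OF J] letter.IH by metis
  qed
  have "subgroup {w \<in> carrier F2. ?h w \<in> J} F2"
  proof (rule F2.subgroupI)
    show "{w \<in> carrier F2. ?h w \<in> J} \<noteq> {}"
      using subgroup.one_closed[OF J] h.hom_one by (metis (mono_tags, lifting) F2.one_closed empty_iff mem_Collect_eq)
    fix u assume "u \<in> {w \<in> carrier F2. ?h w \<in> J}"
    then have u: "u \<in> carrier F2" "?h u \<in> J" by auto
    show "inv\<^sub>F u \<in> {w \<in> carrier F2. ?h w \<in> J}"
      using u subgroup.m_inv_closed[OF J u(2)] h.hom_inv[OF u(1)] F2.inv_closed by (metis (mono_tags, lifting) mem_Collect_eq)
    fix v assume "v \<in> {w \<in> carrier F2. ?h w \<in> J}"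
    then have v: "v \<in> carrier F2" "?h v \<in> J" by auto
    show "u \<cdot> v \<in> {w \<in> carrier F2. ?h w \<in> J}"
      using u v subgroup.m_closed[OF J u(2) v(2)] h.hom_mult[OF u(1) v(1)] F2.m_closed
      by (metis (mono_tags, lifting) mem_Collect_eq)
  qed auto
  then have "E_sub 6 \<subseteq> {w \<in> carrier F2. ?h w \<in> J}"
  proof (rule derived_power_least)
    fix u v assume uv: "u \<in> carrier F2" "v \<in> carrier F2"
    let ?c = "u \<cdot> v \<cdot> inv\<^sub>F u \<cdot> inv\<^sub>F v"
    have "?h ?c = \<one>\<^bsub>?Q\<^esub>" using h.hom_commute_iff[OF uv] comm[OF uv] by blast
    then show "?c \<in> {w \<in> carrier F2. ?h w \<in> J}"
      using subgroup.one_closed[OF J] uv by (metis (mono_tags, lifting) F2.inv_closed F2.m_closed mem_Collect_eq)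
  next
    fix u assume u: "u \<in> carrier F2"
    show "u [^]\<^bsub>F2\<^esub> (6::nat) \<in> {w \<in> carrier F2. ?h w \<in> J}"
      using six[OF u] h.hom_nat_pow[OF u] u F2.nat_pow_closed by (metis (mono_tags, lifting) mem_Collect_eq)
  qed
  then have img: "?h ` D \<subseteq> J" using D(2) by blast
  have subD: "subgroup D F2" using D(1) by (rule normal_imp_subgroup)
  have DG: "D \<subseteq> carrier F2" using subD by (rule subgroup.subset)
  have hD: "?h \<in> hom (F2\<lparr>carrier := D\<rparr>) ?Q"
  proof (rule homI)
    fix u v assume "u \<in> carrier (F2\<lparr>carrier := D\<rparr>)" "v \<in> carrier (F2\<lparr>carrier := D\<rparr>)"
    then have "u \<in> carrier F2" "v \<in> carrier F2" using DG by auto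
    then show "?h u \<in> carrier ?Q" "?h (u \<otimes>\<^bsub>F2\<lparr>carrier := D\<rparr>\<^esub> v) = ?h u \<otimes>\<^bsub>?Q\<^esub> ?h v"
      using h.hom_closed h.hom_mult by (blast, simp)
  qed
  have eq: "{w \<in> D. ?h w = \<one>\<^bsub>?Q\<^esub>} = E_sub 4 \<inter> D" using one DG by blast
  from F2.index_kernel_dvd[OF subD Q.is_group hD J cardJ(1) img]
  show "finite (rcosets\<^bsub>F2\<lparr>carrier := D\<rparr>\<^esub> (E_sub 4 \<inter> D))"
    "card (rcosets\<^bsub>F2\<lparr>carrier := D\<rparr>\<^esub> (E_sub 4 \<inter> D)) dvd 4"
    unfolding eq using cardJ(2) dvd_trans by blast+
qed

section \<open>The action on the abelianization\<close>

lemma GL2Z_group: "group GL2Z"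
proof (rule groupI)
  fix A assume "A \<in> carrier GL2Z"
  then obtain B where "A ** B = mat 1" "B ** A = mat 1"
    by (auto simp: GL2Z_def invertible_def)
  then show "\<exists>B\<in>carrier GL2Z. B \<otimes>\<^bsub>GL2Z\<^esub> A = \<one>\<^bsub>GL2Z\<^esub>"
    by (intro bexI[of _ B]) (auto simp: GL2Z_def invertible_def)
next
  fix A B assume "A \<in> carrier GL2Z" "B \<in> carrier GL2Z"
  then obtain A' B' where "A ** A' = mat 1" "A' ** A = mat 1" "B ** B' = mat 1" "B' ** B = mat 1"
    by (auto simp: GL2Z_def invertible_def)
  then have "(A ** B) ** (B' ** A') = mat 1" "(B' ** A') ** (A ** B) = mat 1"
    by (metis matrix_mul_assoc matrix_mul_rid)+
  then show "A \<otimes>\<^bsub>GL2Z\<^esub> B \<in> carrier GL2Z"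
    by (auto simp: GL2Z_def invertible_def)
qed (auto simp: GL2Z_def matrix_mul_assoc invertible_def intro: exI[of _ "mat 1"])

lemma abel_matrix_mult:
  assumes "\<sigma> \<in> carrier AutF2" "\<tau> \<in> carrier AutF2"
  shows "abel_matrix (\<sigma> \<star> \<tau>) = abel_matrix \<sigma> ** abel_matrix \<tau>"
  using assms expsum_hom[OF assms(1), of "\<tau> gx"] expsum_hom[OF assms(1), of "\<tau> gy"]
  by (simp add: vec_eq_iff forall_2 matrix_matrix_mult_def transpose_def abel_matrix_def abel_def sum_2
      mult.commute)

lemma abel_matrix_one: "abel_matrix \<one>\<^sub>A = mat 1"
  by (simp add: vec_eq_iff forall_2 transpose_def abel_matrix_def abel_def mat_def)

lemma abel_matrix_group_hom: "group_hom AutF2 GL2Z abel_matrix"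
proof -
  have "abel_matrix \<sigma> \<in> carrier GL2Z" if "\<sigma> \<in> carrier AutF2" for \<sigma>
    using that abel_matrix_mult[of \<sigma> "inv\<^sub>A \<sigma>"] abel_matrix_mult[of "inv\<^sub>A \<sigma>" \<sigma>]
    by (auto simp: GL2Z_def invertible_def abel_matrix_one)
  then have "abel_matrix \<in> hom AutF2 GL2Z"
    by (auto simp: hom_def abel_matrix_mult) (simp add: GL2Z_def)
  then show ?thesis by (simp add: group_hom_def group_hom_axioms_def AutF2.is_group GL2Z_group)
qed

lemma subgroup_Aut': "subgroup Aut'F2 AutF2"
proof -
  interpret h: group_hom AutF2 GL2Z abel_matrix by (rule abel_matrix_group_hom)
  let ?S = "{vector [vector [1, 2], vector [0, 1]], vector [vector [1, 0], vector [2, 1]]} :: (int^2^2) set"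
  have inv: "invertible A" if "A ** B = mat 1" "B ** A = mat 1" for A B :: "int^2^2"
    using that by (auto simp: invertible_def)
  have "?S \<subseteq> carrier GL2Z"
  proof -
    have "invertible (vector [vector [1, 2], vector [0, 1]] :: int^2^2)"
      by (rule inv[of _ "vector [vector [1, -2], vector [0, 1]]"])
        (simp_all add: vec_eq_iff forall_2 matrix_matrix_mult_def sum_2 mat_def)
    moreover have "invertible (vector [vector [1, 0], vector [2, 1]] :: int^2^2)"
      by (rule inv[of _ "vector [vector [1, 0], vector [-2, 1]]"])
        (simp_all add: vec_eq_iff forall_2 matrix_matrix_mult_def sum_2 mat_def)
    ultimately show ?thesis by (simp add: GL2Z_def)
  qed
  then have S: "subgroup (generate GL2Z ?S) GL2Z" by (rule h.H.generate_is_subgroup)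
  show ?thesis
    unfolding Aut'F2_def
  proof (rule AutF2.subgroupI)
    show "{\<sigma> \<in> carrier AutF2. abel_matrix \<sigma> \<in> generate GL2Z ?S} \<noteq> {}"
      using subgroup.one_closed[OF S] h.hom_one AutF2.one_closed by (metis (mono_tags, lifting) empty_iff mem_Collect_eq)
  qed (auto intro: subgroup.m_inv_closed[OF S] subgroup.m_closed[OF S])
qed

lemma AB_subset_Aut': "AB \<subseteq> Aut'F2"
proof -
  have "abel_matrix aut_alpha = vector [vector [1, 2], vector [0, 1]]"
    "abel_matrix aut_beta = vector [vector [1, 0], vector [2, 1]]"
    by (simp_all add: vec_eq_iff forall_2 transpose_def abel_matrix_def abel_def expsum_mult)
  then have "{aut_alpha, aut_beta} \<subseteq> Aut'F2"
    by (auto simp: Aut'F2_def intro: generate.incl)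
  then show ?thesis
    unfolding AB_def by (rule AutF2.generate_subgroup_incl[OF _ subgroup_Aut'])
qed

section \<open>The homomorphism \<pi> and the cosets of \<open>Delta\<close>\<close>

lemma pi_hom_eq: "w \<in> Delta \<Longrightarrow> pi_hom w = AB_eval (pi_lift w)"
  using is_pi_unique[OF theI'[OF pi_unique]] by (simp add: pi_hom_def AB_eval_free_walk)

lemma AB_eval_in_AB: "v \<in> carrier F2 \<Longrightarrow> AB_eval v \<in> AB"
proof (induction rule: F2_induct)
  case one
  then show ?case using subgroup.one_closed[OF subgroup_AB] by simp
next
  case (letter a w)
  have "AB_eval [a] \<in> AB"
    using letter_cases[of a] aut_in_AB subgroup.m_inv_closed[OF subgroup_AB aut_in_AB(1)]
      subgroup.m_inv_closed[OF subgroup_AB aut_in_AB(2)] by auto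
  from subgroup.m_closed[OF subgroup_AB this letter.IH] show ?case using letter(1) by simp
qed

lemma free_walk_Delta_mult:
  "u \<in> Delta \<Longrightarrow> pi_lift (u \<cdot> v) = pi_lift u \<cdot> pi_lift v"
  by (simp add: free_walk_mult foldl_coset_step_Delta)

lemma free_walk_one [simp]: "free_walk c \<one>\<^sub>F = \<one>\<^sub>F"
  using free_walk.simps(1)[of c] unfolding F2_one .

lemma free_walk_Delta_inv:
  assumes "u \<in> Delta"
  shows "pi_lift (inv\<^sub>F u) = inv\<^sub>F (pi_lift u)"
proof -
  have "pi_lift (inv\<^sub>F u \<cdot> u) = pi_lift (inv\<^sub>F u) \<cdot> pi_lift u"
    by (rule free_walk_Delta_mult[OF subgroup.m_inv_closed[OF subgroup_Delta assms]])
  then show ?thesis using assms by (intro F2.inv_equality[symmetric]) simp_all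
qed

lemma Delta_conj: "w \<in> Delta \<Longrightarrow> g \<in> carrier F2 \<Longrightarrow> g \<cdot> w \<cdot> inv\<^sub>F g \<in> Delta"
proof -
  assume w: "w \<in> Delta" and g: "g \<in> carrier F2"
  have "w \<in> carrier F2" "even (expsum GX w)" "even (expsum GY w)"
    using w unfolding Delta_def by blast+
  then show ?thesis
    using g unfolding Delta_def by (intro CollectI conjI) (simp_all add: expsum_mult expsum_inv)
qed

lemma coset_rep_mem: "coset_rep c \<in> {\<one>\<^sub>F, gx, gy, gx \<cdot> gy}"
  by (cases c) (simp add: F2_one F2_mult gx_def gy_def inv_letter_def)

lemma Delta_coset:
  assumes "g \<in> carrier F2"
  shows "\<exists>d\<in>Delta. \<exists>t\<in>{\<one>\<^sub>F, gx, gy, gx \<cdot> gy}. g = d \<cdot> t"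
proof -
  define t where "t = coset_rep (odd (expsum GX g), odd (expsum GY g))"
  have t: "t \<in> carrier F2" unfolding t_def by (rule coset_rep_closed)
  have exp: "even (expsum GX t) \<longleftrightarrow> even (expsum GX g)" "even (expsum GY t) \<longleftrightarrow> even (expsum GY g)"
    by (simp_all add: t_def expsum_Cons)
  have "g \<cdot> inv\<^sub>F t \<in> Delta"
    using assms t exp unfolding Delta_def
    by (intro CollectI conjI) (simp_all add: expsum_mult expsum_inv)
  moreover have "g = (g \<cdot> inv\<^sub>F t) \<cdot> t" using assms t by (simp add: F2.m_assoc)
  ultimately show ?thesis using coset_rep_mem unfolding t_def by blast
qed

text \<open>In the image of \<open>c\<close> the inserted square commutes with the letter next to it
  and cancels, both for \<alpha> and for \<beta>.\<close>

lemma AB_fixes_commutator: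
  assumes "\<delta> \<in> AB"
  defines "c \<equiv> gx \<cdot> gy \<cdot> inv\<^sub>F gx \<cdot> inv\<^sub>F gy"
  shows "\<delta> c = c"
proof -
  have cc: "c \<in> carrier F2" by (simp add: c_def)
  have "subgroup {\<sigma> \<in> carrier AutF2. \<sigma> c = c} AutF2"
  proof (rule AutF2.subgroupI)
    show "{\<sigma> \<in> carrier AutF2. \<sigma> c = c} \<noteq> {}"
      using AutF2_one[OF cc] AutF2.one_closed by blast
    fix \<sigma> assume "\<sigma> \<in> {\<sigma> \<in> carrier AutF2. \<sigma> c = c}"
    then have "\<sigma> \<in> carrier AutF2" "\<sigma> c = c" by auto
    then show "inv\<^sub>A \<sigma> \<in> {\<sigma> \<in> carrier AutF2. \<sigma> c = c}"
      using AutF2_inv_apply(2)[of \<sigma> c] cc by simp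
  qed (auto simp: cc)
  moreover have "{aut_alpha, aut_beta} \<subseteq> {\<sigma> \<in> carrier AutF2. \<sigma> c = c}"
    by (auto simp: c_def F2.m_assoc F2.inv_mult_group F2_inv_cancel F2.inv_mult_cancel)
  ultimately have "AB \<subseteq> {\<sigma> \<in> carrier AutF2. \<sigma> c = c}"
    unfolding AB_def using AutF2.generate_subgroup_incl by blast
  then show ?thesis using assms(1) by blast
qed

section \<open>The quotient by \<open>H\<close> and the subgroup \<open>N\<close>\<close>

locale congruence_quotient =
  fixes H :: "(word \<Rightarrow> word) set"
  assumes normal_H: "H \<lhd> AutF2" and finite_H: "finite (rcosets\<^bsub>AutF2\<^esub> H)"
    and Inn_H: "InnF2 \<subseteq> H"
begin

abbreviation "Q \<equiv> AutF2 Mod H"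
definition "q v = H #>\<^sub>A AB_eval v" for v

sublocale H: normal H AutF2 by (rule normal_H)

sublocale Q: group Q by (rule H.factorgroup_is_group)

sublocale \<theta>: group_hom AutF2 Q "\<lambda>\<sigma>. H #>\<^sub>A \<sigma>"
  using H.r_coset_hom_Mod by (simp add: group_hom_def group_hom_axioms_def Q.is_group AutF2.is_group)

lemma coset_eq_one: "\<sigma> \<in> carrier AutF2 \<Longrightarrow> H #>\<^sub>A \<sigma> = \<one>\<^bsub>Q\<^esub> \<longleftrightarrow> \<sigma> \<in> H"
  using AutF2.coset_join1[OF _ _ H.subgroup_axioms] AutF2.coset_join2[OF _ H.subgroup_axioms] by auto

sublocale KC: cayley Q q
proof
  show "q \<in> hom F2 Q"
    using hom_compose[OF AB_eval.homh \<theta>.homh] by (simp add: q_def[abs_def] comp_def)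
qed

text \<open>The preimage of K under the evaluation of words at \<alpha> and \<beta>; edge counts for
  \<open>q\<close> detect membership in it.\<close>

abbreviation "K_free \<equiv> kernel F2 Q q"

lemma K_free_iff: "v \<in> K_free \<longleftrightarrow> v \<in> carrier F2 \<and> AB_eval v \<in> H"
  using coset_eq_one[OF AB_eval.hom_closed] by (auto simp: kernel_def q_def)

lemma normal_K_free: "K_free \<lhd> F2"
  by (rule KC.normal_kernel)

abbreviation "L \<equiv> pi_preimage (K_sub H)"

lemma L_iff: "w \<in> L \<longleftrightarrow> w \<in> Delta \<and> pi_lift w \<in> K_free"
  unfolding pi_preimage_def K_sub_def mem_Collect_eq K_free_iff
  using pi_hom_eq[of w] AB_eval_in_AB[OF free_walk_closed, of origin w] by auto

lemma L_Delta: "w \<in> L \<Longrightarrow> w \<in> Delta"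
  by (simp add: L_iff)

lemma subgroup_L: "subgroup L F2"
proof (rule F2.subgroupI)
  have K_free: "subgroup K_free F2" using normal_K_free by (rule normal_imp_subgroup)
  show "L \<subseteq> carrier F2" using L_Delta Delta_carrier by blast
  have "\<one>\<^sub>F \<in> L"
    using subgroup.one_closed[OF subgroup_Delta] subgroup.one_closed[OF K_free] by (simp add: L_iff)
  then show "L \<noteq> {}" by blast
  show "inv\<^sub>F u \<in> L" if "u \<in> L" for u
    using that subgroup.m_inv_closed[OF subgroup_Delta, of u] subgroup.m_inv_closed[OF K_free]
    by (simp add: L_iff free_walk_Delta_inv)
  show "u \<cdot> v \<in> L" if "u \<in> L" "v \<in> L" for u v
    using that subgroup.m_closed[OF subgroup_Delta, of u v] subgroup.m_closed[OF K_free]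
    by (simp add: L_iff free_walk_Delta_mult)
qed

lemma L_conj:
  assumes "w \<in> L" "d \<in> Delta"
  shows "d \<cdot> w \<cdot> inv\<^sub>F d \<in> L"
proof -
  have w: "w \<in> Delta" "pi_lift w \<in> K_free" using assms L_iff by auto
  have "pi_lift (d \<cdot> w \<cdot> inv\<^sub>F d)
      = pi_lift d \<cdot> pi_lift w \<cdot> inv\<^sub>F (pi_lift d)"
    using w assms subgroup.m_closed[OF subgroup_Delta assms(2) w(1)]
    by (simp add: free_walk_Delta_mult free_walk_Delta_inv)
  then show ?thesis
    using normal.inv_op_closed2[OF normal_K_free free_walk_closed w(2)] Delta_conj[OF w(1)] assms(2)
    by (simp add: L_iff)
qed

abbreviation "reps \<equiv> {\<one>\<^sub>F, gx, gy, gx \<cdot> gy}"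

lemma reps_carrier: "t \<in> reps \<Longrightarrow> t \<in> carrier F2"
  by auto

lemma conj_image_iff:
  assumes "w \<in> carrier F2" "t \<in> carrier F2"
  shows "w \<in> (\<lambda>w. inv\<^sub>F t \<cdot> w \<cdot> t) ` L \<longleftrightarrow> t \<cdot> w \<cdot> inv\<^sub>F t \<in> L"
proof
  assume "w \<in> (\<lambda>w. inv\<^sub>F t \<cdot> w \<cdot> t) ` L"
  then obtain l where l: "l \<in> L" "w = inv\<^sub>F t \<cdot> l \<cdot> t" by blast
  have "l \<in> carrier F2" using subgroup.mem_carrier[OF subgroup_L l(1)] .
  then have "t \<cdot> w \<cdot> inv\<^sub>F t = l"
    using assms(2) by (simp add: l(2) F2.m_assoc F2.inv_mult_cancel)
  then show "t \<cdot> w \<cdot> inv\<^sub>F t \<in> L" using l by simp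
next
  assume "t \<cdot> w \<cdot> inv\<^sub>F t \<in> L"
  moreover have "w = inv\<^sub>F t \<cdot> (t \<cdot> w \<cdot> inv\<^sub>F t) \<cdot> t"
    using assms by (simp add: F2.m_assoc F2_inv_cancel)
  ultimately show "w \<in> (\<lambda>w. inv\<^sub>F t \<cdot> w \<cdot> t) ` L" by blast
qed

lemma N_iff_reps:
  "w \<in> N_sub H \<longleftrightarrow> w \<in> E_sub 6 \<and> (\<forall>t\<in>reps. t \<cdot> w \<cdot> inv\<^sub>F t \<in> L)"
proof -
  have "w \<in> N_sub H \<longleftrightarrow> w \<in> E_sub 6 \<and>
      (\<forall>t\<in>reps. w \<in> (\<lambda>w. inv\<^sub>F t \<cdot> w \<cdot> t) ` L)"
    unfolding N_sub_def by blast
  then show ?thesis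
    using conj_image_iff[OF subgroup.mem_carrier[OF subgroup_E] reps_carrier] by blast
qed

text \<open>\<open>L\<close> is normalized by \<open>Delta\<close> and the four representatives meet
  all cosets of \<open>Delta\<close>, so four conjugates stand for all of them. In this form
  normality of N is visible.\<close>

lemma N_iff:
  "w \<in> N_sub H \<longleftrightarrow> w \<in> E_sub 6 \<and> (\<forall>g\<in>carrier F2. g \<cdot> w \<cdot> inv\<^sub>F g \<in> L)"
proof -
  have "g \<cdot> w \<cdot> inv\<^sub>F g \<in> L"
    if w: "w \<in> E_sub 6" and L: "\<forall>t\<in>reps. t \<cdot> w \<cdot> inv\<^sub>F t \<in> L" and g: "g \<in> carrier F2" for g
  proof -
    obtain d t where dt: "d \<in> Delta" "t \<in> reps" "g = d \<cdot> t" using Delta_coset[OF g] by blast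
    have "w \<in> carrier F2" using subgroup.mem_carrier[OF subgroup_E w] .
    then have eq: "g \<cdot> w \<cdot> inv\<^sub>F g
        = d \<cdot> (t \<cdot> w \<cdot> inv\<^sub>F t) \<cdot> inv\<^sub>F d"
      using Delta_carrier[OF dt(1)] reps_carrier[OF dt(2)] unfolding dt(3)
      by (simp add: F2.m_assoc F2.inv_mult_group)
    have "t \<cdot> w \<cdot> inv\<^sub>F t \<in> L" using L dt(2) by blast
    then show ?thesis unfolding eq by (rule L_conj[OF _ dt(1)])
  qed
  then show ?thesis
    unfolding N_iff_reps using reps_carrier by blast
qed

lemma normal_N: "N_sub H \<lhd> F2"
proof (rule F2.normal_invI)
  show "subgroup (N_sub H) F2"
  proof (rule F2.subgroupI)
    show "N_sub H \<subseteq> carrier F2"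
      using N_iff subgroup.mem_carrier[OF subgroup_E] by blast
    have "\<one>\<^sub>F \<in> N_sub H"
      using subgroup.one_closed[OF subgroup_E] subgroup.one_closed[OF subgroup_L] by (simp add: N_iff)
    then show "N_sub H \<noteq> {}" by blast
    fix u assume u: "u \<in> N_sub H"
    have uE: "u \<in> E_sub 6" and uc: "u \<in> carrier F2"
      using u N_iff subgroup.mem_carrier[OF subgroup_E] by blast+
    have "g \<cdot> inv\<^sub>F u \<cdot> inv\<^sub>F g = inv\<^sub>F (g \<cdot> u \<cdot> inv\<^sub>F g)"
      if "g \<in> carrier F2" for g
      using that uc by (simp add: F2.inv_mult_group F2.m_assoc)
    then show "inv\<^sub>F u \<in> N_sub H"
      using u subgroup.m_inv_closed[OF subgroup_E uE] subgroup.m_inv_closed[OF subgroup_L]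
      by (simp add: N_iff)
    fix v assume v: "v \<in> N_sub H"
    have vE: "v \<in> E_sub 6" and vc: "v \<in> carrier F2"
      using v N_iff subgroup.mem_carrier[OF subgroup_E] by blast+
    have "g \<cdot> (u \<cdot> v) \<cdot> inv\<^sub>F g
        = (g \<cdot> u \<cdot> inv\<^sub>F g) \<cdot> (g \<cdot> v \<cdot> inv\<^sub>F g)" if "g \<in> carrier F2" for g
      using that uc vc by (simp add: F2.m_assoc F2_inv_cancel)
    then show "u \<cdot> v \<in> N_sub H"
      using u v subgroup.m_closed[OF subgroup_E uE vE] subgroup.m_closed[OF subgroup_L]
      by (simp add: N_iff)
  qed
  fix g w assume g: "g \<in> carrier F2" and w: "w \<in> N_sub H"
  have wE: "w \<in> E_sub 6" and wL: "\<And>h. h \<in> carrier F2 \<Longrightarrow> h \<cdot> w \<cdot> inv\<^sub>F h \<in> L"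
    using w N_iff by blast+
  have wc: "w \<in> carrier F2" using subgroup.mem_carrier[OF subgroup_E wE] .
  have "h \<cdot> (g \<cdot> w \<cdot> inv\<^sub>F g) \<cdot> inv\<^sub>F h \<in> L" if h: "h \<in> carrier F2" for h
  proof -
    have "h \<cdot> (g \<cdot> w \<cdot> inv\<^sub>F g) \<cdot> inv\<^sub>F h
        = (h \<cdot> g) \<cdot> w \<cdot> inv\<^sub>F (h \<cdot> g)"
      using g h wc by (simp add: F2.m_assoc F2.inv_mult_group)
    then show ?thesis using wL[of "h \<cdot> g"] g h by simp
  qed
  then show "g \<cdot> w \<cdot> inv\<^sub>F g \<in> N_sub H"
    unfolding N_iff using normal.inv_op_closed2[OF normal_E g wE] by blast
qed

lemma subgroup_N: "subgroup (N_sub H) F2"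
  using normal_N by (rule normal_imp_subgroup)

text \<open>The image of the group generated by \<alpha> and \<beta> in the quotient by
  \<open>H\<close>; it is isomorphic to that group modulo K.\<close>

definition "J = (\<lambda>\<sigma>. H #>\<^sub>A \<sigma>) ` AB"

lemma subgroup_J: "subgroup J Q"
  unfolding J_def by (rule \<theta>.subgroup_img_is_subgroup[OF subgroup_AB])

lemma finite_Q: "finite (carrier Q)"
  using finite_H by (simp add: FactGroup_def)

lemma finite_J: "finite J"
  using finite_Q subgroup.subset[OF subgroup_J] finite_subset by blast

text \<open>\<open>J\<close> is a subgroup of the image of \<open>Aut'F2\<close>, whose elements are
  the cosets counted on the right; Lagrange applies.\<close>

lemma card_J_dvd: "card J dvd card (rcosets\<^bsub>AutF2\<lparr>carrier := Aut'F2\<rparr>\<^esub> H)"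
proof -
  let ?J' = "(\<lambda>\<sigma>. H #>\<^sub>A \<sigma>) ` Aut'F2"
  have J': "subgroup ?J' Q" by (rule \<theta>.subgroup_img_is_subgroup[OF subgroup_Aut'])
  interpret J': group "Q\<lparr>carrier := ?J'\<rparr>"
    using Q.subgroup_imp_group[OF J'] .
  have "subgroup J (Q\<lparr>carrier := ?J'\<rparr>)"
    using Q.subgroup_incl[OF subgroup_J J'] AB_subset_Aut' by (auto simp: J_def)
  from J'.lagrange[OF this] have "card ?J' = card (rcosets\<^bsub>Q\<lparr>carrier := ?J'\<rparr>\<^esub> J) * card J"
    by (simp add: order_def)
  then have "card J dvd card ?J'" by simp
  also have "?J' = rcosets\<^bsub>AutF2\<lparr>carrier := Aut'F2\<rparr>\<^esub> H"
    by (auto simp: RCOSETS_def)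
  finally show ?thesis .
qed

text \<open>The added condition is the kernel on \<open>X\<close> of the homomorphism to
  \<open>J\<close> that conjugates by \<open>t\<close> and then applies \<pi> modulo
  \<open>H\<close>.\<close>

lemma index_step:
  assumes X: "subgroup X F2" "X \<subseteq> Delta" and fin: "finite (rcosets\<^sub>F X)"
    and dvd: "card (rcosets\<^sub>F X) dvd m" and t: "t \<in> carrier F2"
  defines "A \<equiv> {w \<in> X. t \<cdot> w \<cdot> inv\<^sub>F t \<in> L}"
  shows "subgroup A F2 \<and> A \<subseteq> Delta \<and> finite (rcosets\<^sub>F A) \<and>
    card (rcosets\<^sub>F A) dvd m * card J"
proof -
  let ?c = "\<lambda>w. t \<cdot> w \<cdot> inv\<^sub>F t"
  let ?h = "\<lambda>w. q (pi_lift (?c w))"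
  have XG: "X \<subseteq> carrier F2" using X(1) by (rule subgroup.subset)
  have c: "?c w \<in> Delta" if "w \<in> X" for w using Delta_conj that X(2) t by blast
  have c_mult: "?c (u \<cdot> v) = ?c u \<cdot> ?c v" if "u \<in> X" "v \<in> X" for u v
    using that XG t by (simp add: F2.m_assoc F2_inv_cancel subset_iff)
  have h: "?h \<in> hom (F2\<lparr>carrier := X\<rparr>) Q"
  proof (rule homI)
    fix u v assume "u \<in> carrier (F2\<lparr>carrier := X\<rparr>)" "v \<in> carrier (F2\<lparr>carrier := X\<rparr>)"
    then have uv: "u \<in> X" "v \<in> X" by simp_all
    show "?h u \<in> carrier Q" by (rule KC.hom_closed[OF free_walk_closed])
    have "?h (u \<cdot> v) = q (pi_lift (?c u) \<cdot> pi_lift (?c v))"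
      using c_mult[OF uv] free_walk_Delta_mult[OF c[OF uv(1)]] by simp
    then show "?h (u \<otimes>\<^bsub>F2\<lparr>carrier := X\<rparr>\<^esub> v) = ?h u \<otimes>\<^bsub>Q\<^esub> ?h v"
      using KC.hom_mult[OF free_walk_closed free_walk_closed] by simp
  qed
  have img: "?h ` X \<subseteq> J"
    using AB_eval_in_AB[OF free_walk_closed] by (auto simp: J_def q_def)
  have eq: "{w \<in> X. ?h w = \<one>\<^bsub>Q\<^esub>} = A"
    using c by (auto simp: A_def L_iff kernel_def)
  have "finite (rcosets\<^bsub>F2\<lparr>carrier := X\<rparr>\<^esub> A)" "card (rcosets\<^bsub>F2\<lparr>carrier := X\<rparr>\<^esub> A) dvd card J"
    using F2.index_kernel_dvd[OF X(1) Q.is_group h subgroup_J finite_J img] unfolding eq by blast+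
  moreover have A: "subgroup A F2"
  proof -
    interpret h: group_hom "F2\<lparr>carrier := X\<rparr>" Q ?h
      using h F2.subgroup_imp_group[OF X(1)] by (simp add: group_hom_def group_hom_axioms_def Q.is_group)
    have "subgroup A (F2\<lparr>carrier := X\<rparr>)"
      using h.subgroup_kernel unfolding eq[symmetric] by (simp add: kernel_def)
    then show ?thesis using F2.incl_subgroup[OF X(1)] by blast
  qed
  moreover have "A \<subseteq> X" by (auto simp: A_def)
  ultimately show ?thesis
    using F2.index_tower[OF A X(1) _ fin] dvd X(2) by (auto intro: mult_dvd_mono)
qed

lemma index_N:
  assumes "n = card (rcosets\<^bsub>AutF2\<lparr>carrier := Aut'F2\<rparr>\<^esub> H)"
  shows "finite (rcosets\<^sub>F (N_sub H))" "card (rcosets\<^sub>F (N_sub H)) dvd 36 * n ^ 4"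
proof -
  define A where "A X t = {w \<in> X. t \<cdot> w \<cdot> inv\<^sub>F t \<in> L}" for X t
  define good where "good X m \<longleftrightarrow> subgroup X F2 \<and> X \<subseteq> Delta \<and> finite (rcosets\<^sub>F X) \<and>
    card (rcosets\<^sub>F X) dvd m" for X m
  have step: "good (A X t) (m * card J)" if "good X m" "t \<in> reps" for X t m
    using index_step[of X m t] that reps_carrier unfolding good_def A_def by blast
  have "good (E_sub 6) 36"
    using subgroup_E E_Delta[of 6] index_E[of 6] by (simp add: good_def)
  \<comment> \<open>The index of \<open>E_sub 6\<close> divides 36, and each of the four
    representatives contributes a factor dividing \<open>card J\<close>.\<close>
  then have "good (A (A (A (A (E_sub 6) \<one>\<^sub>F) gx) gy) (gx \<cdot> gy)) (36 * card J * card J * card J * card J)"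
    by (intro step) simp_all
  moreover have "A (A (A (A (E_sub 6) \<one>\<^sub>F) gx) gy) (gx \<cdot> gy) = N_sub H"
    unfolding A_def set_eq_iff N_iff_reps by blast
  moreover have "36 * card J * card J * card J * card J = 36 * card J ^ 4"
    by (simp add: power4_eq_xxxx)
  ultimately have "good (N_sub H) (36 * card J ^ 4)" by metis
  moreover have "card J ^ 4 dvd n ^ 4" using card_J_dvd assms dvd_power_same by blast
  ultimately show "finite (rcosets\<^sub>F (N_sub H))" "card (rcosets\<^sub>F (N_sub H)) dvd 36 * n ^ 4"
    unfolding good_def by (auto intro: dvd_trans mult_dvd_mono)
qed

sublocale N: normal "N_sub H" F2 by (rule normal_N)

sublocale NC: cayley "F2 Mod N_sub H" "\<lambda>w. N_sub H #>\<^sub>F w"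
  using N.r_coset_hom_Mod N.factorgroup_is_group
  by (simp add: cayley_def group_hom_def group_hom_axioms_def group_F2)

lemma NC_kernel: "kernel F2 (F2 Mod N_sub H) (\<lambda>w. N_sub H #>\<^sub>F w) = N_sub H"
proof -
  have "N_sub H #>\<^sub>F w = N_sub H \<longleftrightarrow> w \<in> N_sub H" if "w \<in> carrier F2" for w
    using F2.coset_join1[OF _ that subgroup_N] F2.coset_join2[OF that subgroup_N] by blast
  then show ?thesis using N.subset by (auto simp: kernel_def)
qed

text \<open>The index is computed along M, D, N, F with
  \<open>D = derived_power (N_sub H) p\<close>. The three steps divide 4, a power of
  \<open>p\<close> whose exponent is the Schreier bound for N, and
  \<open>36 * n ^ 4\<close>.\<close>

lemma index_M:
  assumes n: "n = card (rcosets\<^bsub>AutF2\<lparr>carrier := Aut'F2\<rparr>\<^esub> H)" and "0 < n" "0 < p"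
  shows "M_sub H p \<lhd> F2" "finite (rcosets\<^sub>F (M_sub H p))"
    "card (rcosets\<^sub>F (M_sub H p)) dvd 144 * n ^ 4 * p ^ (36 * n ^ 4 + 1)"
proof -
  define D where "D = derived_power (N_sub H) p"
  have M: "M_sub H p = E_sub 4 \<inter> D" by (simp add: M_sub_def D_def)
  have D: "D \<lhd> F2" unfolding D_def by (rule derived_power_normal[OF normal_N])
  have subD: "subgroup D F2" using D by (rule normal_imp_subgroup)
  have DN: "D \<subseteq> N_sub H" unfolding D_def by (rule derived_power_subset[OF subgroup_N])
  have NE: "N_sub H \<subseteq> E_sub 6" using N_iff by blast
  show "M_sub H p \<lhd> F2"
    unfolding M by (rule F2.normal_subgroup_intersect[OF normal_E D])
  then have subM: "subgroup (M_sub H p) F2" by (rule normal_imp_subgroup)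
  have fin: "finite (carrier (F2 Mod N_sub H))"
    using index_N(1)[OF n] by (simp add: FactGroup_def)
  have card: "card (carrier (F2 Mod N_sub H)) \<le> 36 * n ^ 4"
    using dvd_imp_le[OF index_N(2)[OF n]] \<open>0 < n\<close> by (simp add: FactGroup_def)
  obtain S where S: "finite S" "card S \<le> card (carrier (F2 Mod N_sub H)) + 1" "N_sub H = generate F2 S"
    using NC.kernel_generators[OF fin] unfolding NC_kernel by (auto simp: carrier_FactGroup)
  have "card S \<le> 36 * n ^ 4 + 1" using S(2) card by simp
  from index_derived_power[OF normal_N S(1,3) this \<open>0 < p\<close>]
  have ND: "finite (rcosets\<^bsub>F2\<lparr>carrier := N_sub H\<rparr>\<^esub> D)"
    "card (rcosets\<^bsub>F2\<lparr>carrier := N_sub H\<rparr>\<^esub> D) dvd p ^ (36 * n ^ 4 + 1)"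
    unfolding D_def by blast+
  have FD: "finite (rcosets\<^sub>F D)"
    "card (rcosets\<^sub>F D) = card (rcosets\<^sub>F (N_sub H)) * card (rcosets\<^bsub>F2\<lparr>carrier := N_sub H\<rparr>\<^esub> D)"
    using F2.index_tower[OF subD subgroup_N DN index_N(1)[OF n] ND(1)] by blast+
  have DM: "finite (rcosets\<^bsub>F2\<lparr>carrier := D\<rparr>\<^esub> (M_sub H p))"
    "card (rcosets\<^bsub>F2\<lparr>carrier := D\<rparr>\<^esub> (M_sub H p)) dvd 4"
    using index_Int_E4[OF D] DN NE unfolding M by auto
  have MD: "M_sub H p \<subseteq> D" by (simp add: M)
  have FM: "finite (rcosets\<^sub>F (M_sub H p))"
    "card (rcosets\<^sub>F (M_sub H p)) = card (rcosets\<^sub>F D) * card (rcosets\<^bsub>F2\<lparr>carrier := D\<rparr>\<^esub> (M_sub H p))"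
    using F2.index_tower[OF subM subD MD FD(1) DM(1)] by blast+
  show "finite (rcosets\<^sub>F (M_sub H p))" by (rule FM(1))
  have "card (rcosets\<^sub>F (M_sub H p)) dvd (36 * n ^ 4) * p ^ (36 * n ^ 4 + 1) * 4"
    unfolding FM(2) FD(2) by (intro mult_dvd_mono index_N(2)[OF n] ND(2) DM(2))
  also have "(36 * n ^ 4) * p ^ (36 * n ^ 4 + 1) * 4 = 144 * n ^ 4 * p ^ (36 * n ^ 4 + 1)" by simp
  finally show "card (rcosets\<^sub>F (M_sub H p)) dvd 144 * n ^ 4 * p ^ (36 * n ^ 4 + 1)" .
qed

lemma N_subset_L: "N_sub H \<subseteq> L"
proof
  fix w assume w: "w \<in> N_sub H"
  then have "\<one>\<^sub>F \<cdot> w \<cdot> inv\<^sub>F \<one>\<^sub>F \<in> L" using N_iff F2.one_closed by blast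
  then show "w \<in> L" using N.mem_carrier[OF w] by simp
qed

text \<open>\<open>pi_lift\<close> is multiplicative on \<open>Delta\<close> and maps N into
  \<open>K_free\<close>, so commutators and p-th powers go to commutators and p-th powers.\<close>

lemma free_walk_derived_power:
  assumes "w \<in> derived_power (N_sub H) p"
  shows "w \<in> Delta \<and> pi_lift w \<in> derived_power K_free p"
proof -
  let ?D = "derived_power K_free p"
  have D: "subgroup ?D F2"
    using derived_power_normal[OF normal_K_free] by (rule normal_imp_subgroup)
  have K_free: "subgroup K_free F2" using normal_K_free by (rule normal_imp_subgroup)
  define T where "T = {w \<in> Delta. pi_lift w \<in> ?D}"
  have T: "subgroup T F2"
  proof (rule F2.subgroupI)
    show "T \<subseteq> carrier F2" using Delta_carrier unfolding T_def by blast
    have "\<one>\<^sub>F \<in> T"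
      using subgroup.one_closed[OF subgroup_Delta] subgroup.one_closed[OF D] by (simp add: T_def)
    then show "T \<noteq> {}" by blast
    show "inv\<^sub>F u \<in> T" if "u \<in> T" for u
      using that subgroup.m_inv_closed[OF subgroup_Delta, of u] subgroup.m_inv_closed[OF D]
      by (simp add: T_def free_walk_Delta_inv)
    show "u \<cdot> v \<in> T" if "u \<in> T" "v \<in> T" for u v
      using that subgroup.m_closed[OF subgroup_Delta, of u v] subgroup.m_closed[OF D]
      by (simp add: T_def free_walk_Delta_mult)
  qed
  have ND: "u \<in> Delta" "pi_lift u \<in> K_free" if "u \<in> N_sub H" for u
    using that N_subset_L L_iff by blast+
  have pow: "u [^]\<^bsub>F2\<^esub> k \<in> Delta \<and> pi_lift (u [^]\<^bsub>F2\<^esub> k) = pi_lift u [^]\<^bsub>F2\<^esub> k"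
    if "u \<in> Delta" for u and k :: nat
    using that by (induction k)
      (simp_all add: subgroup.one_closed[OF subgroup_Delta] subgroup.m_closed[OF subgroup_Delta]
        free_walk_Delta_mult)
  have "derived_power (N_sub H) p \<subseteq> T"
  proof (rule derived_power_least[OF T])
    fix u v assume "u \<in> N_sub H" "v \<in> N_sub H"
    note uv = ND[OF this(1)] ND[OF this(2)]
    have uv': "u \<cdot> v \<in> Delta" "inv\<^sub>F u \<in> Delta" "inv\<^sub>F v \<in> Delta"
      using uv subgroup.m_closed[OF subgroup_Delta] subgroup.m_inv_closed[OF subgroup_Delta] by blast+
    then have uvu: "u \<cdot> v \<cdot> inv\<^sub>F u \<in> Delta"
      using subgroup.m_closed[OF subgroup_Delta] by blast
    show "u \<cdot> v \<cdot> inv\<^sub>F u \<cdot> inv\<^sub>F v \<in> T"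
      unfolding T_def
      using subgroup.m_closed[OF subgroup_Delta uvu uv'(3)] derived_power_memI(1)[OF K_free uv(2,4)]
        free_walk_Delta_mult[OF uvu] free_walk_Delta_mult[OF uv'(1)] free_walk_Delta_mult[OF uv(1)]
        free_walk_Delta_inv[OF uv(1)] free_walk_Delta_inv[OF uv(3)] by simp
  next
    fix u assume "u \<in> N_sub H"
    note u = ND[OF this]
    show "u [^]\<^bsub>F2\<^esub> p \<in> T"
      unfolding T_def using pow[OF u(1), of p] derived_power_memI(2)[OF K_free u(2)] by simp
  qed
  then show ?thesis using assms by (auto simp: T_def)
qed

section \<open>The congruence subgroup of \<open>M\<close>\<close>

lemma trivial_mod_M:
  assumes p: "2 < p" and \<sigma>: "\<sigma> \<in> trivial_mod (M_sub H p)" and M: "M_sub H p \<lhd> F2"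
    and finN: "finite (rcosets\<^sub>F (N_sub H))"
  shows "\<sigma> \<in> H"
proof -
  have \<sigma>c: "\<sigma> \<in> carrier AutF2" using \<sigma> by (simp add: trivial_mod_def)
  have subM: "subgroup (M_sub H p) F2" using M by (rule normal_imp_subgroup)
  have \<sigma>M: "\<sigma> w \<cdot> inv\<^sub>F w \<in> M_sub H p" if "w \<in> carrier F2" for w
    using \<sigma> that F2.r_coset_eq_iff[OF subM AutF2_closed[OF \<sigma>c that] that]
    unfolding trivial_mod_def by blast
  have \<sigma>E: "\<sigma> w \<cdot> inv\<^sub>F w \<in> E_sub 4"
    and \<sigma>D: "\<sigma> w \<cdot> inv\<^sub>F w \<in> derived_power (N_sub H) p" if "w \<in> carrier F2" for w
    using \<sigma>M[OF that] unfolding M_sub_def by blast+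
  have "\<sigma> \<in> InnAB"
  proof (rule congruent_mod_4_in_InnAB[OF \<sigma>c])
    fix w h assume w: "w \<in> carrier F2"
    show "4 dvd expsum h (\<sigma> w) - expsum h w"
      using expsum_E[OF \<sigma>E[OF w], of h] w \<sigma>c by (simp add: expsum_mult expsum_inv)
  qed
  then obtain g \<delta> where g: "g \<in> carrier F2" and \<delta>: "\<delta> \<in> AB" and \<sigma>_eq: "\<sigma> = inner_aut g \<star> \<delta>"
    by (auto simp: InnAB_def)
  define c where "c = gx \<cdot> gy \<cdot> inv\<^sub>F gx \<cdot> inv\<^sub>F gy"
  have cc: "c \<in> carrier F2" by (simp add: c_def)
  \<comment> \<open>As \<delta> fixes \<open>c\<close>, only the conjugation by \<open>g\<close>
    acts on it, so \<open>g\<close> commutes with \<open>c\<close> modulo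
    \<open>derived_power (N_sub H) p\<close>.\<close>
  have "\<sigma> c = g \<cdot> c \<cdot> inv\<^sub>F g"
    using AB_fixes_commutator[OF \<delta>] cc g \<delta> by (simp add: \<sigma>_eq c_def[symmetric])
  then have comm: "g \<cdot> c \<cdot> inv\<^sub>F g \<cdot> inv\<^sub>F c \<in> derived_power (N_sub H) p"
    using \<sigma>D[OF cc] by simp
  let ?R = "F2 Mod N_sub H"
  have finR: "finite (carrier ?R)" using finN by (simp add: FactGroup_def)
  \<comment> \<open>The order of F/N serves as the positive exponent that brings \<open>c\<close>
    into N, so that the powers of \<open>c\<close> close up to a loop.\<close>
  have "0 < order ?R" using NC.H.order_gt_0_iff_finite finR by blast
  moreover have "(N_sub H #>\<^sub>F c) [^]\<^bsub>?R\<^esub> order ?R = \<one>\<^bsub>?R\<^esub>"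
    by (rule NC.H.pow_order_eq_1[OF NC.hom_closed[OF cc]])
  ultimately have "N_sub H #>\<^sub>F g \<in> generate ?R {N_sub H #>\<^sub>F c}"
    using NC.commutator_centralizer[OF g p, of "order ?R"] comm unfolding NC_kernel c_def[symmetric] by blast
  then obtain k :: int where "N_sub H #>\<^sub>F g = (N_sub H #>\<^sub>F c) [^]\<^bsub>?R\<^esub> k"
    using NC.H.generate_pow[OF NC.hom_closed[OF cc]] by blast
  also have "\<dots> = N_sub H #>\<^sub>F (c [^]\<^bsub>F2\<^esub> k)"
    by (rule NC.hom_int_pow[OF cc, symmetric])
  finally have \<nu>: "g \<cdot> inv\<^sub>F (c [^]\<^bsub>F2\<^esub> k) \<in> N_sub H"
    using F2.r_coset_eq_iff[OF subgroup_N g F2.int_pow_closed[OF cc]] by blast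
  \<comment> \<open>\<open>c\<close> is the inverse of \<open>e2\<close>, on which \<pi> is trivial.
    So the power of \<open>c\<close> contained in \<open>g\<close> does not contribute to
    \<open>pi_lift g\<close>.\<close>
  have ck: "c [^]\<^bsub>F2\<^esub> k \<in> Delta \<and> pi_lift (c [^]\<^bsub>F2\<^esub> k) = \<one>\<^sub>F"
  proof -
    have T: "subgroup {d \<in> Delta. pi_lift d = \<one>\<^sub>F} F2"
    proof (rule F2.subgroupI)
      show "{d \<in> Delta. pi_lift d = \<one>\<^sub>F} \<noteq> {}"
        using subgroup.one_closed[OF subgroup_Delta] free_walk_one by blast
    qed (auto simp: free_walk_Delta_mult free_walk_Delta_inv subgroup.m_closed[OF subgroup_Delta]
        subgroup.m_inv_closed[OF subgroup_Delta])
    have "c = inv\<^sub>F e2"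
      by (simp add: c_def e2_def F2.inv_mult_group F2.m_assoc)
    moreover have "pi_lift e2 = \<one>\<^sub>F" by (simp add: e_words)
    ultimately have "c \<in> {d \<in> Delta. pi_lift d = \<one>\<^sub>F}"
      using subgroup.m_inv_closed[OF subgroup_Delta e_in_Delta(2)] e_in_Delta(2)
      by (simp add: free_walk_Delta_inv)
    then show ?thesis using F2.subgroup_int_pow_closed[OF T] by blast
  qed
  define \<nu> where "\<nu> = g \<cdot> inv\<^sub>F (c [^]\<^bsub>F2\<^esub> k)"
  have \<nu>L: "\<nu> \<in> Delta" "pi_lift \<nu> \<in> K_free"
    using \<nu> N_subset_L L_iff unfolding \<nu>_def by blast+
  have g_eq: "g = \<nu> \<cdot> c [^]\<^bsub>F2\<^esub> k"
    using g cc by (simp add: \<nu>_def F2.m_assoc)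
  have gD: "g \<in> Delta"
    unfolding g_eq using subgroup.m_closed[OF subgroup_Delta \<nu>L(1)] ck by blast
  have gK: "pi_lift g \<in> K_free"
    unfolding g_eq using \<nu>L ck by (simp add: free_walk_Delta_mult)
  obtain u where "twisted_by \<delta> u" and \<delta>D: "\<And>d. d \<in> carrier F2 \<Longrightarrow> \<delta> d \<in> Delta \<longleftrightarrow> d \<in> Delta"
    using AB_twist[OF \<delta>] by blast
  then obtain g' where u: "u \<in> carrier F2"
    and twist: "\<And>d. d \<in> Delta \<Longrightarrow> pi_lift (\<delta> d) = u \<cdot> pi_lift d \<cdot> inv\<^sub>F u"
    and g': "g' \<in> carrier F2" "flip \<star> \<delta> \<star> flip = inner_aut g' \<star> AB_eval u"
    unfolding twisted_by_def by blast
  \<comment> \<open>After \<open>pi_lift\<close>, \<sigma> acts on \<open>Delta\<close> as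
    conjugation by \<open>z\<close>: the inner part contributes \<open>pi_lift g\<close>, available
    since \<open>g\<close> lies in \<open>Delta\<close>, and \<delta> contributes
    \<open>u\<close>.\<close>
  define z where "z = pi_lift g \<cdot> u"
  have z: "z \<in> carrier F2" using u by (simp add: z_def)
  have "z \<cdot> v \<cdot> inv\<^sub>F z \<cdot> inv\<^sub>F v \<in> derived_power K_free p" if v: "v \<in> carrier F2" for v
  proof -
    \<comment> \<open>Every \<open>v\<close> is a value of the lift, so triviality of \<sigma> at a
      preimage \<open>d\<close> says that \<open>z\<close> commutes with \<open>v\<close> modulo
      \<open>derived_power K_free p\<close>.\<close>
    obtain d where d: "d \<in> Delta" "pi_lift d = v" using free_walk_surj[OF v] by blast
    have dc: "d \<in> carrier F2" using d(1) by simp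
    have \<delta>d: "\<delta> d \<in> Delta" using \<delta>D[OF dc] d(1) by simp
    have gd: "g \<cdot> \<delta> d \<in> Delta" using subgroup.m_closed[OF subgroup_Delta gD \<delta>d] .
    have gdg: "g \<cdot> \<delta> d \<cdot> inv\<^sub>F g \<in> Delta" using Delta_conj[OF \<delta>d g] .
    have "\<sigma> d = g \<cdot> \<delta> d \<cdot> inv\<^sub>F g" using dc g \<delta> by (simp add: \<sigma>_eq)
    then have "pi_lift (\<sigma> d \<cdot> inv\<^sub>F d)
        = pi_lift g \<cdot> (u \<cdot> v \<cdot> inv\<^sub>F u) \<cdot> inv\<^sub>F (pi_lift g) \<cdot> inv\<^sub>F v"
      using free_walk_Delta_mult[OF gdg] free_walk_Delta_mult[OF gd] free_walk_Delta_mult[OF gD]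
        free_walk_Delta_inv[OF gD] free_walk_Delta_inv[OF d(1)] twist[OF d(1)] d(2) by simp
    also have "\<dots> = z \<cdot> v \<cdot> inv\<^sub>F z \<cdot> inv\<^sub>F v"
      using u v by (simp add: z_def F2.m_assoc F2.inv_mult_group)
    finally show ?thesis
      using free_walk_derived_power[OF \<sigma>D[OF dc]] by simp
  qed
  then have comm_z: "z \<cdot> v \<cdot> inv\<^sub>F z \<cdot> inv\<^sub>F v \<in> derived_power K_free p" if "v \<in> K_free" for v
    using that KC.K_D(1) by blast
  have "0 < order Q" using Q.order_gt_0_iff_finite finite_Q by blast
  moreover have "q gx [^]\<^bsub>Q\<^esub> order Q = \<one>\<^bsub>Q\<^esub>" "q gy [^]\<^bsub>Q\<^esub> order Q = \<one>\<^bsub>Q\<^esub>"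
    by (rule Q.pow_order_eq_1[OF KC.hom_closed], simp)+
  ultimately have "z \<in> K_free"
    using KC.commuting_trivial[OF z, of p "order Q"] p comm_z by simp
  then have "inv\<^sub>F (pi_lift g) \<cdot> z \<in> K_free"
    using subgroup.m_closed[OF KC.subgroup_K subgroup.m_inv_closed[OF KC.subgroup_K gK]] by blast
  then have "u \<in> K_free" using u by (simp add: z_def F2_inv_cancel)
  then have "AB_eval u \<in> H" using K_free_iff by blast
  moreover have inn: "inner_aut h \<in> H" if "h \<in> carrier F2" for h
    using that Inn_H by (auto simp: InnF2_eq)
  ultimately have fdf: "flip \<star> \<delta> \<star> flip \<in> H"
    unfolding g'(2) using H.m_closed g'(1) by blast
  \<comment> \<open>\<open>AB_eval u\<close> is the conjugate of \<delta> by \<open>flip\<close> up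
    to an inner automorphism; normality of \<open>H\<close> in the full automorphism group undoes
    the conjugation.\<close>
  have "flip \<star> (flip \<star> \<delta> \<star> flip) \<star> inv\<^sub>A flip \<in> H"
    by (rule H.inv_op_closed2[OF auts_closed(2) fdf])
  moreover have "flip \<star> (flip \<star> \<delta> \<star> flip) \<star> inv\<^sub>A flip = \<delta>"
    using \<delta> flip_inv by (metis AB_closed AutF2.inv_mult_cancel(1) AutF2.inv_closed AutF2.inv_solve_right AutF2.m_assoc AutF2.m_closed auts_closed(2))
  ultimately have "\<delta> \<in> H" by simp
  then show ?thesis unfolding \<sigma>_eq using H.m_closed inn[OF g] by blast
qed

end

theorem theorem2p9:
  fixes H :: "(word \<Rightarrow> word) set" and n p :: nat
  assumes "H \<lhd> AutF2"
    and "finite (rcosets\<^bsub>AutF2\<^esub> H)"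
    and "InnF2 \<subseteq> H"
    and "H \<subseteq> Aut'F2"
    and "n = card (rcosets\<^bsub>AutF2\<lparr>carrier := Aut'F2\<rparr>\<^esub> H)"
    and "prime p"
    and "\<not> p dvd 6 * n"
  shows "M_sub H p \<lhd> F2
    \<and> finite (rcosets\<^bsub>F2\<^esub> (M_sub H p))
    \<and> card (rcosets\<^bsub>F2\<^esub> (M_sub H p)) dvd 144 * n ^ 4 * p ^ (36 * n ^ 4 + 1)
    \<and> trivial_mod (M_sub H p) \<subseteq> H"
proof -
  interpret congruence_quotient H
    using assms(1-3) by (rule congruence_quotient.intro)
  \<comment> \<open>Every number divides 0, so \<open>n = 0\<close> contradicts the last
    assumption.\<close>
  have "0 < n" using assms(7) by (intro gr0I) simp
  \<comment> \<open>2 divides \<open>6 * n\<close>; hence \<open>2 < p\<close>, as the edge counts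
    for \<open>c\<close> require.\<close>
  have "p \<noteq> 2" using assms(7) by (auto intro: dvd_mult2)
  then have "2 < p" using prime_ge_2_nat[OF assms(6)] by simp
  note M = index_M[OF assms(5) \<open>0 < n\<close>, of p]
  have "0 < p" using \<open>2 < p\<close> by simp
  have "trivial_mod (M_sub H p) \<subseteq> H"
    using trivial_mod_M[OF \<open>2 < p\<close> _ M(1)[OF \<open>0 < p\<close>] index_N(1)[OF assms(5)]] by blast
  then show ?thesis using M[OF \<open>0 < p\<close>] by blast
qed

end
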